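(* Let $W_S$ be an irreducible right-angled Coxeter group of rank $N$ with $3\le N<\infty$. For each integer $n\ge N$, there is a finite-index reflection subgroup $\Gamma_n$ of $W_S$ and a representation $\rho_n:\Gamma_n\to\mathrm{GL}_n(\mathbb{R})$ of $\Gamma_n$ as a reflection group which is injective, has image contained in $\mathrm{SL}^\pm_n(\mathbb{Z})$, and whose image is Zariski-dense in $\mathrm{SL}^\pm_n(\mathbb{R})$. Moreover, if the Coxeter diagram of $W_S$ is not a tree, one may take $\Gamma_N=W_S$.
   Context: A Coxeter group $W_S$ is given by a finite set $S$ and a symmetric matrix $(m_{st})_{s,t\in S}$ with $m_{ss}=1$ and $m_{st}\in\{2,3,\dots,\infty\}$ for $s\neq t$; it is the group presented by generators $S$ and relations $(st)^{m_{st}}=1$ whenever $m_{st}<\infty$. Its rank is $|S|$. Its Coxeter diagram is the graph with vertex set $S$, with an edge labelled $m_{st}$ between $s\ne t$ iff $m_{st}\ge3$; $W_S$ is irreducible if this graph is connected, and right-angled if $m_{st}\in\{2,\infty\}$ for all $s\ne t$. A reflection of $W_S$ is an element conjugate to an element of $S$; a reflection subgroup is a subgroup generated by reflections. A finite-index (hence finitely generated) reflection subgroup is itself naturally a Coxeter group with respect to a canonical finite generating set of reflections, and "representation as a reflection group" refers to this Coxeter structure. A Cartan matrix on $S$ is a real matrix $\mathscr{A}=(\mathscr{A}_{st})$ with $\mathscr{A}_{ss}=2$, $\mathscr{A}_{st}\le 0$ for $s\ne t$, and $\mathscr{A}_{st}=0\iff\mathscr{A}_{ts}=0$; it is compatible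 with $W_S$ if for $s\ne t$: $m_{st}=2\iff\mathscr{A}_{st}=0$; $m_{st}<\infty\Rightarrow\mathscr{A}_{st}\mathscr{A}_{ts}=4\cos^2(\pi/m_{st})$; $m_{st}=\infty\Rightarrow\mathscr{A}_{st}\mathscr{A}_{ts}\ge 4$. A representation $\rho:W_S\to\mathrm{GL}(V)$ ($V$ a finite-dimensional real vector space) is a representation as a reflection group if there are $\alpha_s\in V^*$, $v_s\in V$ with $\alpha_s(v_s)=2$, $\rho(s)(x)=x-\alpha_s(x)v_s$, such that $(\alpha_s(v_t))_{s,t}$ is a Cartan matrix compatible with $W_S$ and the cone $\bigcap_s\{\alpha_s\le0\}$ has nonempty interior. *)

theory Defs
  imports "HOL-Algebra.Coset" "HOL-Algebra.Generated_Groups" "HOL-Library.Extended_Nat"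
    "Jordan_Normal_Form.Determinant"
begin

definition coxeter_matrix :: "'s set \<Rightarrow> ('s \<Rightarrow> 's \<Rightarrow> enat) \<Rightarrow> bool" where
  "coxeter_matrix S m \<longleftrightarrow> finite S \<and> (\<forall>s\<in>S. m s s = 1) \<and>
     (\<forall>s\<in>S. \<forall>t\<in>S. m s t = m t s) \<and> (\<forall>s\<in>S. \<forall>t\<in>S. s \<noteq> t \<longrightarrow> m s t \<ge> 2)"

definition right_angled :: "'s set \<Rightarrow> ('s \<Rightarrow> 's \<Rightarrow> enat) \<Rightarrow> bool" where
  "right_angled S m \<longleftrightarrow> (\<forall>s\<in>S. \<forall>t\<in>S. s \<noteq> t \<longrightarrow> m s t = 2 \<or> m s t = \<infinity>)"

definition diagram_adj :: "'s set \<Rightarrow> ('s \<Rightarrow> 's \<Rightarrow> enat) \<Rightarrow> 's \<Rightarrow> 's \<Rightarrow> bool" where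
  "diagram_adj S m s t \<longleftrightarrow> s \<in> S \<and> t \<in> S \<and> s \<noteq> t \<and> m s t \<ge> 3"

definition diagram_connected :: "'s set \<Rightarrow> ('s \<Rightarrow> 's \<Rightarrow> enat) \<Rightarrow> bool" where
  "diagram_connected S m \<longleftrightarrow> (\<forall>s\<in>S. \<forall>t\<in>S. (diagram_adj S m)\<^sup>*\<^sup>* s t)"

definition irreducible_coxeter :: "'s set \<Rightarrow> ('s \<Rightarrow> 's \<Rightarrow> enat) \<Rightarrow> bool" where
  "irreducible_coxeter S m \<longleftrightarrow> diagram_connected S m"

definition diagram_has_cycle :: "'s set \<Rightarrow> ('s \<Rightarrow> 's \<Rightarrow> enat) \<Rightarrow> bool" where
  "diagram_has_cycle S m \<longleftrightarrow> (\<exists>vs. length vs \<ge> 3 \<and> distinct vs \<and> set vs \<subseteq> S \<and>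
      (\<forall>i<length vs. diagram_adj S m (vs ! i) (vs ! ((i + 1) mod length vs))))"

definition diagram_is_tree :: "'s set \<Rightarrow> ('s \<Rightarrow> 's \<Rightarrow> enat) \<Rightarrow> bool" where
  "diagram_is_tree S m \<longleftrightarrow> diagram_connected S m \<and> \<not> diagram_has_cycle S m"

text \<open>Since all generators are involutions, W_S is the monoid on words over S modulo the
  congruence generated by (st)^(m_st) = 1 (m_st finite); this includes s^2 = 1 as m_ss = 1.\<close>
inductive cox_eq :: "'s set \<Rightarrow> ('s \<Rightarrow> 's \<Rightarrow> enat) \<Rightarrow> 's list \<Rightarrow> 's list \<Rightarrow> bool"
  for S m where
  refl: "cox_eq S m w w"
| sym: "cox_eq S m v w \<Longrightarrow> cox_eq S m w v"
| trans: "cox_eq S m u v \<Longrightarrow> cox_eq S m v w \<Longrightarrow> cox_eq S m u w"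
| ctx: "cox_eq S m v w \<Longrightarrow> cox_eq S m (a @ v @ b) (a @ w @ b)"
| rel: "s \<in> S \<Longrightarrow> t \<in> S \<Longrightarrow> m s t = enat k \<Longrightarrow> cox_eq S m (concat (replicate k [s, t])) []"

definition cox_class :: "'s set \<Rightarrow> ('s \<Rightarrow> 's \<Rightarrow> enat) \<Rightarrow> 's list \<Rightarrow> 's list set" where
  "cox_class S m w = {v. set v \<subseteq> S \<and> cox_eq S m v w}"

definition coxeter_group :: "'s set \<Rightarrow> ('s \<Rightarrow> 's \<Rightarrow> enat) \<Rightarrow> 's list set monoid" where
  "coxeter_group S m = \<lparr> carrier = {cox_class S m w | w. set w \<subseteq> S},
      monoid.mult = (\<lambda>A B. cox_class S m ((SOME a. a \<in> A) @ (SOME b. b \<in> B))),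
      monoid.one = cox_class S m [] \<rparr>"

definition cox_gen :: "'s set \<Rightarrow> ('s \<Rightarrow> 's \<Rightarrow> enat) \<Rightarrow> 's \<Rightarrow> 's list set" where
  "cox_gen S m s = cox_class S m [s]"

definition cox_length :: "'s set \<Rightarrow> ('s \<Rightarrow> 's \<Rightarrow> enat) \<Rightarrow> 's list set \<Rightarrow> nat" where
  "cox_length S m x = (LEAST k. \<exists>w. length w = k \<and> set w \<subseteq> S \<and> cox_class S m w = x)"

definition cox_reflections :: "'s set \<Rightarrow> ('s \<Rightarrow> 's \<Rightarrow> enat) \<Rightarrow> 's list set set" where
  "cox_reflections S m = {g \<otimes>\<^bsub>coxeter_group S m\<^esub> cox_gen S m s \<otimes>\<^bsub>coxeter_group S m\<^esub> inv\<^bsub>coxeter_group S m\<^esub> g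
       | g s. g \<in> carrier (coxeter_group S m) \<and> s \<in> S}"

definition reflection_subgroup :: "'s set \<Rightarrow> ('s \<Rightarrow> 's \<Rightarrow> enat) \<Rightarrow> 's list set set \<Rightarrow> bool" where
  "reflection_subgroup S m \<Gamma> \<longleftrightarrow>
     (\<exists>X. X \<subseteq> cox_reflections S m \<and> \<Gamma> = generate (coxeter_group S m) X)"

definition finite_index :: "('a, 'b) monoid_scheme \<Rightarrow> 'a set \<Rightarrow> bool" where
  "finite_index G H \<longleftrightarrow> finite (rcosets\<^bsub>G\<^esub> H)"

text \<open>Canonical Coxeter generators of a reflection subgroup (Dyer, Deodhar):
  chi(Gamma) = {t in T : N(t) \<inter> Gamma = {t}}, with N(w) = {t in T : l(t w) < l(w)}.\<close>
definition canonical_gens :: "'s set \<Rightarrow> ('s \<Rightarrow> 's \<Rightarrow> enat) \<Rightarrow> 's list set set \<Rightarrow> 's list set set" where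
  "canonical_gens S m \<Gamma> = {t \<in> cox_reflections S m \<inter> \<Gamma>.
      \<forall>t' \<in> cox_reflections S m \<inter> \<Gamma>.
         cox_length S m (t' \<otimes>\<^bsub>coxeter_group S m\<^esub> t) < cox_length S m t \<longrightarrow> t' = t}"

definition elt_order :: "('a, 'b) monoid_scheme \<Rightarrow> 'a \<Rightarrow> enat" where
  "elt_order G x = (if \<exists>k>0. x [^]\<^bsub>G\<^esub> (k::nat) = \<one>\<^bsub>G\<^esub>
      then enat (LEAST k. k > 0 \<and> x [^]\<^bsub>G\<^esub> (k::nat) = \<one>\<^bsub>G\<^esub>) else \<infinity>)"

definition sub_coxeter_matrix :: "'s set \<Rightarrow> ('s \<Rightarrow> 's \<Rightarrow> enat) \<Rightarrow> 's list set \<Rightarrow> 's list set \<Rightarrow> enat" where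
  "sub_coxeter_matrix S m r r' = elt_order (coxeter_group S m) (r \<otimes>\<^bsub>coxeter_group S m\<^esub> r')"

definition cartan_compatible :: "'i set \<Rightarrow> ('i \<Rightarrow> 'i \<Rightarrow> enat) \<Rightarrow> ('i \<Rightarrow> 'i \<Rightarrow> real) \<Rightarrow> bool" where
  "cartan_compatible I m A \<longleftrightarrow> (\<forall>s\<in>I. A s s = 2) \<and>
     (\<forall>s\<in>I. \<forall>t\<in>I. s \<noteq> t \<longrightarrow>
        A s t \<le> 0 \<and> (A s t = 0 \<longleftrightarrow> A t s = 0) \<and>
        (m s t = 2 \<longleftrightarrow> A s t = 0) \<and>
        (\<forall>k. m s t = enat k \<longrightarrow> A s t * A t s = 4 * (cos (pi / real k))\<^sup>2) \<and>
        (m s t = \<infinity> \<longrightarrow> A s t * A t s \<ge> 4))"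

definition matrix_rep :: "nat \<Rightarrow> ('a, 'b) monoid_scheme \<Rightarrow> 'a set \<Rightarrow> ('a \<Rightarrow> real mat) \<Rightarrow> bool" where
  "matrix_rep n Gr G \<rho> \<longleftrightarrow> (\<forall>g\<in>G. \<rho> g \<in> carrier_mat n n) \<and> \<rho> \<one>\<^bsub>Gr\<^esub> = 1\<^sub>m n \<and>
     (\<forall>g\<in>G. \<forall>h\<in>G. \<rho> (g \<otimes>\<^bsub>Gr\<^esub> h) = \<rho> g * \<rho> h)"

text \<open>Representation as a reflection group w.r.t. the Coxeter generators I with Coxeter matrix mI,
  on V = R^n, with alpha_s in V^* given via the standard dot product.\<close>
definition reflection_rep :: "nat \<Rightarrow> ('a, 'b) monoid_scheme \<Rightarrow> 'a set \<Rightarrow> 'a set \<Rightarrow>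
     ('a \<Rightarrow> 'a \<Rightarrow> enat) \<Rightarrow> ('a \<Rightarrow> real mat) \<Rightarrow> bool" where
  "reflection_rep n Gr G I mI \<rho> \<longleftrightarrow> matrix_rep n Gr G \<rho> \<and>
     (\<exists>\<alpha> v :: 'a \<Rightarrow> real vec.
        (\<forall>s\<in>I. \<alpha> s \<in> carrier_vec n \<and> v s \<in> carrier_vec n \<and> \<alpha> s \<bullet> v s = 2 \<and>
            (\<forall>x\<in>carrier_vec n. \<rho> s *\<^sub>v x = x - (\<alpha> s \<bullet> x) \<cdot>\<^sub>v v s)) \<and>
        cartan_compatible I mI (\<lambda>s t. \<alpha> s \<bullet> v t) \<and>
        (\<exists>x\<in>carrier_vec n. \<exists>\<epsilon>>0. \<forall>y\<in>carrier_vec n.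
            (\<Sum>i<n. (y $ i - x $ i)\<^sup>2) < \<epsilon>\<^sup>2 \<longrightarrow> (\<forall>s\<in>I. \<alpha> s \<bullet> y \<le> 0)))"

definition SLpm_R :: "nat \<Rightarrow> real mat set" where
  "SLpm_R n = {A \<in> carrier_mat n n. det A = 1 \<or> det A = -1}"

definition SLpm_Z :: "nat \<Rightarrow> real mat set" where
  "SLpm_Z n = {A \<in> SLpm_R n. \<forall>i<n. \<forall>j<n. A $$ (i, j) \<in> \<int>}"

inductive_set poly_fun :: "nat \<Rightarrow> (real mat \<Rightarrow> real) set" for n where
  const: "(\<lambda>A. c) \<in> poly_fun n"
| entry: "i < n \<Longrightarrow> j < n \<Longrightarrow> (\<lambda>A. A $$ (i, j)) \<in> poly_fun n"
| add: "p \<in> poly_fun n \<Longrightarrow> q \<in> poly_fun n \<Longrightarrow> (\<lambda>A. p A + q A) \<in> poly_fun n"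
| mult: "p \<in> poly_fun n \<Longrightarrow> q \<in> poly_fun n \<Longrightarrow> (\<lambda>A. p A * q A) \<in> poly_fun n"

definition zariski_dense_in :: "nat \<Rightarrow> real mat set \<Rightarrow> real mat set \<Rightarrow> bool" where
  "zariski_dense_in n Y X \<longleftrightarrow> Y \<subseteq> X \<and>
     (\<forall>p\<in>poly_fun n. (\<forall>A\<in>Y. p A = 0) \<longrightarrow> (\<forall>A\<in>X. p A = 0))"

definition good_rep :: "'s set \<Rightarrow> ('s \<Rightarrow> 's \<Rightarrow> enat) \<Rightarrow> nat \<Rightarrow> 's list set set \<Rightarrow>
     ('s list set \<Rightarrow> real mat) \<Rightarrow> bool" where
  "good_rep S m n \<Gamma> \<rho> \<longleftrightarrow>
     reflection_rep n (coxeter_group S m) \<Gamma> (canonical_gens S m \<Gamma>) (sub_coxeter_matrix S m) \<rho> \<and>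
     inj_on \<rho> \<Gamma> \<and> \<rho> ` \<Gamma> \<subseteq> SLpm_Z n \<and> zariski_dense_in n (\<rho> ` \<Gamma>) (SLpm_R n)"

end

theory Submission
  imports Defs "HOL-Computational_Algebra.Polynomial" "HOL-Library.Numeral_Type"
begin

text \<open>
  Let \<open>a\<close> and \<open>b\<close> be generators with \<open>m a b = \<infinity>\<close>. The chambers \<open>1, a, ab, aba, \<dots>\<close> (\<open>k\<close> of them) form a
  fundamental domain of a reflection subgroup \<open>\<Gamma>\<close> of index \<open>k\<close>, whose canonical generators are the
  reflections in the walls of this domain; \<open>\<Gamma>\<close> is again right-angled. For \<open>k = 1\<close> it is \<open>W\<close> itself.
  If \<open>W\<close> has Cartan matrix with entries \<open>2\<close>, \<open>0\<close> and \<open>-3\<close>, the pairings of the canonical generators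
  of \<open>\<Gamma>\<close> are \<open>0\<close> or at most \<open>-3\<close>, which leaves room to deform.

  If the diagram has a cycle, \<open>k = 1\<close> works in dimension \<open>N\<close>. If it is a tree, doubling along a leaf
  (\<open>k = 2\<close>) keeps the rank and creates a cycle. For \<open>n = N + j\<close>, a large \<open>k\<close> gives many pairwise
  non-commuting reflections, and \<open>j\<close> new coordinates are used to perturb their pairings.

  Faithfulness is a ping-pong argument. For density, consider the Lie algebra of matrices \<open>Y\<close> for which
  the derivation \<open>A \<mapsto> A Y\<close> preserves the polynomials vanishing on the image. Each product of two
  reflections generating an infinite dihedral group contributes \<open>A\<^sub>x\<^sub>y v\<^sub>x \<otimes> \<alpha>\<^sub>y - A\<^sub>y\<^sub>x v\<^sub>y \<otimes> \<alpha>\<^sub>x\<close>. A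
  cycle along which the Cartan matrix cannot be symmetrized yields all the traceless combinations for one
  edge, these spread over the connected diagram, and one obtains every elementary matrix.
\<close>

section \<open>Reflection actions of right-angled Coxeter groups\<close>

text \<open>Why a cycle: over a forest a Cartan matrix becomes symmetric after rescaling the pairs
  \<alpha>, v. When the v form a basis, a symmetric matrix makes the image preserve a nonzero
  symmetric bilinear form, which rules out density. Unequal opposite entries on one edge of an
  otherwise symmetric cycle cannot be rescaled away. Why -3: the matrices must be integral. Opposite
  entries must have product greater than 4, since at 4 a product of two reflections is unipotent and
  the Lie algebra computations degenerate. Divisibility by 3 of all off-diagonal entries makes the
  determinant a power of 2 modulo 3, hence nonzero for every diagram, and it leaves a gap between
  the possible pairings of walls. The group is given by words modulo relations only, and a single
  sign estimate, \<open>act_sign\<close>, supplies everything about it. It is used for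
  \<open>cartan0\<close> (reduced words, exchange), for the matrix \<open>B\<close> of \<Gamma> (its
  presentation), and for the deformed matrix (injectivity).\<close>

definition step :: "('i \<Rightarrow> 'i \<Rightarrow> 'a::comm_ring_1) \<Rightarrow> 'i \<Rightarrow> ('i \<Rightarrow> 'a) \<Rightarrow> 'i \<Rightarrow> 'a" where
  "step A r h = (\<lambda>x. h x - A x r * h r)"

text \<open>\<open>h x\<close> stands for the value of the form of \<open>x\<close> at a point, so
  \<open>step\<close> is a reflection written in these coordinates. The last letter of a word acts
  first.\<close>

definition act :: "('i \<Rightarrow> 'i \<Rightarrow> 'a::comm_ring_1) \<Rightarrow> 'i list \<Rightarrow> ('i \<Rightarrow> 'a) \<Rightarrow> 'i \<Rightarrow> 'a" where
  "act A w h = foldr (step A) w h"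

lemma act_simps [simp]: "act A [] h = h" "act A (r # w) h = step A r (act A w h)"
  and act_append: "act A (u @ w) h = act A u (act A w h)"
  by (simp_all add: act_def)

text \<open>The letters that commutations alone can bring to the front of the word, that is, its
  visible left descents.\<close>

fun desc :: "('i \<Rightarrow> 'i \<Rightarrow> enat) \<Rightarrow> 'i list \<Rightarrow> 'i set" where
  "desc m [] = {}"
| "desc m (r # w) = insert r {t \<in> desc m w. m t r = 2}"

fun good_word :: "('i \<Rightarrow> 'i \<Rightarrow> enat) \<Rightarrow> 'i list \<Rightarrow> bool" where
  "good_word m [] = True"
| "good_word m (r # w) = (r \<notin> desc m w \<and> good_word m w)"

lemma desc_subset: "desc m w \<subseteq> set w"
  by (induction w) auto

lemma cox_eq_append:
  "cox_eq I m u u' \<Longrightarrow> cox_eq I m w w' \<Longrightarrow> cox_eq I m (u @ w) (u' @ w')"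
  using cox_eq.ctx[of I m u u' "[]" w] cox_eq.ctx[of I m w w' u' "[]"]
  by (auto intro: cox_eq.trans)

lemma cox_eq_Cons: "cox_eq I m u w \<Longrightarrow> cox_eq I m (x # u) (x # w)"
  using cox_eq.ctx[of I m u w "[x]" "[]"] by simp

lemma enat_2: "2 = enat 2" and enat_1: "1 = enat 1"
  by (simp_all add: numeral_eq_enat one_enat_def)

locale ra_matrix =
  fixes I :: "'i set" and m :: "'i \<Rightarrow> 'i \<Rightarrow> enat"
  assumes m_diag: "s \<in> I \<Longrightarrow> m s s = 1"
    and m_sym: "s \<in> I \<Longrightarrow> t \<in> I \<Longrightarrow> m s t = m t s"
    and m_off: "s \<in> I \<Longrightarrow> t \<in> I \<Longrightarrow> s \<noteq> t \<Longrightarrow> m s t = 2 \<or> m s t = \<infinity>"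
begin

definition compat :: "('i \<Rightarrow> 'i \<Rightarrow> 'a::linordered_idom) \<Rightarrow> bool" where
  "compat A \<longleftrightarrow> (\<forall>s\<in>I. A s s = 2) \<and> (\<forall>s\<in>I. \<forall>t\<in>I. s \<noteq> t \<longrightarrow>
     (m s t = 2 \<longrightarrow> A s t = 0) \<and> (m s t = \<infinity> \<longrightarrow> A s t < 0 \<and> 4 \<le> A s t * A t s))"

lemma cancel2: "s \<in> I \<Longrightarrow> cox_eq I m (s # s # w) w"
  using cox_eq.ctx[OF cox_eq.rel[of s I s m 1], of "[]" w] m_diag[of s]
  by (simp add: enat_1)

lemma commute_eq:
  assumes "s \<in> I" "t \<in> I" "m s t = 2"
  shows "cox_eq I m (s # t # w) (t # s # w)"
proof -
  have "cox_eq I m (concat (replicate 2 [s, t])) []"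
    using assms by (intro cox_eq.rel) (auto simp: enat_2)
  then have "cox_eq I m [s,t,s,t] []" by (simp add: numeral_2_eq_2)
  from cox_eq.ctx[OF this, of "[]" "t # s # w"]
  have 1: "cox_eq I m (s # t # s # t # t # s # w) (t # s # w)" by simp
  have "cox_eq I m (s # t # s # t # t # s # w) (s # t # s # s # w)"
    using cox_eq.ctx[OF cancel2[OF assms(2), of "s # w"], of "[s,t,s]" "[]"] by simp
  moreover have "cox_eq I m (s # t # s # s # w) (s # t # w)"
    using cox_eq.ctx[OF cancel2[OF assms(1), of "w"], of "[s,t]" "[]"] by simp
  ultimately show ?thesis using 1 by (meson cox_eq.sym cox_eq.trans)
qed

lemma desc_move:
  assumes "set w \<subseteq> I" "x \<in> desc m w"
  shows "\<exists>w'. set w' \<subseteq> I \<and> length w = Suc (length w') \<and> cox_eq I m w (x # w')"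
  using assms
proof (induction w)
  case (Cons r w)
  show ?case
  proof (cases "x = r")
    case True
    then show ?thesis using Cons.prems by (intro exI[of _ w]) (auto intro: cox_eq.refl)
  next
    case False
    then have "x \<in> desc m w" "m x r = 2" using Cons.prems by auto
    then obtain w' where w': "set w' \<subseteq> I" "length w = Suc (length w')" "cox_eq I m w (x # w')"
      using Cons by auto
    have "x \<in> I" using \<open>x \<in> desc m w\<close> desc_subset Cons.prems by fastforce
    then have "cox_eq I m (r # x # w') (x # r # w')"
      using commute_eq[of x r w'] \<open>m x r = 2\<close> Cons.prems by (auto intro: cox_eq.sym)
    then have "cox_eq I m (r # w) (x # r # w')"
      using cox_eq_Cons[OF w'(3), of r] by (rule cox_eq.trans[rotated])
    then show ?thesis using w' Cons.prems by (intro exI[of _ "r # w'"]) auto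
  qed
qed auto

text \<open>The quantitative third claim is what makes the induction work: a coordinate that has just
  become positive is dominated by every coordinate with which it does not commute.\<close>
lemma act_sign:
  fixes A :: "'i \<Rightarrow> 'i \<Rightarrow> 'a::linordered_idom"
  assumes A: "compat A" and h0: "\<And>x. x \<in> I \<Longrightarrow> h0 x < 0"
    and "set w \<subseteq> I" "good_word m w"
  shows "(\<forall>x\<in>I. x \<in> desc m w \<longrightarrow> act A w h0 x > 0) \<and>
    (\<forall>x\<in>I. x \<notin> desc m w \<longrightarrow> act A w h0 x < 0) \<and>
    (\<forall>t\<in>desc m w. \<forall>s\<in>I. m s t = \<infinity> \<longrightarrow> 2 * act A w h0 t \<le> A t s * act A w h0 s)"
  using assms(3,4)
proof (induction w)
  case Nil
  then show ?case using h0 by simp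
next
  case (Cons r w)
  define h where "h = act A w h0"
  define h' where "h' = act A (r # w) h0"
  let ?D = "desc m w"
  have r: "r \<in> I" "r \<notin> ?D" and w: "set w \<subseteq> I" using Cons.prems by auto
  have D: "?D \<subseteq> I" using desc_subset w by fastforce
  have pos: "h x > 0" if "x \<in> I" "x \<in> ?D" for x using that Cons h_def by auto
  have neg: "h x < 0" if "x \<in> I" "x \<notin> ?D" for x using that Cons h_def by auto
  have bnd: "2 * h t \<le> A t s * h s" if "t \<in> ?D" "s \<in> I" "m s t = \<infinity>" for t s
    using that Cons h_def by auto
  have h'x: "h' x = h x - A x r * h r" for x by (simp add: h'_def h_def step_def)
  have diag: "A r r = 2" using A r by (auto simp: compat_def)
  have com: "A s t = 0" if "s \<in> I" "t \<in> I" "m s t = 2" for s t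
    using A that m_diag[of s] by (cases "s = t") (auto simp: compat_def one_enat_def numeral_eq_enat)
  have inf: "A s t < 0" "4 \<le> A s t * A t s" if "s \<in> I" "t \<in> I" "m s t = \<infinity>" for s t
    using A that m_diag[of s] by (cases "s = t"; auto simp: compat_def one_enat_def)+
  have hr: "h r < 0" using neg r by auto
  have h'r: "h' r = - h r" by (simp add: h'x diag)
  have h'c: "h' x = h x" if "x \<in> I" "m x r = 2" for x using that r com by (simp add: h'x)
  have h'i: "h' x < 0 \<and> h' x \<le> h x - A x r * h r" if x: "x \<in> I" "m x r = \<infinity>" for x
  proof (cases "x \<in> ?D")
    case True
    then have "2 * h x \<le> A x r * h r" using bnd[of x r] x r m_sym[of x r] by auto
    then show ?thesis using pos[OF x(1) True] by (simp add: h'x)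
  next
    case False
    have "A x r * h r > 0" using inf(1)[of x r] x r hr by (simp add: mult_neg_neg)
    then show ?thesis using neg[OF x(1) False] by (simp add: h'x)
  qed
  have 1: "h' x > 0" if "x \<in> I" "x \<in> desc m (r # w)" for x
    using that h'r hr h'c pos by (cases "x = r") auto
  have 2: "h' x < 0" if "x \<in> I" "x \<notin> desc m (r # w)" for x
    using that h'i[of x] h'c[of x] neg[of x] m_off[of x r] r by (cases "x \<in> ?D") auto
  have 3: "2 * h' t \<le> A t s * h' s" if t: "t \<in> desc m (r # w)" and s: "s \<in> I" "m s t = \<infinity>" for t s
  proof (cases "t = r")
    case True
    have "m r s = \<infinity>" using s m_sym[of r s] True r by simp
    then have p: "A r s * A s r \<ge> 4" and ars: "A r s < 0" using inf[of r s] r s by auto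
    have eq: "A r s * h' s = A r s * h s - (A r s * A s r) * h r" by (simp add: h'x algebra_simps)
    \<comment> \<open>This is where the bound 4 on the product of opposite entries enters: if
      \<open>s\<close> was already a descent, half of it is lost, and 4 / 2 is exactly the factor 2
      of the claim.\<close>
    have p4: "(A r s * A s r) * h r \<le> 4 * h r"
      using mult_right_mono_neg[OF p, of "h r"] hr by simp
    show ?thesis
    proof (cases "s \<in> ?D")
      case True2: True
      have "2 * h s \<le> A s r * h r" using bnd[of s r] True2 r \<open>m r s = \<infinity>\<close> by simp
      then have "A r s * (A s r * h r) \<le> A r s * (2 * h s)"
        using ars by (intro mult_left_mono_neg) auto
      moreover have "A r s * (A s r * h r) = (A r s * A s r) * h r"
        "A r s * (2 * h s) = 2 * (A r s * h s)" by simp_all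
      ultimately have "2 * (A r s * h' s) \<ge> - ((A r s * A s r) * h r)"
        unfolding eq right_diff_distrib by linarith
      moreover have "- ((A r s * A s r) * h r) \<ge> - (4 * h r)" using p4 by simp
      ultimately have "- (4 * h r) \<le> 2 * (A r s * h' s)" by (rule order_trans[rotated])
      then have "2 * (2 * (- h r)) \<le> 2 * (A r s * h' s)" by simp
      then have "2 * (- h r) \<le> A r s * h' s" by (metis mult_le_cancel_left_pos zero_less_numeral)
      then show ?thesis using True h'r by (simp only:)
    next
      case False
      then have "A r s * h s > 0" using neg[OF s(1)] ars by (simp add: mult_neg_neg)
      moreover have "4 * h r \<le> 2 * h r" using hr by simp
      ultimately have "- (2 * h r) \<le> A r s * h' s" using p4 unfolding eq by linarith
      then show ?thesis using True h'r by simp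
    qed
  next
    case False
    then have t: "t \<in> ?D" "m t r = 2" "t \<in> I" using t D by auto
    have "m t s = \<infinity>" using s t m_sym by simp
    have "s \<noteq> r" using s t m_sym[of t r] r by auto
    have "h' s \<le> h s"
    proof (cases "m s r = 2")
      case True then show ?thesis using h'c s by simp
    next
      case False
      then have "m s r = \<infinity>" using m_off[of s r] s r \<open>s \<noteq> r\<close> by auto
      then have "A s r * h r > 0" using inf(1)[of s r] s r hr by (simp add: mult_neg_neg)
      then show ?thesis by (simp add: h'x)
    qed
    then have "A t s * h s \<le> A t s * h' s"
      using inf(1)[of t s] t s \<open>m t s = \<infinity>\<close> by (intro mult_left_mono_neg) auto
    then show ?thesis using bnd[OF t(1) s] h'c[OF t(3,2)] by simp
  qed
  show ?case using 1 2 3 unfolding h'_def by blast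
qed

lemma act_cox_eq:
  fixes A :: "'i \<Rightarrow> 'i \<Rightarrow> 'a::linordered_idom"
  assumes "compat A" "cox_eq I m u w"
  shows "act A u h = act A w h"
  using assms(2)
proof (induction arbitrary: h rule: cox_eq.induct)
  case (rel s t k)
  have d: "A s s = 2" "A t t = 2" using assms(1) rel by (auto simp: compat_def)
  have invol: "step A s (step A s h) = h" for h
    using d by (auto simp: step_def algebra_simps)
  show ?case
  proof (cases "s = t")
    case True
    then have "k = 1" using rel m_diag[of s] by (simp add: one_enat_def)
    then show ?thesis using True invol by simp
  next
    case False
    then have "m s t = 2" using m_off rel by force
    then have k: "k = 2" using rel by (simp add: numeral_eq_enat)
    have "A s t = 0" "A t s = 0" using assms(1) rel False \<open>m s t = 2\<close> m_sym[of s t]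
      by (auto simp: compat_def)
    then have "act A (concat (replicate k [s,t])) h = h"
      using d by (auto simp: k numeral_2_eq_2 step_def fun_eq_iff algebra_simps)
    then show ?thesis by simp
  qed
qed (auto simp: act_append)

text \<open>A shortest representative works: a letter that is a descent of what follows it could be
  moved next to its copy and cancelled.\<close>

lemma reduced_exists:
  assumes "set w \<subseteq> I"
  obtains w' where "set w' \<subseteq> I" "cox_eq I m w' w" "good_word m w'"
    "\<forall>v. set v \<subseteq> I \<longrightarrow> cox_eq I m v w \<longrightarrow> length w' \<le> length v"
proof -
  define P where "P = (\<lambda>v. set v \<subseteq> I \<and> cox_eq I m v w)"
  have "P w" using assms by (simp add: P_def cox_eq.refl)
  then obtain w' where w': "P w'" and min: "\<And>v. P v \<Longrightarrow> length w' \<le> length v"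
    using ex_has_least_nat[of P w length] by blast
  have good: "good_word m u" if "w' = v @ u" for v u
    using that
  proof (induction u arbitrary: v)
    case (Cons r u)
    have u: "set u \<subseteq> I" "r \<in> I" "set v \<subseteq> I" using w' Cons.prems by (auto simp: P_def)
    have "r \<notin> desc m u"
    proof
      assume "r \<in> desc m u"
      then obtain u' where u': "set u' \<subseteq> I" "length u = Suc (length u')" "cox_eq I m u (r # u')"
        using desc_move u by blast
      have "cox_eq I m (r # u) u'"
        using cox_eq.trans[OF cox_eq_Cons[OF u'(3)] cancel2] u by blast
      then have "cox_eq I m (v @ u') (v @ r # u)"
        by (auto intro!: cox_eq_append intro: cox_eq.refl cox_eq.sym)
      then have "P (v @ u')" using u u' w' Cons.prems
        by (auto simp: P_def intro: cox_eq.trans)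
      then show False using min[of "v @ u'"] u' Cons.prems by simp
    qed
    moreover have "good_word m u" using Cons.IH[of "v @ [r]"] Cons.prems by simp
    ultimately show ?case by simp
  qed auto
  from that[of w'] good[of "[]" w'] w' min show ?thesis by (auto simp: P_def)
qed

text \<open>Ping-pong: the first letter of a nonempty reduced representative makes its own
  coordinate positive. Asking only for nonpositive coordinates at the end, and not for a fixed
  point, allows later comparisons between different chambers of one domain.\<close>

theorem act_faithful:
  fixes A :: "'i \<Rightarrow> 'i \<Rightarrow> 'a::linordered_idom"
  assumes A: "compat A" and h0: "\<And>x. x \<in> I \<Longrightarrow> h0 x < 0"
    and "set w \<subseteq> I" and le: "\<And>x. x \<in> I \<Longrightarrow> act A w h0 x \<le> 0"
  shows "cox_eq I m w []"
proof -
  obtain w' where w': "set w' \<subseteq> I" "cox_eq I m w' w" "good_word m w'"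
    by (rule reduced_exists[OF assms(3)])
  show ?thesis
  proof (cases w')
    case Nil
    then show ?thesis using w' cox_eq.sym by blast
  next
    case (Cons r u)
    then have "act A w' h0 r > 0" using act_sign[OF A h0 w'(1,3)] w' by auto
    then show ?thesis using act_cox_eq[OF A w'(2)] le[of r] w' Cons by auto
  qed
qed

end

section \<open>Length and the exchange condition\<close>

context ra_matrix
begin

abbreviation "G \<equiv> coxeter_group I m"
abbreviation "cl \<equiv> cox_class I m"

lemma cl_eq_iff: "set u \<subseteq> I \<Longrightarrow> cl u = cl w \<longleftrightarrow> cox_eq I m u w"
  by (auto simp: cox_class_def intro: cox_eq.refl cox_eq.sym cox_eq.trans)

lemma cl_eqI: "cox_eq I m u w \<Longrightarrow> cl u = cl w"
  by (auto simp: cox_class_def intro: cox_eq.sym cox_eq.trans)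

lemma in_cl: "set w \<subseteq> I \<Longrightarrow> w \<in> cl w"
  by (auto simp: cox_class_def intro: cox_eq.refl)

lemma cl_carrier: "set w \<subseteq> I \<Longrightarrow> cl w \<in> carrier G"
  by (auto simp: coxeter_group_def)

lemma carrierE:
  assumes "g \<in> carrier G" obtains w where "set w \<subseteq> I" "g = cl w"
  using assms by (auto simp: coxeter_group_def)

lemma one_cl: "\<one>\<^bsub>G\<^esub> = cl []"
  by (simp add: coxeter_group_def)

lemma mult_cl:
  assumes "set u \<subseteq> I" "set w \<subseteq> I"
  shows "cl u \<otimes>\<^bsub>G\<^esub> cl w = cl (u @ w)"
proof -
  have "(SOME a. a \<in> cl u) \<in> cl u" "(SOME a. a \<in> cl w) \<in> cl w"
    using in_cl assms by (meson someI)+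
  then have "cox_eq I m ((SOME a. a \<in> cl u) @ (SOME a. a \<in> cl w)) (u @ w)"
    by (auto simp: cox_class_def intro: cox_eq_append)
  then show ?thesis by (simp add: coxeter_group_def cl_eqI)
qed

lemma rev_cancel_right: "set w \<subseteq> I \<Longrightarrow> cox_eq I m (w @ rev w) []"
proof (induction w)
  case (Cons x w)
  have "cox_eq I m ([x] @ (w @ rev w) @ [x]) ([x] @ [] @ [x])"
    using Cons by (intro cox_eq.ctx) auto
  then show ?case using cancel2[of x "[]"] Cons.prems cox_eq.trans by fastforce
qed (simp add: cox_eq.refl)

lemma rev_cancel_left: "set w \<subseteq> I \<Longrightarrow> cox_eq I m (rev w @ w) []"
  using rev_cancel_right[of "rev w"] by simp

lemma group_G: "group G"
proof (rule groupI)
  show "\<one>\<^bsub>G\<^esub> \<in> carrier G" using cl_carrier[of "[]"] by (simp add: one_cl)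
  show "\<And>x. x \<in> carrier G \<Longrightarrow> \<one>\<^bsub>G\<^esub> \<otimes>\<^bsub>G\<^esub> x = x"
    using mult_cl[of "[]"] by (auto simp: one_cl elim!: carrierE)
  show "\<exists>y\<in>carrier G. y \<otimes>\<^bsub>G\<^esub> x = \<one>\<^bsub>G\<^esub>" if x: "x \<in> carrier G" for x
  proof -
    obtain w where w: "set w \<subseteq> I" "x = cl w" using x by (rule carrierE)
    show ?thesis using w cl_eqI[OF rev_cancel_left[OF w(1)]] cl_carrier[of "rev w"]
      by (intro bexI[of _ "cl (rev w)"]) (simp_all add: mult_cl one_cl)
  qed
  show "\<And>x y. x \<in> carrier G \<Longrightarrow> y \<in> carrier G \<Longrightarrow> x \<otimes>\<^bsub>G\<^esub> y \<in> carrier G"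
    by (elim carrierE) (simp add: mult_cl cl_carrier)
  show "\<And>x y z. x \<in> carrier G \<Longrightarrow> y \<in> carrier G \<Longrightarrow> z \<in> carrier G \<Longrightarrow>
    x \<otimes>\<^bsub>G\<^esub> y \<otimes>\<^bsub>G\<^esub> z = x \<otimes>\<^bsub>G\<^esub> (y \<otimes>\<^bsub>G\<^esub> z)"
    by (elim carrierE) (simp add: mult_cl)
qed

lemma inv_cl: "set w \<subseteq> I \<Longrightarrow> inv\<^bsub>G\<^esub> (cl w) = cl (rev w)"
  using group.inv_equality[OF group_G, of "cl (rev w)" "cl w"] rev_cancel_left[of w]
  by (simp add: mult_cl one_cl cl_carrier cl_eqI)

definition len :: "'i list \<Rightarrow> nat" where
  "len w = cox_length I m (cl w)"

lemma len_eq: "set w \<subseteq> I \<Longrightarrow> len w = (LEAST k. \<exists>v. length v = k \<and> set v \<subseteq> I \<and> cox_eq I m v w)"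
  unfolding len_def cox_length_def by (intro arg_cong[where f=Least] ext) (metis cl_eq_iff)

lemma len_le: "set v \<subseteq> I \<Longrightarrow> set w \<subseteq> I \<Longrightarrow> cox_eq I m v w \<Longrightarrow> len w \<le> length v"
  unfolding len_eq by (rule Least_le) blast

lemma len_cong: "cox_eq I m v w \<Longrightarrow> len v = len w"
  by (simp add: len_def cl_eqI)

lemma reducedE:
  assumes "set w \<subseteq> I"
  obtains w' where "set w' \<subseteq> I" "cox_eq I m w' w" "good_word m w'" "length w' = len w"
proof -
  obtain w' where w': "set w' \<subseteq> I" "cox_eq I m w' w" "good_word m w'"
    and min: "\<forall>v. set v \<subseteq> I \<longrightarrow> cox_eq I m v w \<longrightarrow> length w' \<le> length v"
    by (rule reduced_exists[OF assms])
  have "length w' \<le> len w"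
    unfolding len_eq[OF assms] by (rule LeastI2_ex) (use w' min in blast)+
  then show ?thesis using that[of w'] w' len_le[of w' w] assms by simp
qed

definition cartan0 :: "'i \<Rightarrow> 'i \<Rightarrow> int" where
  "cartan0 s t = (if s = t then 2 else if m s t = 2 then 0 else -3)"

lemma compat_cartan0: "compat cartan0"
  using m_sym by (auto simp: compat_def cartan0_def)

text \<open>The side of the wall of \<open>s\<close> on which the chamber of \<open>w\<close> lies.
  This is the geometric form of a left descent (\<open>pos_iff_len\<close>), and it is visibly
  invariant under \<open>cox_eq\<close>.\<close>

definition pos :: "'i list \<Rightarrow> 'i \<Rightarrow> bool" where
  "pos w s \<longleftrightarrow> act cartan0 w (\<lambda>_. -1) s > 0"

lemma pos_cong: "cox_eq I m u w \<Longrightarrow> pos u s = pos w s"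
  using act_cox_eq[OF compat_cartan0] by (simp add: pos_def)

lemma pos_good_word: "set w \<subseteq> I \<Longrightarrow> good_word m w \<Longrightarrow> s \<in> I \<Longrightarrow> pos w s \<longleftrightarrow> s \<in> desc m w"
  using act_sign[OF compat_cartan0, of "\<lambda>_. -1" w] by (force simp: pos_def)

lemma pos_Cons_self: "set w \<subseteq> I \<Longrightarrow> s \<in> I \<Longrightarrow> pos (s # w) s \<longleftrightarrow> \<not> pos w s"
proof -
  assume a: "set w \<subseteq> I" "s \<in> I"
  obtain w' where w': "set w' \<subseteq> I" "cox_eq I m w' w" "good_word m w'"
    using reducedE[OF a(1)] by metis
  have "act cartan0 w' (\<lambda>_. -1) s \<noteq> 0"
    using act_sign[OF compat_cartan0, of "\<lambda>_. -1" w'] w' a by force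
  moreover have "pos (s # w) s = pos (s # w') s" "pos w s = pos w' s"
    using pos_cong[OF cox_eq_Cons[OF w'(2)]] pos_cong[OF w'(2)] by auto
  ultimately show ?thesis by (auto simp: pos_def step_def cartan0_def)
qed

lemma len_Cons_less:
  assumes "set w \<subseteq> I" "s \<in> I" "pos w s"
  shows "Suc (len (s # w)) \<le> len w"
proof -
  obtain w' where w': "set w' \<subseteq> I" "cox_eq I m w' w" "good_word m w'" "length w' = len w"
    using reducedE[OF assms(1)] by metis
  have "s \<in> desc m w'" using assms pos_cong[OF w'(2)] pos_good_word[of w' s] w' by simp
  then obtain u where u: "set u \<subseteq> I" "length w' = Suc (length u)" "cox_eq I m w' (s # u)"
    using desc_move w' by blast
  have "cox_eq I m (s # w) (s # s # u)"
    using u w' by (meson cox_eq.sym cox_eq.trans cox_eq_Cons)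
  then have "cox_eq I m u (s # w)" using cancel2[OF assms(2)] by (meson cox_eq.sym cox_eq.trans)
  then show ?thesis using len_le[of u "s # w"] u w' assms by simp
qed

lemma pos_iff_len:
  assumes "set w \<subseteq> I" "s \<in> I"
  shows "pos w s \<longleftrightarrow> len (s # w) < len w"
proof (cases "pos w s")
  case True
  then show ?thesis using len_Cons_less assms by fastforce
next
  case False
  then have "Suc (len (s # s # w)) \<le> len (s # w)"
    using assms pos_Cons_self[of w s] by (intro len_Cons_less) auto
  then show ?thesis using False len_cong[OF cancel2[OF assms(2), of w]] by simp
qed

lemma len_Cons_le: "set w \<subseteq> I \<Longrightarrow> s \<in> I \<Longrightarrow> len (s # w) \<le> Suc (len w)"
proof -
  assume a: "set w \<subseteq> I" "s \<in> I"
  then obtain w' where "set w' \<subseteq> I" "cox_eq I m w' w" "length w' = len w"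
    using reducedE[OF a(1)] by metis
  then show ?thesis using a len_le[of "s # w'" "s # w"] cox_eq_Cons[of I m w' w s] by simp
qed

lemma len_snoc_le: "set w \<subseteq> I \<Longrightarrow> s \<in> I \<Longrightarrow> len (w @ [s]) \<le> Suc (len w)"
proof -
  assume a: "set w \<subseteq> I" "s \<in> I"
  then obtain w' where "set w' \<subseteq> I" "cox_eq I m w' w" "length w' = len w"
    using reducedE[OF a(1)] by metis
  then show ?thesis using a len_le[of "w' @ [s]" "w @ [s]"] cox_eq_append[of I m w' w "[s]" "[s]"]
    by (simp add: cox_eq.refl)
qed

lemma good_word_if_reduced:
  assumes "set w \<subseteq> I" "length w = len w" shows "good_word m w"
  using assms
proof (induction w)
  case (Cons x w)
  have "len w \<le> length w" using len_le[of w w] Cons.prems by (simp add: cox_eq.refl)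
  then have len: "len w = length w" using len_Cons_le[of w x] Cons.prems by simp
  then have gw: "good_word m w" using Cons by simp
  moreover have "\<not> pos w x" using pos_iff_len[of w x] Cons.prems len by simp
  ultimately show ?case using pos_good_word[of w x] Cons.prems by simp
qed simp

lemma desc_snoc:
  assumes "s \<in> desc m (w @ [r])" "s \<notin> desc m w"
  shows "s = r \<and> (\<forall>t\<in>set w. m s t = 2)"
  using assms by (induction w) (auto split: if_splits)

lemma commute_word:
  "s \<in> I \<Longrightarrow> set w \<subseteq> I \<Longrightarrow> \<forall>t\<in>set w. m s t = 2 \<Longrightarrow> cox_eq I m (s # w) (w @ [s])"
proof (induction w)
  case (Cons x w)
  then have "cox_eq I m (s # x # w) (x # s # w)" by (intro commute_eq) auto
  moreover have "cox_eq I m (x # s # w) (x # w @ [s])" using Cons by (intro cox_eq_Cons) auto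
  ultimately show ?case using cox_eq.trans by fastforce
qed (simp add: cox_eq.refl)

text \<open>The length inequalities force \<open>w\<close> followed by \<open>r\<close> to stay
  reduced when \<open>w\<close> is. A descent that appears only with the last letter is that letter
  and commutes with all the others, so the exchange is pure commutation.\<close>

lemma exchange:
  assumes w: "set w \<subseteq> I" "s \<in> I" "r \<in> I" and "\<not> pos w s" "pos (w @ [r]) s"
  shows "cox_eq I m (s # w) (w @ [r])"
proof -
  obtain w' where w': "set w' \<subseteq> I" "cox_eq I m w' w" "good_word m w'" "length w' = len w"
    using reducedE[OF w(1)] by metis
  have eq: "cox_eq I m (w' @ [r]) (w @ [r])"
    using w' by (intro cox_eq_append cox_eq.refl)
  have "Suc (len (s # w @ [r])) \<le> len (w @ [r])" using assms by (intro len_Cons_less) auto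
  moreover have "len w < len (s # w)"
    using assms pos_iff_len[of "s # w" s] pos_Cons_self[of w s] len_cong[OF cancel2[of s w]] by simp
  moreover have "len (s # w) \<le> Suc (len ((s # w) @ [r]))"
    using len_snoc_le[of "(s # w) @ [r]" r] w len_cong[of "s # w @ [r, r]" "s # w"]
      cox_eq.ctx[OF cancel2[of r "[]"], of "s # w" "[]"] by simp
  moreover have "len (w @ [r]) \<le> Suc (len w)" using w by (intro len_snoc_le)
  ultimately have "len (w' @ [r]) = length (w' @ [r])" using len_cong[OF eq] w' by simp
  then have good: "good_word m (w' @ [r])" using w' w by (intro good_word_if_reduced) auto
  have "s \<in> desc m (w' @ [r])"
    using pos_good_word[OF _ good, of s] pos_cong[OF eq] assms w' by simp
  moreover have "s \<notin> desc m w'" using pos_good_word[of w' s] w' assms pos_cong[OF w'(2)] by simp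
  ultimately have sr: "s = r" "\<forall>t\<in>set w'. m s t = 2" using desc_snoc by fast+
  have "cox_eq I m (s # w') (w' @ [r])" using commute_word[of s w'] sr w w' by simp
  then show ?thesis using eq cox_eq_Cons[OF w'(2), of s] by (meson cox_eq.sym cox_eq.trans)
qed

text \<open>The generator \<open>s\<close> is a left descent of \<open>rev g @ w\<close> precisely when the wall of the reflection
  \<open>g s g\<^sup>-\<^sup>1\<close> separates \<open>g\<close> and \<open>w\<close>, so a change of \<open>pos\<close> means that a gallery crosses that wall.\<close>
lemma wall_crossing:
  assumes g: "set g \<subseteq> I" "s \<in> I" and "set w \<subseteq> I" "pos (rev g) s \<noteq> pos (rev g @ w) s"
  shows "\<exists>p r q. w = p @ r # q \<and> cox_eq I m (g @ s # rev g) (p @ r # rev p)"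
  using assms(3,4)
proof (induction w rule: rev_induct)
  case (snoc r w)
  show ?case
  proof (cases "pos (rev g) s = pos (rev g @ w) s")
    case False
    then obtain p r' q where "w = p @ r' # q" "cox_eq I m (g @ s # rev g) (p @ r' # rev p)"
      using snoc by auto
    then show ?thesis by (intro exI[of _ p] exI[of _ r'] exI[of _ "q @ [r]"]) auto
  next
    case True
    define u where "u = rev g @ w"
    have u: "set u \<subseteq> I" "r \<in> I" using g snoc.prems by (auto simp: u_def)
    have urr: "cox_eq I m (u @ [r, r]) u"
      using cox_eq.ctx[OF cancel2[of r "[]"], of u "[]"] u by simp
    have sur: "cox_eq I m (s # u) (u @ [r])"
    proof (cases "pos u s")
      case False
      then show ?thesis using True snoc.prems exchange[OF u(1) g(2) u(2)] by (simp add: u_def)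
    next
      case True2: True
      have "\<not> pos (u @ [r]) s" using True True2 snoc.prems by (simp add: u_def)
      then have "cox_eq I m (s # u @ [r]) (u @ [r, r])"
        using exchange[of "u @ [r]" s r] u g True2 pos_cong[OF urr] by simp
      then have "cox_eq I m (s # u @ [r]) u" using urr by (rule cox_eq.trans)
      then have "cox_eq I m (s # s # u @ [r]) (s # u)" by (rule cox_eq_Cons)
      then show ?thesis using cancel2[OF g(2), of "u @ [r]"] by (meson cox_eq.sym cox_eq.trans)
    qed
    have ww: "cox_eq I m (w @ rev w) []" using rev_cancel_right snoc.prems by simp
    have gg: "cox_eq I m (g @ rev g) []" using rev_cancel_right g by simp
    have "cox_eq I m (g @ (s # u) @ rev w) (g @ (u @ [r]) @ rev w)"
      using sur by (rule cox_eq.ctx)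
    moreover have "cox_eq I m (g @ (s # u) @ rev w) (g @ s # rev g)"
      using cox_eq.ctx[OF ww, of "g @ s # rev g" "[]"] by (simp add: u_def)
    moreover have "cox_eq I m (g @ (u @ [r]) @ rev w) (w @ r # rev w)"
      using cox_eq.ctx[OF gg, of "[]" "w @ r # rev w"] by (simp add: u_def)
    ultimately have "cox_eq I m (g @ s # rev g) (w @ r # rev w)"
      by (meson cox_eq.sym cox_eq.trans)
    then show ?thesis by blast
  qed
qed simp

lemma delete_letter:
  assumes "set (p @ r # q) \<subseteq> I"
  shows "cox_eq I m ((p @ r # rev p) @ p @ r # q) (p @ q)"
proof -
  have "cox_eq I m (p @ [r] @ (rev p @ p) @ r # q) (p @ [r] @ [] @ r # q)"
    using rev_cancel_left[of p] assms by (intro cox_eq_append cox_eq.refl) auto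
  moreover have "cox_eq I m (p @ (r # r # q)) (p @ q)"
    using cancel2[of r q] assms by (intro cox_eq_append cox_eq.refl) auto
  ultimately show ?thesis using cox_eq.trans by fastforce
qed

text \<open>If the wall of the reflection does not separate 1 from \<open>w\<close>, it separates 1
  from the shorter product of the reflection and \<open>w\<close>. Deleting a letter in a reduced
  word of that product would then give a word for \<open>w\<close> shorter than
  \<open>len w\<close>.\<close>

theorem strong_exchange:
  assumes g: "set g \<subseteq> I" "s \<in> I" and w: "set w \<subseteq> I"
    and less: "len ((g @ s # rev g) @ w) < len w"
  shows "\<exists>p r q. w = p @ r # q \<and> cox_eq I m (g @ s # rev g) (p @ r # rev p)"
proof (rule wall_crossing[OF g w], rule notI)
  assume eq: "pos (rev g) s = pos (rev g @ w) s"
  let ?t = "g @ s # rev g"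
  have t: "set ?t \<subseteq> I" using g by auto
  have tt: "cox_eq I m (?t @ ?t) []"
  proof -
    have "rev ?t = ?t" by simp
    then show ?thesis using rev_cancel_right[OF t] by simp
  qed
  obtain w' where w': "set w' \<subseteq> I" "cox_eq I m w' (?t @ w)" "length w' = len (?t @ w)"
    using reducedE[of "?t @ w"] t w by (metis Un_subset_iff set_append)
  have "cox_eq I m (rev g @ w') ((rev g @ g) @ s # rev g @ w)"
    using cox_eq_append[OF cox_eq.refl w'(2), of "rev g"] by simp
  moreover have "cox_eq I m ((rev g @ g) @ s # rev g @ w) ([] @ s # rev g @ w)"
    using rev_cancel_left g by (intro cox_eq_append cox_eq.refl) auto
  ultimately have "cox_eq I m (rev g @ w') (s # rev g @ w)" using cox_eq.trans by fastforce
  then have "pos (rev g @ w') s = pos (s # rev g @ w) s" by (rule pos_cong)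
  then have "pos (rev g) s \<noteq> pos (rev g @ w') s"
    using eq pos_Cons_self[of "rev g @ w" s] g w by auto
  then obtain p r q where pq: "w' = p @ r # q" "cox_eq I m ?t (p @ r # rev p)"
    using wall_crossing[OF g w'(1)] by metis
  have "cox_eq I m (?t @ w') (p @ q)"
    using cox_eq_append[OF pq(2) cox_eq.refl, of w'] delete_letter[of p r q] w'(1) pq(1)
    by (metis cox_eq.trans)
  moreover have "cox_eq I m (?t @ w') ((?t @ ?t) @ w)"
    using cox_eq_append[OF cox_eq.refl w'(2), of ?t] by simp
  moreover have "cox_eq I m ((?t @ ?t) @ w) w"
    using cox_eq_append[OF tt cox_eq.refl, of w] by simp
  ultimately have "cox_eq I m (p @ q) w" by (meson cox_eq.sym cox_eq.trans)
  then have "len w \<le> length (p @ q)" using len_le[of "p @ q" w] w pq w' by auto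
  then show False using less w' pq by simp
qed

end

section \<open>Reflection subgroups from an infinite dihedral subgroup\<close>

locale dihedral = ra_matrix I m for I :: "'i set" and m :: "'i \<Rightarrow> 'i \<Rightarrow> enat" +
  fixes a b :: 'i and k :: nat
  assumes fin: "finite I" and aI: "a \<in> I" and bI: "b \<in> I" and ab: "a \<noteq> b" and mab: "m a b = \<infinity>"
    and k1: "k \<ge> 1"
begin

definition alt :: "nat \<Rightarrow> 'i" where "alt i = (if even i then a else b)"

definition seg :: "nat \<Rightarrow> nat \<Rightarrow> 'i list" where "seg i j = map alt [i..<j]"

text \<open>\<open>ext i s\<close> says that the \<open>s\<close>-neighbour of the chamber \<open>seg 0 i\<close> lies outside the gallery
  \<open>seg 0 0, \<dots>, seg 0 (k - 1)\<close>, and then \<open>rw i s\<close> is the reflection in the wall between them.\<close>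
definition ext :: "nat \<Rightarrow> 'i \<Rightarrow> bool" where
  "ext i s \<longleftrightarrow> i < k \<and> s \<in> I \<and> \<not> (s = alt i \<and> Suc i < k) \<and> \<not> (0 < i \<and> s = alt (i - 1))"

definition rw :: "nat \<Rightarrow> 'i \<Rightarrow> 'i list" where "rw i s = seg 0 i @ s # rev (seg 0 i)"

definition X :: "'i list set set" where "X = {cl (rw i s) | i s. ext i s}"

lemma alt_I [simp]: "alt i \<in> I" by (simp add: alt_def aI bI)

lemma alt_neq: "alt i \<noteq> alt (Suc i)" using ab by (auto simp: alt_def)

lemma m_alt: "m (alt i) (alt (Suc i)) = \<infinity>" "m (alt (Suc i)) (alt i) = \<infinity>"
  using mab m_sym[OF aI bI] by (auto simp: alt_def)

lemma set_seg: "set (seg i j) \<subseteq> {a, b}" by (auto simp: seg_def alt_def)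

lemma set_seg_I [simp]: "set (seg i j) \<subseteq> I" by (auto simp: seg_def)

lemma seg_Suc: "i \<le> j \<Longrightarrow> seg i (Suc j) = seg i j @ [alt j]" by (simp add: seg_def)

lemma seg_Cons: "i < j \<Longrightarrow> seg i j = alt i # seg (Suc i) j" by (simp add: seg_def upt_conv_Cons)

lemma seg_append: "i \<le> j \<Longrightarrow> j \<le> l \<Longrightarrow> seg i l = seg i j @ seg j l"
  using upt_add_eq_append[of i j "l - j"] by (simp add: seg_def flip: map_append)

lemma seg_self [simp]: "seg i i = []" by (simp add: seg_def)

text \<open>Neighbouring letters of an alternating word do not commute, so nothing can pass its
  first letter.\<close>

lemma seg_good: "good_word m (seg i j) \<and> desc m (seg i j) = (if i < j then {alt i} else {})"
proof (cases "i \<le> j")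
  case True
  then show ?thesis
  proof (induction rule: inc_induct)
    case (step i)
    then have "good_word m (seg i j)" using alt_neq[of i] by (simp add: seg_Cons)
    moreover have "{t \<in> desc m (seg (Suc i) j). m t (alt i) = 2} = {}" using step m_alt[of i] by auto
    then have "desc m (seg i j) = {alt i}" using step.hyps by (simp only: seg_Cons desc.simps)
    ultimately show ?case using step.hyps by simp
  qed simp
qed (simp add: seg_def)

lemma rev_seg_good: "good_word m (rev (seg i j)) \<and> desc m (rev (seg i j)) = (if i < j then {alt (j - 1)} else {})"
proof (cases "i \<le> j")
  case True
  then show ?thesis
  proof (induction rule: dec_induct)
    case (step j)
    have *: "desc m (rev (seg i j)) \<subseteq> {alt (j - 1)} \<and> (desc m (rev (seg i j)) \<noteq> {} \<longrightarrow> j > 0)"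
      using step.IH by auto
    then have "alt j \<notin> desc m (rev (seg i j))" using alt_neq[of "j - 1"] by fastforce
    then have "good_word m (rev (seg i (Suc j)))" using step by (simp add: seg_Suc)
    moreover have "{t \<in> desc m (rev (seg i j)). m t (alt j) = 2} = {}"
      using * m_alt[of "j - 1"] by fastforce
    then have "desc m (rev (seg i (Suc j))) = {alt j}"
      using step.hyps by (simp only: seg_Suc rev.simps rev_append append.simps desc.simps)
    ultimately show ?case using step.hyps by simp
  qed simp
qed (simp add: seg_def)

lemma seg_quotient:
  "i \<le> j \<Longrightarrow> cox_eq I m (rev (seg 0 i) @ seg 0 j) (seg i j)"
  "j \<le> i \<Longrightarrow> cox_eq I m (rev (seg 0 i) @ seg 0 j) (rev (seg j i))"
proof -
  show "cox_eq I m (rev (seg 0 i) @ seg 0 j) (seg i j)" if "i \<le> j"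
    using cox_eq_append[OF rev_cancel_left[of "seg 0 i"] cox_eq.refl, of "seg i j"] seg_append[of 0 i j] that
    by simp
  show "cox_eq I m (rev (seg 0 i) @ seg 0 j) (rev (seg j i))" if "j \<le> i"
    using cox_eq_append[OF cox_eq.refl rev_cancel_left[of "seg 0 j"], of "rev (seg j i)"] seg_append[of 0 j i] that
    by simp
qed

section \<open>Roots of the walls as integer combinations of simple roots\<close>

definition rstep :: "'i \<Rightarrow> ('i \<Rightarrow> int) \<Rightarrow> 'i \<Rightarrow> int" where
  "rstep r c = c(r := c r - (\<Sum>s\<in>I. cartan0 r s * c s))"

definition ract :: "'i list \<Rightarrow> ('i \<Rightarrow> int) \<Rightarrow> 'i \<Rightarrow> int" where
  "ract w c = foldr rstep w c"

definition sroot :: "'i \<Rightarrow> 'i \<Rightarrow> int" where "sroot s = (\<lambda>x. if x = s then 1 else 0)"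

text \<open>The values of all simple forms at the vector with coefficients \<open>c\<close>. Because
  \<open>cartan0\<close> is symmetric on \<open>I\<close>, one coefficient function serves both as a
  root (through \<open>ev\<close>) and as its coroot.\<close>

definition coroot :: "('i \<Rightarrow> int) \<Rightarrow> 'i \<Rightarrow> int" where
  "coroot c = (\<lambda>t. \<Sum>s\<in>I. cartan0 t s * c s)"

definition ev :: "('i \<Rightarrow> int) \<Rightarrow> ('i \<Rightarrow> int) \<Rightarrow> int" where
  "ev c h = (\<Sum>s\<in>I. c s * h s)"

lemma ract_simps [simp]: "ract [] c = c" "ract (r # w) c = rstep r (ract w c)"
  and ract_append: "ract (u @ w) c = ract u (ract w c)"
  by (simp_all add: ract_def)

lemma cartan0_sym: "s \<in> I \<Longrightarrow> t \<in> I \<Longrightarrow> cartan0 s t = cartan0 t s"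
  using m_sym by (auto simp: cartan0_def)

lemma cartan0_diag [simp]: "cartan0 s s = 2" by (simp add: cartan0_def)

lemma rstep_coroot: "rstep r c = (\<lambda>s. c s - sroot r s * coroot c r)"
  by (auto simp: rstep_def coroot_def sroot_def)

lemma sum_sroot: "r \<in> I \<Longrightarrow> (\<Sum>s\<in>I. f s * sroot r s) = f r"
  using fin by (simp add: sroot_def if_distrib cong: if_cong)

lemma ev_sroot: "s \<in> I \<Longrightarrow> ev (sroot s) h = h s"
  using sum_sroot[of s h] by (simp add: ev_def mult.commute)

lemma ev_diff: "ev c (\<lambda>t. h t - x * h' t) = ev c h - x * ev c h'"
  by (simp add: ev_def sum_subtractf sum_distrib_left algebra_simps)

lemma ev_coroot_sym: "ev c (coroot c') = ev c' (coroot c)"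
proof -
  have "ev c (coroot c') = (\<Sum>s\<in>I. \<Sum>t\<in>I. c s * cartan0 s t * c' t)"
    by (simp add: ev_def coroot_def sum_distrib_left mult.assoc)
  also have "\<dots> = (\<Sum>t\<in>I. \<Sum>s\<in>I. c s * cartan0 s t * c' t)" by (rule sum.swap)
  also have "\<dots> = ev c' (coroot c)"
    by (auto simp: ev_def coroot_def sum_distrib_left cartan0_sym intro!: sum.cong)
  finally show ?thesis .
qed

lemma ev_rstep: "r \<in> I \<Longrightarrow> ev (rstep r c) h = ev c (step cartan0 r h)"
proof -
  assume r: "r \<in> I"
  have "ev (rstep r c) h = ev c h - (\<Sum>s\<in>I. (h s * coroot c r) * sroot r s)"
    by (simp only: rstep_coroot ev_def left_diff_distrib sum_subtractf) (simp add: mult.commute mult.left_commute)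
  also have "(\<Sum>s\<in>I. (h s * coroot c r) * sroot r s) = h r * coroot c r" by (rule sum_sroot[OF r])
  also have "h r * coroot c r = (\<Sum>s\<in>I. c s * (cartan0 s r * h r))"
    using r by (auto simp: coroot_def sum_distrib_left cartan0_sym intro!: sum.cong)
  finally show ?thesis by (simp add: ev_def step_def right_diff_distrib sum_subtractf)
qed

lemma coroot_rstep: "r \<in> I \<Longrightarrow> coroot (rstep r c) = step cartan0 r (coroot c)"
proof
  fix t assume r: "r \<in> I"
  have "coroot (rstep r c) t = coroot c t - (\<Sum>s\<in>I. (cartan0 t s * coroot c r) * sroot r s)"
    by (simp add: rstep_coroot coroot_def[of "\<lambda>s. c s - _ s"] right_diff_distrib sum_subtractf mult.commute
        mult.left_commute) (simp add: coroot_def mult.commute)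
  also have "(\<Sum>s\<in>I. (cartan0 t s * coroot c r) * sroot r s) = cartan0 t r * coroot c r"
    by (rule sum_sroot[OF r])
  finally show "coroot (rstep r c) t = step cartan0 r (coroot c) t" by (simp add: step_def)
qed

lemma ev_ract: "set w \<subseteq> I \<Longrightarrow> ev (ract w c) h = ev c (act cartan0 (rev w) h)"
  by (induction w arbitrary: h) (simp_all add: ev_rstep act_append)

lemma coroot_ract: "set w \<subseteq> I \<Longrightarrow> coroot (ract w c) = act cartan0 w (coroot c)"
  by (induction w) (simp_all add: coroot_rstep)

lemma step_invol: "step cartan0 r (step cartan0 r h) = h"
  by (auto simp: step_def algebra_simps)

lemma step_diff: "step cartan0 r (\<lambda>t. h t - x * h' t) = (\<lambda>t. step cartan0 r h t - x * step cartan0 r h' t)"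
  by (auto simp: step_def algebra_simps)

lemma act_reflection:
  "set g \<subseteq> I \<Longrightarrow> s \<in> I \<Longrightarrow> act cartan0 (g @ s # rev g) h =
    (\<lambda>t. h t - ev (ract g (sroot s)) h * coroot (ract g (sroot s)) t)"
proof (induction g arbitrary: h)
  case Nil
  have "coroot (sroot s) t = cartan0 t s" for t using sum_sroot[OF Nil(2)] by (simp add: coroot_def)
  then show ?case using Nil by (simp add: ev_sroot step_def mult.commute)
next
  case (Cons r g)
  have "act cartan0 ((r # g) @ s # rev (r # g)) h =
      step cartan0 r (act cartan0 (g @ s # rev g) (step cartan0 r h))"
    by (simp add: act_append)
  also have "\<dots> = (\<lambda>t. h t - ev (ract g (sroot s)) (step cartan0 r h) * step cartan0 r (coroot (ract g (sroot s))) t)"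
    using Cons by (simp add: step_diff step_invol)
  finally show ?case using Cons.prems by (simp add: ev_rstep coroot_rstep)
qed

lemma act_id_imp: "set w \<subseteq> I \<Longrightarrow> (\<And>h. act cartan0 w h = h) \<Longrightarrow> cox_eq I m w []"
  using act_faithful[OF compat_cartan0, of "\<lambda>_. -1" w] by simp

lemma nonneg_if_neg:
  assumes neg: "\<And>h. (\<And>s. s \<in> I \<Longrightarrow> h s < 0) \<Longrightarrow> ev c h \<le> 0" and s: "s \<in> I"
  shows "c s \<ge> 0"
proof (rule ccontr)
  assume "\<not> c s \<ge> 0"
  then have cs: "c s \<le> -1" by simp
  \<comment> \<open>Since \<open>c\<close> is integral, \<open>c s\<close> is at most -1, and the
    weight \<open>K\<close> at \<open>s\<close> outweighs all other coefficients by 1.\<close>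
  define K where "K = (\<Sum>t\<in>I - {s}. \<bar>c t\<bar>) + 1"
  have "K \<ge> 1" by (simp add: K_def sum_nonneg)
  have "ev c (\<lambda>t. if t = s then - K else -1) = c s * (- K) + (\<Sum>t\<in>I - {s}. - c t)"
    unfolding ev_def by (subst sum.remove[OF fin s]) (auto intro!: sum.cong)
  moreover have "c s * (- K) \<ge> K" using mult_right_mono[of "c s" "-1" K] cs \<open>K \<ge> 1\<close> by simp
  moreover have "(\<Sum>t\<in>I - {s}. - c t) \<ge> (\<Sum>t\<in>I - {s}. - \<bar>c t\<bar>)" by (intro sum_mono) simp
  ultimately have "ev c (\<lambda>t. if t = s then - K else -1) \<ge> 1" by (simp add: K_def sum_negf)
  moreover have "ev c (\<lambda>t. if t = s then - K else -1) \<le> 0" using \<open>K \<ge> 1\<close> by (intro neg) auto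
  ultimately show False by simp
qed

definition root :: "nat \<Rightarrow> 'i \<Rightarrow> 'i \<Rightarrow> int" where "root i s = ract (seg 0 i) (sroot s)"

text \<open>The gallery lies on one side of each outer wall: the word leading from chamber
  \<open>i\<close> to chamber \<open>j\<close> is alternating, hence has at most one descent, and
  \<open>ext\<close> excludes exactly that letter.\<close>

lemma root_negative:
  assumes e: "ext i s" and j: "j < k" and h: "\<And>t. t \<in> I \<Longrightarrow> h t < 0"
  shows "ev (root i s) (act cartan0 (seg 0 j) h) < 0"
proof -
  have s: "s \<in> I" using e by (simp add: ext_def)
  have "ev (root i s) (act cartan0 (seg 0 j) h) = act cartan0 (rev (seg 0 i) @ seg 0 j) h s"
    using s by (simp add: root_def ev_ract ev_sroot act_append)
  also have "\<dots> < 0"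
  proof (cases "i \<le> j")
    case True
    have "act cartan0 (seg i j) h s < 0"
      using act_sign[OF compat_cartan0, of h "seg i j"] h seg_good[of i j] s e j True
      by (auto simp: ext_def)
    then show ?thesis using act_cox_eq[OF compat_cartan0 seg_quotient(1)[OF True]] by simp
  next
    case False
    have "act cartan0 (rev (seg j i)) h s < 0"
      using act_sign[OF compat_cartan0, of h "rev (seg j i)"] h rev_seg_good[of j i] s e j False
      by (auto simp: ext_def)
    then show ?thesis using act_cox_eq[OF compat_cartan0 seg_quotient(2)] False by simp
  qed
  finally show ?thesis .
qed

text \<open>Seen from any chamber of the gallery, the root of an outer wall is a nonnegative
  combination of simple roots. This turns the pairings below into sums of terms of one sign.\<close>

lemma root_nonneg:
  assumes "ext i s" "j < k" "t \<in> I"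
  shows "ract (rev (seg 0 j)) (root i s) t \<ge> 0"
proof (rule nonneg_if_neg[OF _ assms(3)])
  fix h :: "'i \<Rightarrow> int" assume "\<And>s. s \<in> I \<Longrightarrow> h s < 0"
  then show "ev (ract (rev (seg 0 j)) (root i s)) h \<le> 0"
    using root_negative[OF assms(1,2), of h] by (simp add: ev_ract)
qed

definition bil :: "('i \<Rightarrow> int) \<Rightarrow> ('i \<Rightarrow> int) \<Rightarrow> int" where "bil c c' = ev c (coroot c')"

lemma bil_sym: "bil c c' = bil c' c" by (simp add: bil_def ev_coroot_sym)

lemma bil_ract: "set w \<subseteq> I \<Longrightarrow> bil (ract w c) c' = bil c (ract (rev w) c')"
  by (simp add: bil_def ev_ract coroot_ract)

lemma ract_cancel: "ract (rev w) (ract w c) = c" if "set w \<subseteq> I"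
proof -
  have inv: "rstep r (rstep r c) = c" if "r \<in> I" for r c
  proof -
    have "coroot (rstep r c) r = - coroot c r" using coroot_rstep[OF that, of c] by (simp add: step_def)
    then show ?thesis by (simp add: rstep_coroot[of r "rstep r c"]) (simp add: rstep_coroot)
  qed
  show ?thesis using that by (induction w arbitrary: c) (simp_all add: ract_append inv)
qed

lemma ract_ab: "set w \<subseteq> {a, b} \<Longrightarrow> r \<notin> {a, b} \<Longrightarrow> ract w c r = c r"
  by (induction w) (auto simp: rstep_def)

lemma coroot_ab:
  assumes "\<And>r. r \<in> I - {a, b} \<Longrightarrow> c r = 0"
  shows "coroot c s = cartan0 s a * c a + cartan0 s b * c b"
proof -
  have "coroot c s = (\<Sum>r\<in>{a, b}. cartan0 s r * c r)"
    unfolding coroot_def using assms by (intro sum.mono_neutral_right[OF fin]) (auto simp: aI bI)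
  then show ?thesis using ab by simp
qed

lemma coroot_abt:
  assumes "\<And>r. r \<in> I - {a, b} \<Longrightarrow> c r = sroot t r" "t \<in> I - {a, b}"
  shows "coroot c s = cartan0 s a * c a + cartan0 s b * c b + cartan0 s t"
proof -
  have "coroot c s = (\<Sum>r\<in>{a, b, t}. cartan0 s r * c r)"
    unfolding coroot_def using assms by (intro sum.mono_neutral_right[OF fin]) (auto simp: aI bI sroot_def)
  then show ?thesis using ab assms(1)[OF assms(2)] assms(2) by (auto simp: sroot_def)
qed

lemma cartan0_off: "s \<noteq> t \<Longrightarrow> cartan0 s t = 0 \<or> cartan0 s t = -3"
  by (simp add: cartan0_def)

text \<open>For two walls of the same type this raises the step between possible pairings from 3 to
  9, so that they jump from 2 directly to -7 and avoid -1.\<close>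

lemma ract_dvd3:
  assumes "set w \<subseteq> {a, b}" "t \<in> I - {a, b}"
  shows "3 dvd ract w (sroot t) a \<and> 3 dvd ract w (sroot t) b"
  using assms(1)
proof (induction w)
  case Nil
  then show ?case using assms by (auto simp: sroot_def)
next
  case (Cons r w)
  let ?c = "ract w (sroot t)"
  have c: "coroot ?c s = cartan0 s a * ?c a + cartan0 s b * ?c b + cartan0 s t" for s
    by (rule coroot_abt) (use Cons.prems assms(2) in \<open>auto simp: ract_ab\<close>)
  have "3 dvd cartan0 r t" using cartan0_off[of r t] Cons.prems assms(2) by auto
  then have "3 dvd coroot ?c r" using Cons unfolding c by simp
  then show ?case using Cons by (simp add: rstep_coroot)
qed

text \<open>A new letter replaces the smaller coefficient \<open>x\<close> by
  \<open>3 y - x\<close>, where \<open>y\<close> is the larger one. From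
  \<open>y \<ge> 2 x \<ge> 0\<close> it follows that \<open>3 y - x \<ge> 2 y\<close>, so the
  domination survives.\<close>

lemma dihedral_root:
  assumes "i \<le> j"
  defines "c \<equiv> \<lambda>i. ract (seg i j) (sroot (alt j))"
  shows "c i (alt i) \<ge> 1 \<and> c i (alt (Suc i)) \<ge> 0 \<and> c i (alt i) \<ge> 2 * c i (alt (Suc i))"
  using assms(1)
proof (induction rule: inc_induct)
  case base
  show ?case using alt_neq[of j] by (simp add: c_def sroot_def)
next
  case (step i)
  have z: "c (Suc i) r = 0" if "r \<notin> {a, b}" for r
    using that set_seg by (auto simp: c_def ract_ab sroot_def alt_def)
  have alt2: "alt (Suc (Suc i)) = alt i" by (simp add: alt_def)
  have "coroot (c (Suc i)) (alt i) = cartan0 (alt i) a * c (Suc i) a + cartan0 (alt i) b * c (Suc i) b"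
    by (rule coroot_ab) (use z in auto)
  also have "\<dots> = 2 * c (Suc i) (alt i) - 3 * c (Suc i) (alt (Suc i))"
    using ab mab m_sym[OF aI bI] by (auto simp: alt_def cartan0_def)
  finally have "c i (alt i) = 3 * c (Suc i) (alt (Suc i)) - c (Suc i) (alt i)"
    "c i (alt (Suc i)) = c (Suc i) (alt (Suc i))"
    using step.hyps alt_neq[of i] by (auto simp: c_def seg_Cons rstep_coroot sroot_def)
  then show ?case using step.IH unfolding alt2 by linarith
qed

section \<open>Pairings of the wall roots\<close>

lemma bil_root: "s \<in> I \<Longrightarrow> bil (root i s) (root j t) = coroot (ract (rev (seg 0 i)) (root j t)) s"
  unfolding root_def[of i] by (simp add: bil_ract) (simp add: bil_def ev_sroot)

lemma bil_root_self: "s \<in> I \<Longrightarrow> bil (root i s) (root i s) = 2"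
  by (simp add: bil_root) (simp add: root_def ract_cancel coroot_def sum_sroot)

text \<open>Seen from chamber \<open>i\<close>, the second root has coefficient 0 at
  \<open>s\<close> and nonnegative coefficients elsewhere, while the entries of
  \<open>cartan0\<close> off the diagonal are 0 or -3.\<close>

lemma bil_root_distinct:
  assumes e: "ext i s" "ext j t" and st: "s \<noteq> t" "s \<notin> {a, b}"
  shows "bil (root i s) (root j t) = 0 \<or> bil (root i s) (root j t) \<le> -3"
proof -
  have I: "s \<in> I" "i < k" using e by (auto simp: ext_def)
  define c where "c = ract (rev (seg 0 i)) (root j t)"
  have nn: "c r \<ge> 0" if "r \<in> I" for r unfolding c_def by (rule root_nonneg[OF e(2) I(2) that])
  have cs: "c s = 0"
    using st set_seg ract_ab[of "rev (seg 0 i) @ seg 0 j" s "sroot t"]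
    by (auto simp: c_def root_def sroot_def ract_append subset_iff)
  have "coroot c s = (\<Sum>r\<in>I. cartan0 s r * c r)" by (simp add: coroot_def)
  moreover have "3 dvd (\<Sum>r\<in>I. cartan0 s r * c r)"
    using cs cartan0_off[of s] by (intro dvd_sum) (metis dvd_0_right dvd_minus_iff dvd_refl dvd_mult2 mult_zero_right)
  moreover have "(\<Sum>r\<in>I. cartan0 s r * c r) \<le> 0"
    using cs cartan0_off[of s] nn by (intro sum_nonpos) (metis mult_nonpos_nonneg mult_zero_right neg_numeral_le_zero order_refl)
  ultimately obtain z where "bil (root i s) (root j t) = 3 * z" "3 * z \<le> 0"
    using bil_root[OF I(1), of i j t] by (auto simp: c_def elim!: dvdE)
  then show ?thesis by (cases "z = 0") auto
qed

text \<open>Seen from chamber \<open>i\<close>, the second root has coefficient 1 at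
  \<open>s\<close>, so the pairing is 2 minus a nonnegative multiple of 9. If it equals 2,
  invariance of the norm kills the coefficients at \<open>a\<close> and \<open>b\<close>, and the
  two roots coincide.\<close>

lemma root_same_type:
  assumes e: "ext i s" "ext j s" and s: "s \<notin> {a, b}"
  shows "root i s = root j s \<or> bil (root i s) (root j s) \<le> -7"
proof -
  have I: "s \<in> I" "i < k" using e by (auto simp: ext_def)
  define w where "w = rev (seg 0 i) @ seg 0 j"
  have w: "set w \<subseteq> {a, b}" "set w \<subseteq> I" using set_seg by (auto simp: w_def)
  define c where "c = ract w (sroot s)"
  have c_root: "c = ract (rev (seg 0 i)) (root j s)" by (simp add: c_def w_def root_def ract_append)
  have nn: "c r \<ge> 0" if "r \<in> I" for r unfolding c_root by (rule root_nonneg[OF e(2) I(2) that])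
  have off: "c r = sroot s r" if "r \<notin> {a, b}" for r using that w by (simp add: c_def ract_ab)
  have co: "coroot c t = cartan0 t a * c a + cartan0 t b * c b + cartan0 t s" for t
    by (rule coroot_abt) (use off I s in auto)
  have "3 dvd c a" "3 dvd c b" using ract_dvd3[OF w(1), of s] I s by (auto simp: c_def)
  then obtain p q where pq: "c a = 3 * p" "c b = 3 * q" by (elim dvdE)
  have pq0: "p \<ge> 0" "q \<ge> 0" using nn aI bI pq by fastforce+
  have B: "bil (root i s) (root j s) = coroot c s" using bil_root[OF I(1)] c_root by simp
  show ?thesis
  proof (cases "coroot c s = 2")
    case True
    have "cartan0 s a * c a = 0" "cartan0 s b * c b = 0"
      using True co[of s] cartan0_off[of s a] cartan0_off[of s b] s pq pq0 by auto
    then have za: "cartan0 s a = 0 \<or> c a = 0" and zb: "cartan0 s b = 0 \<or> c b = 0" by auto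
    have sym: "cartan0 a s = cartan0 s a" "cartan0 b s = cartan0 s b"
      using cartan0_sym aI bI I by auto
    have ab0: "cartan0 a b = -3" "cartan0 b a = -3" using ab mab m_sym[OF aI bI] by (auto simp: cartan0_def)
    have "bil c c = 2"
      using w I by (simp add: c_def bil_ract ract_cancel) (simp add: bil_def ev_sroot coroot_def sum_sroot)
    moreover have "bil c c = c a * coroot c a + c b * coroot c b + coroot c s"
    proof -
      have "bil c c = (\<Sum>r\<in>{a, b, s}. c r * coroot c r)"
        unfolding bil_def ev_def using off aI bI I
        by (intro sum.mono_neutral_right[OF fin]) (auto simp: sroot_def)
      then show ?thesis using ab s off[OF s] by (auto simp: sroot_def)
    qed
    ultimately have q0: "c a * (2 * c a - 3 * c b) + c b * (2 * c b - 3 * c a) = 0"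
      using True za zb by (auto simp: co[of a] co[of b] ab0 sym)
    have "c a = 0 \<and> c b = 0"
    \<comment> \<open>If \<open>s\<close> commutes with both \<open>a\<close> and \<open>b\<close>,
      the word fixes the simple root of \<open>s\<close>. Otherwise \<open>za\<close> or
      \<open>zb\<close> makes one coefficient 0, and \<open>q0\<close> then forces the other to
      vanish.\<close>
    proof (cases "cartan0 s a = 0 \<and> cartan0 s b = 0")
      case True
      have "ract w (sroot s) = sroot s"
        using w(1)
      proof (induction w)
        case (Cons r w)
        have "coroot (sroot s) r = cartan0 r s" using sum_sroot I by (simp add: coroot_def)
        also have "\<dots> = 0" using Cons.prems True sym by auto
        finally show ?case using Cons by (simp add: rstep_coroot)
      qed simp
      then show ?thesis using s by (auto simp: c_def sroot_def)
    next
      case False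
      then show ?thesis using za zb q0 by auto
    qed
    then have "c x = sroot s x" for x using off[of x] s by (cases "x \<in> {a, b}") (auto simp: sroot_def)
    then have "c = sroot s" by blast
    then have "ract (seg 0 i) c = root i s" by (simp add: root_def)
    moreover have "ract (seg 0 i) c = root j s"
      using ract_cancel[of "rev (seg 0 i)" "root j s"] by (simp add: c_root)
    ultimately show ?thesis by simp
  next
    case False
    then have "coroot c s \<le> -7"
      using co[of s] cartan0_off[of s a] cartan0_off[of s b] s pq pq0 by auto
    then show ?thesis using B by simp
  qed
qed

lemma ext_ab: "ext i s \<Longrightarrow> s \<in> {a, b} \<Longrightarrow> (i = 0 \<and> s = b) \<or> (i = k - 1 \<and> s = alt i)"
  using ab by (cases i) (auto simp: ext_def alt_def split: if_splits)

text \<open>The case left over by the other two lemmas: by \<open>ext_ab\<close>, the only outer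
  walls of type \<open>a\<close> or \<open>b\<close> are the two ends of the gallery.\<close>

lemma bil_walls: "bil (root 0 b) (root j (alt j)) \<le> -3"
proof -
  let ?c = "root j (alt j)"
  have "?c r = 0" if "r \<notin> {a, b}" for r
    using that set_seg by (auto simp: root_def ract_ab sroot_def alt_def)
  then have "coroot ?c b = cartan0 b a * ?c a + cartan0 b b * ?c b" by (intro coroot_ab) auto
  also have "\<dots> = 2 * ?c b - 3 * ?c a" using ab mab m_sym[OF aI bI] by (simp add: cartan0_def)
  finally have "bil (root 0 b) ?c = 2 * ?c b - 3 * ?c a" using bil_root[OF bI, of 0 j "alt j"] by simp
  moreover have "?c a \<ge> 1" "?c b \<ge> 0" "?c a \<ge> 2 * ?c b"
    using dihedral_root[of 0 j] by (auto simp: root_def alt_def)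
  ultimately show ?thesis by (cases "?c b = 0") auto
qed

lemma root_trichotomy:
  assumes e: "ext i s" "ext j t"
  shows "root i s = root j t \<or> bil (root i s) (root j t) = 0 \<or> bil (root i s) (root j t) \<le> -3"
proof (cases "s \<notin> {a, b} \<or> t \<notin> {a, b}")
  case True
  then show ?thesis
    using bil_root_distinct[OF e] bil_root_distinct[OF e(2,1)] root_same_type[of i s j] e
      bil_sym[of "root i s" "root j t"] by (cases "s = t") auto
next
  case False
  then show ?thesis using ext_ab[OF e(1)] ext_ab[OF e(2)] bil_walls[of i] bil_walls[of j]
      bil_sym[of "root i s" "root j t"] by auto
qed

end

section \<open>Reflections as palindromic words\<close>

context ra_matrix
begin

lemma cancel_prefix: "set u \<subseteq> I \<Longrightarrow> cox_eq I m (rev u @ w) [] \<Longrightarrow> cox_eq I m w u"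
proof -
  assume u: "set u \<subseteq> I" and e: "cox_eq I m (rev u @ w) []"
  have "cox_eq I m ((u @ rev u) @ w) ([] @ w)"
    using rev_cancel_right[OF u] by (intro cox_eq_append cox_eq.refl)
  moreover have "cox_eq I m (u @ rev u @ w) (u @ [])" using e by (intro cox_eq_append cox_eq.refl)
  ultimately show ?thesis by (simp, meson cox_eq.sym cox_eq.trans)
qed

lemma prefix_quotient: "set u \<subseteq> I \<Longrightarrow> cox_eq I m w u \<Longrightarrow> cox_eq I m (rev u @ w) []"
  using cox_eq_append[OF cox_eq.refl, of I m w u "rev u"] rev_cancel_left[of u] by (blast intro: cox_eq.trans)

lemma act_eq_imp:
  assumes "set u \<subseteq> I" "set w \<subseteq> I" "\<And>h. act cartan0 u h = act cartan0 w h"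
  shows "cox_eq I m u w"
proof -
  have "act cartan0 (rev w @ u) h = h" for h
    using act_cox_eq[OF compat_cartan0 rev_cancel_left[OF assms(2)], of h] assms(3) by (simp add: act_append)
  then have "cox_eq I m (rev w @ u) []"
    using act_faithful[OF compat_cartan0, of "\<lambda>_. -1" "rev w @ u"] assms by simp
  then show ?thesis by (rule cancel_prefix[OF assms(2)])
qed

lemma reflection_ne_one: "set g \<subseteq> I \<Longrightarrow> s \<in> I \<Longrightarrow> \<not> cox_eq I m (g @ s # rev g) []"
proof
  assume g: "set g \<subseteq> I" "s \<in> I" and "cox_eq I m (g @ s # rev g) []"
  then have "cox_eq I m (rev g @ (g @ s # rev g) @ g) (rev g @ [] @ g)" by (intro cox_eq.ctx)
  moreover have "cox_eq I m ((rev g @ g) @ [s] @ (rev g @ g)) ([] @ [s] @ [])"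
    using rev_cancel_left[OF g(1)] by (intro cox_eq_append cox_eq.refl)
  ultimately have "cox_eq I m [s] []"
    using rev_cancel_left[OF g(1)] by simp (meson cox_eq.sym cox_eq.trans)
  then have "pos [s] s = pos [] s" by (rule pos_cong)
  then show False using pos_Cons_self[of "[]" s] g by simp
qed

lemma reflectionE:
  assumes "t \<in> cox_reflections I m"
  obtains g s where "set g \<subseteq> I" "s \<in> I" "t = cl (g @ s # rev g)"
proof -
  obtain x s where x: "x \<in> carrier G" "s \<in> I" and t: "t = x \<otimes>\<^bsub>G\<^esub> cox_gen I m s \<otimes>\<^bsub>G\<^esub> inv\<^bsub>G\<^esub> x"
    using assms by (auto simp: cox_reflections_def)
  obtain g where g: "set g \<subseteq> I" "x = cl g" using x(1) by (rule carrierE)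
  have "t = cl (g @ s # rev g)" unfolding t using g x by (simp add: cox_gen_def inv_cl mult_cl)
  then show ?thesis using that g x by blast
qed

lemma reflectionI:
  assumes "set g \<subseteq> I" "s \<in> I" shows "cl (g @ s # rev g) \<in> cox_reflections I m"
proof -
  have "cl (g @ s # rev g) = cl g \<otimes>\<^bsub>G\<^esub> cox_gen I m s \<otimes>\<^bsub>G\<^esub> inv\<^bsub>G\<^esub> (cl g)"
    using assms by (simp add: cox_gen_def inv_cl mult_cl)
  then show ?thesis using cl_carrier[OF assms(1)] assms(2) unfolding cox_reflections_def by blast
qed

end

context dihedral
begin

lemma set_rw: "s \<in> I \<Longrightarrow> set (rw i s) \<subseteq> I"
  using set_seg_I by (auto simp: rw_def)

lemma rev_rw [simp]: "rev (rw i s) = rw i s" by (simp add: rw_def)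

lemma act_rw: "s \<in> I \<Longrightarrow> act cartan0 (rw i s) h = (\<lambda>t. h t - ev (root i s) h * coroot (root i s) t)"
  unfolding rw_def root_def by (rule act_reflection) simp_all

text \<open>Equal reflections force the square of the pairing of their roots to be 4. The value -2,
  which opposite roots would give, is excluded by the trichotomy.\<close>

lemma cl_rw_iff:
  assumes e: "ext i s" "ext j t"
  shows "cl (rw i s) = cl (rw j t) \<longleftrightarrow> root i s = root j t"
proof
  have I: "s \<in> I" "t \<in> I" using e by (auto simp: ext_def)
  show "root i s = root j t" if "cl (rw i s) = cl (rw j t)"
  proof -
    have "cox_eq I m (rw i s) (rw j t)" using that cl_eq_iff[OF set_rw[OF I(1)]] by simp
    then have eq: "act cartan0 (rw i s) h = act cartan0 (rw j t) h" for h
      by (rule act_cox_eq[OF compat_cartan0])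
    let ?c = "root i s" and ?c' = "root j t"
    have 1: "ev ?c h * coroot ?c r = ev ?c' h * coroot ?c' r" for h r
      using fun_cong[OF eq[of h], of r] by (simp add: act_rw I)
    have "2 * coroot ?c r = bil ?c ?c' * coroot ?c' r" for r
      using 1[of "coroot ?c" r] bil_root_self[OF I(1), of i] bil_sym[of ?c ?c'] by (simp add: bil_def)
    then have "ev ?c (\<lambda>r. 2 * coroot ?c r) = ev ?c (\<lambda>r. bil ?c ?c' * coroot ?c' r)" by simp
    then have "2 * ev ?c (coroot ?c) = bil ?c ?c' * ev ?c (coroot ?c')"
      by (simp add: ev_def sum_distrib_left mult.left_commute)
    then have "4 = bil ?c ?c' * bil ?c ?c'" using bil_root_self[OF I(1), of i] by (simp add: bil_def)
    moreover have "bil ?c ?c' * bil ?c ?c' \<ge> 9" if "bil ?c ?c' \<le> -3"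
      using that mult_mono[of 3 "- bil ?c ?c'" 3 "- bil ?c ?c'"] by simp
    ultimately show ?thesis using root_trichotomy[OF e] by auto
  qed
  show "cl (rw i s) = cl (rw j t)" if "root i s = root j t"
    by (intro cl_eqI act_eq_imp set_rw I) (simp add: act_rw I that)
qed

section \<open>The reflection subgroup as an abstract Coxeter group\<close>

definition ix :: "'i list set \<Rightarrow> nat \<times> 'i" where
  "ix x = (SOME p. ext (fst p) (snd p) \<and> cl (rw (fst p) (snd p)) = x)"

text \<open>One wall can bound several chambers of the gallery, so a generator may come from several
  pairs \<open>(i, s)\<close>. By \<open>cl_rw_iff\<close> the root does not depend on the pair
  chosen in \<open>ix\<close>.\<close>

definition rt :: "'i list set \<Rightarrow> 'i \<Rightarrow> int" where "rt x = root (fst (ix x)) (snd (ix x))"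

text \<open>The empty word outside \<open>X\<close> lets \<open>set_wd\<close> and
  \<open>rev_wd\<close> hold without a membership assumption.\<close>

definition wd :: "'i list set \<Rightarrow> 'i list" where
  "wd x = (if x \<in> X then rw (fst (ix x)) (snd (ix x)) else [])"

definition wrd :: "'i list set list \<Rightarrow> 'i list" where "wrd w = concat (map wd w)"

definition B :: "'i list set \<Rightarrow> 'i list set \<Rightarrow> int" where "B x y = bil (rt x) (rt y)"

definition mB :: "'i list set \<Rightarrow> 'i list set \<Rightarrow> enat" where
  "mB x y = (if x = y then 1 else if B x y = 0 then 2 else \<infinity>)"

abbreviation "\<Gamma> \<equiv> generate G X"

lemma ix: "x \<in> X \<Longrightarrow> ext (fst (ix x)) (snd (ix x)) \<and> cl (rw (fst (ix x)) (snd (ix x))) = x"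
  unfolding ix_def by (rule someI_ex) (force simp: X_def)

lemma ix_I: "x \<in> X \<Longrightarrow> snd (ix x) \<in> I" using ix[of x] by (simp add: ext_def)

lemma XI: "ext i s \<Longrightarrow> cl (rw i s) \<in> X" by (auto simp: X_def)

lemma rt_cl: "ext i s \<Longrightarrow> rt (cl (rw i s)) = root i s"
  using ix[OF XI[of i s]] cl_rw_iff[of "fst (ix (cl (rw i s)))" "snd (ix (cl (rw i s)))" i s]
  by (simp add: rt_def)

lemma set_wd [simp]: "set (wd x) \<subseteq> I"
  using set_rw ix_I by (auto simp: wd_def)

lemma cl_wd: "x \<in> X \<Longrightarrow> cl (wd x) = x" using ix by (simp add: wd_def)

lemma rev_wd [simp]: "rev (wd x) = wd x" by (simp add: wd_def)

lemma wrd_simps [simp]: "wrd [] = []" "wrd (x # w) = wd x @ wrd w" "wrd (u @ w) = wrd u @ wrd w"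
  "set (wrd w) \<subseteq> I" "rev (wrd w) = wrd (rev w)"
  using set_wd[THEN subsetD] by (auto simp: wrd_def rev_concat rev_map comp_def)

lemma act_wd: "x \<in> X \<Longrightarrow> act cartan0 (wd x) h = (\<lambda>t. h t - ev (rt x) h * coroot (rt x) t)"
  by (simp add: wd_def rt_def act_rw ix_I)

lemma B_self: "x \<in> X \<Longrightarrow> B x x = 2" by (simp add: B_def rt_def bil_root_self ix_I)

lemma B_sym: "B x y = B y x" by (simp add: B_def bil_sym)

lemma B_off: "x \<in> X \<Longrightarrow> y \<in> X \<Longrightarrow> x \<noteq> y \<Longrightarrow> B x y = 0 \<or> B x y \<le> -3"
  using root_trichotomy[of "fst (ix x)" "snd (ix x)" "fst (ix y)" "snd (ix y)"] ix[of x] ix[of y]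
    cl_rw_iff[of "fst (ix x)" "snd (ix x)" "fst (ix y)" "snd (ix y)"]
  by (auto simp: B_def rt_def)

lemma rt_negative: "x \<in> X \<Longrightarrow> j < k \<Longrightarrow> (\<And>t. t \<in> I \<Longrightarrow> h t < 0) \<Longrightarrow> ev (rt x) (act cartan0 (seg 0 j) h) < 0"
  unfolding rt_def using ix[of x] by (intro root_negative) auto

sublocale XR: ra_matrix X mB
  by unfold_locales (auto simp: mB_def B_sym)

lemma compat_mB:
  assumes "\<And>x. x \<in> X \<Longrightarrow> A x x = (2::'c::linordered_idom)"
    and "\<And>x y. x \<in> X \<Longrightarrow> y \<in> X \<Longrightarrow> x \<noteq> y \<Longrightarrow> B x y = 0 \<Longrightarrow> A x y = 0"
    and "\<And>x y. x \<in> X \<Longrightarrow> y \<in> X \<Longrightarrow> x \<noteq> y \<Longrightarrow> B x y \<noteq> 0 \<Longrightarrow> A x y \<le> -3"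
  shows "XR.compat A"
  unfolding XR.compat_def
proof (intro conjI ballI impI)
  fix x y assume xy: "x \<in> X" "y \<in> X" "x \<noteq> y"
  show "A x y = 0" if "mB x y = 2" using that xy assms(2) by (auto simp: mB_def split: if_splits)
  assume inf: "mB x y = \<infinity>"
  then have nz: "B x y \<noteq> 0" "B y x \<noteq> 0" using xy B_sym[of x y] by (auto simp: mB_def split: if_splits)
  then have le: "A x y \<le> -3" "A y x \<le> -3" using xy assms(3) by auto
  have "(-3::'c) < 0" by simp
  then show "A x y < 0" using le(1) by (rule le_less_trans[rotated])
  have "3 * 3 \<le> (- A x y) * (- A y x)" using le by (intro mult_mono) (auto simp: le_minus_iff intro: order_trans)
  moreover have "(4::'c) \<le> 3 * 3" by simp
  ultimately show "4 \<le> A x y * A y x" by (metis minus_mult_minus order_trans)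
qed (use assms(1) in auto)

lemma compat_B: "XR.compat B"
  using B_off by (intro compat_mB B_self) auto

text \<open>Evaluating all roots of \<Gamma> at a point intertwines the action of the big group with
  the abstract action of matrix \<open>B\<close>. Thus \<open>act_faithful\<close> becomes available
  for words in the generators of \<Gamma>.\<close>

lemma act_wrd: "set w \<subseteq> X \<Longrightarrow> (\<lambda>x. ev (rt x) (act cartan0 (wrd w) h)) = act B w (\<lambda>x. ev (rt x) h)"
proof (induction w)
  case (Cons r w)
  let ?H = "act cartan0 (wrd w) h"
  have IH: "ev (rt x) ?H = act B w (\<lambda>x. ev (rt x) h) x" for x
    using Cons fun_cong[OF Cons.IH, of x] by simp
  have "ev (rt x) (act cartan0 (wrd (r # w)) h) = ev (rt x) ?H - B x r * ev (rt r) ?H" for x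
    using Cons.prems by (simp add: act_append act_wd ev_diff B_def bil_def)
  then show ?case by (simp add: IH step_def)
qed simp

lemma wrd_cong: "cox_eq X mB u w \<Longrightarrow> cox_eq I m (wrd u) (wrd w)"
proof (induction rule: cox_eq.induct)
  case (rel s t n)
  show ?case
  proof (cases "s = t")
    case True
    then have "n = 1" using rel by (simp add: mB_def one_enat_def)
    then show ?thesis using rev_cancel_right[OF set_wd[of s]] True by simp
  next
    case False
    then have st: "B s t = 0" "n = 2" using rel by (auto simp: mB_def numeral_eq_enat split: if_splits)
    have "ev (rt s) (coroot (rt t)) = 0" "ev (rt t) (coroot (rt s)) = 0"
      "ev (rt s) (coroot (rt s)) = 2" "ev (rt t) (coroot (rt t)) = 2"
      using st(1) B_sym[of s t] B_self rel by (auto simp: B_def bil_def)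
    then have "act cartan0 (wd s @ wd t @ wd s @ wd t) h = h" for h
      by (simp add: act_append act_wd rel ev_diff fun_eq_iff)
    then have "cox_eq I m (wd s @ wd t @ wd s @ wd t) []" using set_wd by (intro act_id_imp) auto
    then show ?thesis by (simp add: st(2) numeral_2_eq_2)
  qed
qed (auto intro: cox_eq.refl cox_eq.sym cox_eq.trans cox_eq.ctx)

text \<open>With \<open>j = 0\<close> this yields the presentation of \<Gamma>
  (\<open>wrd_inj\<close>); with general \<open>j\<close> it separates the cosets of the chambers of
  the gallery (\<open>transversal\<close>).\<close>

lemma act_wrd_faithful:
  assumes "set w \<subseteq> X" "j < k" "\<And>x. x \<in> X \<Longrightarrow> ev (rt x) (act cartan0 (wrd w @ seg 0 j) (\<lambda>_. -1)) \<le> 0"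
  shows "cox_eq X mB w []"
proof (rule XR.act_faithful[OF compat_B _ assms(1)])
  let ?h = "act cartan0 (seg 0 j) (\<lambda>_. -1)"
  show "\<And>x. x \<in> X \<Longrightarrow> ev (rt x) ?h < 0" using rt_negative[OF _ assms(2)] by simp
  show "\<And>x. x \<in> X \<Longrightarrow> act B w (\<lambda>x. ev (rt x) ?h) x \<le> 0"
    using assms(3) fun_cong[OF act_wrd[OF assms(1), of ?h]] by (simp add: act_append)
qed

lemma wrd_inj:
  assumes "set u \<subseteq> X" "set w \<subseteq> X" "cl (wrd u) = cl (wrd w)"
  shows "cox_eq X mB u w"
proof -
  have "cox_eq I m (wrd u) (wrd w)" using assms(3) cl_eq_iff[of "wrd u"] by simp
  then have "cox_eq I m (rev (wrd w) @ wrd u) []" by (intro prefix_quotient) auto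
  then have "cox_eq I m (wrd (rev w @ u)) []" by simp
  then have "act cartan0 (wrd (rev w @ u) @ seg 0 0) h = h" for h
    using act_cox_eq[OF compat_cartan0] by simp
  then have "cox_eq X mB (rev w @ u) []"
    using assms k1 rt_negative[of _ 0 "\<lambda>_. -1"] by (intro act_wrd_faithful[of _ 0]) (auto intro: less_imp_le)
  then show ?thesis by (rule XR.cancel_prefix[OF assms(2)])
qed

lemma gamma_iff: "g \<in> \<Gamma> \<longleftrightarrow> (\<exists>w. set w \<subseteq> X \<and> g = cl (wrd w))"
proof
  show "\<exists>w. set w \<subseteq> X \<and> g = cl (wrd w)" if "g \<in> \<Gamma>"
    using that
  proof (induction rule: generate.induct)
    case one
    show ?case by (rule exI[of _ "[]"]) (simp add: one_cl)
  next
    case (incl h)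
    then show ?case by (intro exI[of _ "[h]"]) (simp add: cl_wd)
  next
    case (inv h)
    then have "inv\<^bsub>G\<^esub> h = cl (wrd [h])" using inv_cl[OF set_wd[of h]] by (simp add: cl_wd)
    then show ?case using inv by (intro exI[of _ "[h]"]) simp
  next
    case (eng g h)
    then obtain u w where "set u \<subseteq> X" "g = cl (wrd u)" "set w \<subseteq> X" "h = cl (wrd w)" by blast
    then show ?case by (intro exI[of _ "u @ w"]) (simp add: mult_cl)
  qed
  have "set w \<subseteq> X \<Longrightarrow> cl (wrd w) \<in> \<Gamma>" for w
  proof (induction w)
    case Nil
    then show ?case using generate.one[of G X] by (simp add: one_cl)
  next
    case (Cons x w)
    then have "x \<otimes>\<^bsub>G\<^esub> cl (wrd w) \<in> \<Gamma>"
      using generate.eng[OF generate.incl[of x X G], of "cl (wrd w)"] by simp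
    moreover have "x \<otimes>\<^bsub>G\<^esub> cl (wrd w) = cl (wrd (x # w))"
      using mult_cl[of "wd x" "wrd w"] cl_wd[of x] Cons.prems by simp
    ultimately show ?case by simp
  qed
  then show "\<exists>w. set w \<subseteq> X \<and> g = cl (wrd w) \<Longrightarrow> g \<in> \<Gamma>" by blast
qed

section \<open>Fundamental domain, index and canonical generators\<close>

lemma X_carrier: "X \<subseteq> carrier G"
  using cl_carrier set_rw by (fastforce simp: X_def ext_def)

lemma subgroup_gamma: "subgroup \<Gamma> G"
  by (rule group.generate_is_subgroup[OF group_G X_carrier])

lemma reflection_subgroup_gamma: "reflection_subgroup I m \<Gamma>"
proof -
  have "X \<subseteq> cox_reflections I m" using reflectionI[of "seg 0 _"] by (auto simp: X_def rw_def ext_def)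
  then show ?thesis unfolding reflection_subgroup_def by blast
qed

text \<open>Every chamber of the gallery is negative for all roots of \<Gamma>, so an element of
  \<Gamma> that maps one of them into the gallery is trivial.\<close>

lemma transversal:
  assumes w: "set w \<subseteq> X" and ij: "i < k" "j < k" and eq: "cox_eq I m (wrd w @ seg 0 j) (seg 0 i)"
  shows "i = j"
proof -
  let ?h = "\<lambda>_. -1 :: int"
  have "act cartan0 (wrd w @ seg 0 j) ?h = act cartan0 (seg 0 i) ?h"
    by (rule act_cox_eq[OF compat_cartan0 eq])
  then have "cox_eq X mB w []"
    using rt_negative[OF _ ij(1), of _ ?h] by (intro act_wrd_faithful[OF w ij(2)]) (auto intro: less_imp_le)
  from cox_eq_append[OF wrd_cong[OF this] cox_eq.refl, of "seg 0 j"]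
  have "cox_eq I m (wrd w @ seg 0 j) (seg 0 j)" by simp
  then have e: "cox_eq I m (seg 0 i) (seg 0 j)" using eq by (meson cox_eq.sym cox_eq.trans)
  have *: "p = q" if e: "cox_eq I m (seg 0 p) (seg 0 q)" and "p \<le> q" for p q
  proof (rule ccontr)
    assume "p \<noteq> q"
    then have "p < q" using that by simp
    have "cox_eq I m (rev (seg 0 p) @ seg 0 q) []" using e cox_eq.sym by (intro prefix_quotient) auto
    then have "cox_eq I m (seg p q) []" using seg_quotient(1)[OF that(2)] by (meson cox_eq.sym cox_eq.trans)
    then have "act cartan0 (seg p q) ?h (alt p) = -1" using act_cox_eq[OF compat_cartan0] by simp
    moreover have "act cartan0 (seg p q) ?h (alt p) > 0"
      using act_sign[OF compat_cartan0, of ?h "seg p q"] seg_good[of p q] \<open>p < q\<close> by auto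
    ultimately show False by simp
  qed
  show ?thesis
  proof (cases "i \<le> j")
    case True
    then show ?thesis using *[OF e] by simp
  next
    case False
    then show ?thesis using *[OF cox_eq.sym[OF e]] by simp
  qed
qed

lemma step_chamber:
  assumes "j < k" "s \<in> I" "\<not> ext j s"
  shows "\<exists>i<k. cox_eq I m (seg 0 j @ [s]) (seg 0 i)"
proof -
  consider "s = alt j" "Suc j < k" | "0 < j" "s = alt (j - 1)" using assms by (auto simp: ext_def)
  then show ?thesis
  proof cases
    case 1
    then show ?thesis by (intro exI[of _ "Suc j"]) (simp add: seg_Suc cox_eq.refl)
  next
    case 2
    then have "seg 0 j = seg 0 (j - 1) @ [s]" using seg_Suc[of 0 "j - 1"] by simp
    then have "cox_eq I m (seg 0 j @ [s]) (seg 0 (j - 1))"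
      using cox_eq.ctx[OF cancel2[OF assms(2), of "[]"], of "seg 0 (j - 1)" "[]"] by simp
    then show ?thesis using assms(1) by (intro exI[of _ "j - 1"]) auto
  qed
qed

text \<open>Folding: the gallery of \<open>w\<close> is read letter by letter, and each time it
  leaves the domain the reflection in the wall just crossed is absorbed into the
  \<Gamma>-part.\<close>

lemma decompose:
  "set w \<subseteq> I \<Longrightarrow> \<exists>u j. set u \<subseteq> X \<and> j < k \<and> cox_eq I m w (wrd u @ seg 0 j)"
proof (induction w rule: rev_induct)
  case Nil
  show ?case using k1 by (intro exI[of _ "[]"] exI[of _ 0]) (simp add: cox_eq.refl)
next
  case (snoc s w)
  then obtain u j where u: "set u \<subseteq> X" "j < k" "cox_eq I m w (wrd u @ seg 0 j)" by auto
  have s: "s \<in> I" using snoc.prems by simp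
  have e: "cox_eq I m (w @ [s]) (wrd u @ seg 0 j @ [s])"
    using cox_eq_append[OF u(3) cox_eq.refl, of "[s]"] by simp
  show ?case
  proof (cases "ext j s")
    case True
    let ?x = "cl (rw j s)"
    have "cl (wd ?x) = cl (rw j s)" by (rule cl_wd[OF XI[OF True]])
    then have 1: "cox_eq I m (wd ?x) (rw j s)" using cl_eq_iff[OF set_wd] by simp
    have "cox_eq I m (rw j s @ seg 0 j) ((seg 0 j @ [s]) @ [])"
      using cox_eq_append[OF cox_eq.refl rev_cancel_left[of "seg 0 j"], of "seg 0 j @ [s]"]
      by (simp add: rw_def)
    then have "cox_eq I m (wd ?x @ seg 0 j) (seg 0 j @ [s])"
      using cox_eq_append[OF 1 cox_eq.refl, of "seg 0 j"] cox_eq.trans by fastforce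
    then have "cox_eq I m (wrd u @ seg 0 j @ [s]) (wrd (u @ [?x]) @ seg 0 j)"
      using cox_eq_append[OF cox_eq.refl, of I m _ _ "wrd u"] cox_eq.sym by fastforce
    then have "cox_eq I m (w @ [s]) (wrd (u @ [?x]) @ seg 0 j)" using e by (rule cox_eq.trans[rotated])
    then show ?thesis using u XI[OF True] by (intro exI[of _ "u @ [?x]"] exI[of _ j]) auto
  next
    case False
    then obtain i where i: "i < k" "cox_eq I m (seg 0 j @ [s]) (seg 0 i)"
      using step_chamber[OF u(2) s] by blast
    have "cox_eq I m (w @ [s]) (wrd u @ seg 0 i)"
      using cox_eq.trans[OF e cox_eq_append[OF cox_eq.refl i(2)]] .
    then show ?thesis using u i by blast
  qed
qed

lemma finite_index_gamma: "finite_index G \<Gamma>"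
proof -
  have "rcosets\<^bsub>G\<^esub> \<Gamma> \<subseteq> (\<lambda>j. \<Gamma> #>\<^bsub>G\<^esub> cl (seg 0 j)) ` {..<k}"
  proof
    fix C assume "C \<in> rcosets\<^bsub>G\<^esub> \<Gamma>"
    then obtain g where g: "g \<in> carrier G" "C = \<Gamma> #>\<^bsub>G\<^esub> g" by (auto simp: RCOSETS_def)
    obtain w where w: "set w \<subseteq> I" "g = cl w" using g(1) by (rule carrierE)
    obtain u j where u: "set u \<subseteq> X" "j < k" "cox_eq I m w (wrd u @ seg 0 j)"
      using decompose[OF w(1)] by blast
    have g2: "g = cl (wrd u) \<otimes>\<^bsub>G\<^esub> cl (seg 0 j)" using w cl_eqI[OF u(3)] by (simp add: mult_cl)
    have in\<Gamma>: "cl (wrd u) \<in> \<Gamma>" using u gamma_iff by blast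
    have "C = \<Gamma> #>\<^bsub>G\<^esub> cl (wrd u) #>\<^bsub>G\<^esub> cl (seg 0 j)"
      unfolding g(2) g2 using subgroup.subset[OF subgroup_gamma]
      by (intro group.coset_mult_assoc[OF group_G, symmetric] cl_carrier) auto
    also have "\<Gamma> #>\<^bsub>G\<^esub> cl (wrd u) = \<Gamma>"
      by (intro group.coset_join2[OF group_G _ subgroup_gamma in\<Gamma>] cl_carrier) simp
    finally show "C \<in> (\<lambda>j. \<Gamma> #>\<^bsub>G\<^esub> cl (seg 0 j)) ` {..<k}" using u(2) by blast
  qed
  then show ?thesis unfolding finite_index_def by (rule finite_subset) simp
qed

text \<open>Such a reflection maps chamber \<open>l\<close> to chamber \<open>l + 1\<close>, and
  these represent different cosets of \<Gamma>.\<close>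

lemma internal_wall:
  assumes "Suc l < k" shows "cl (rw l (alt l)) \<notin> \<Gamma>"
proof
  assume "cl (rw l (alt l)) \<in> \<Gamma>"
  then obtain w where w: "set w \<subseteq> X" "cl (rw l (alt l)) = cl (wrd w)" using gamma_iff by blast
  then have "cox_eq I m (wrd w) (rw l (alt l))" using cl_eq_iff[of "wrd w" "rw l (alt l)"] by simp
  then have "cox_eq I m (wrd w @ seg 0 l) (rw l (alt l) @ seg 0 l)"
    by (intro cox_eq_append cox_eq.refl)
  moreover have "cox_eq I m (rw l (alt l) @ seg 0 l) ((seg 0 l @ [alt l]) @ [])"
    using cox_eq_append[OF cox_eq.refl rev_cancel_left[of "seg 0 l"], of "seg 0 l @ [alt l]"]
    by (simp add: rw_def)
  ultimately have "cox_eq I m (wrd w @ seg 0 l) (seg 0 (Suc l))"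
    by (simp add: seg_Suc) (rule cox_eq.trans)
  then show False using transversal[OF w(1), of "Suc l" l] assms by simp
qed

lemma mult_gamma: "g \<in> \<Gamma> \<Longrightarrow> h \<in> \<Gamma> \<Longrightarrow> g \<otimes>\<^bsub>G\<^esub> h \<in> \<Gamma>"
  by (rule generate.eng)

text \<open>A gallery from \<open>1\<close> to the generator \<open>x\<close> stays in the fundamental domain, crosses the wall
  of \<open>x\<close> and then runs in its mirror image, so no other wall of \<open>\<Gamma>\<close> separates \<open>1\<close> from \<open>x\<close>.\<close>
lemma X_canonical:
  assumes e: "ext i s" and t: "t \<in> cox_reflections I m" "t \<in> \<Gamma>"
    and less: "cox_length I m (t \<otimes>\<^bsub>G\<^esub> cl (rw i s)) < cox_length I m (cl (rw i s))"
  shows "t = cl (rw i s)"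
proof -
  have s: "s \<in> I" "i < k" using e by (auto simp: ext_def)
  have rwI: "set (rw i s) \<subseteq> I" by (rule set_rw[OF s(1)])
  obtain g r' where g: "set g \<subseteq> I" "r' \<in> I" "t = cl (g @ r' # rev g)" using t(1) by (rule reflectionE)
  have "set (g @ r' # rev g) \<subseteq> I" using g by auto
  then have "len ((g @ r' # rev g) @ rw i s) < len (rw i s)"
    using less mult_cl[of "g @ r' # rev g" "rw i s"] rwI g by (simp add: len_def)
  then obtain p r q where pq: "rw i s = p @ r # q" and tp: "cox_eq I m (g @ r' # rev g) (p @ r # rev p)"
    using strong_exchange[OF g(1,2) rwI] by blast
  have tp: "t = cl (p @ r # rev p)" using cl_eqI[OF tp] g by simp
  have seg_split: "\<exists>l<i. p' = seg 0 l \<and> r'' = alt l \<and> q' = seg (Suc l) i"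
    if "seg 0 i = p' @ r'' # q'" for p' r'' q'
  proof -
    have l: "length p' < i" using arg_cong[OF that, of length] by (simp add: seg_def)
    have "seg 0 i = seg 0 (length p') @ alt (length p') # seg (Suc (length p')) i"
      using seg_append[of 0 "length p'" i] seg_Cons[of "length p'" i] l by simp
    moreover have "length (seg 0 (length p')) = length p'" by (simp add: seg_def)
    ultimately have "p' = seg 0 (length p')" "r'' # q' = alt (length p') # seg (Suc (length p')) i"
      using that by (metis append_eq_append_conv)+
    then show ?thesis using l by blast
  qed
  consider (before) p' where "seg 0 i = p @ r # p'" | (mid) "p = seg 0 i" "r = s"
    | (after) p' where "p = seg 0 i @ s # p'" "rev (seg 0 i) = p' @ r # q"
    using pq unfolding rw_def by (auto simp: append_eq_append_conv2 Cons_eq_append_conv append_eq_Cons_conv)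
  then show ?thesis
  proof cases
    case before
    then obtain l where "l < i" "p = seg 0 l" "r = alt l" using seg_split by blast
    then show ?thesis using internal_wall[of l] t(2) s(2) tp by (auto simp: rw_def)
  next
    case mid
    then show ?thesis using tp by (simp add: rw_def)
  next
    case after
    \<comment> \<open>The second half of the gallery is the mirror image of the first. Conjugating
      \<open>t\<close> by the generator therefore gives the reflection in an inner wall of the
      domain, which is not in \<Gamma>.\<close>
    then have "seg 0 i = rev q @ r # rev p'" by (metis rev.simps(2) rev_append rev_rev_ident append.assoc append_Cons append_Nil)
    then obtain l where l: "l < i" "rev q = seg 0 l" "r = alt l" "rev p' = seg (Suc l) i"
      using seg_split by blast
    have ps: "p' = rev (seg (Suc l) i)" using arg_cong[OF l(4), of rev] by simp
    let ?x = "rw i s"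
    have pI: "set (p @ r # rev p) \<subseteq> I" using pq rwI by auto
    have 1: "cox_eq I m (?x @ p) (seg 0 (Suc l))"
    proof -
      have "cox_eq I m (seg 0 i @ [s] @ (rev (seg 0 i) @ seg 0 i) @ s # p') (seg 0 i @ [s] @ [] @ s # p')"
        by (intro cox_eq_append cox_eq.refl rev_cancel_left) simp
      then have "cox_eq I m (?x @ p) (seg 0 i @ s # s # p')" using after(1) by (simp add: rw_def)
      moreover have "cox_eq I m (seg 0 i @ s # s # p') (seg 0 i @ p')"
        by (intro cox_eq_append cox_eq.refl cancel2 s)
      moreover have "seg 0 i @ p' = seg 0 (Suc l) @ (seg (Suc l) i @ rev (seg (Suc l) i))"
        using l(1) seg_append[of 0 "Suc l" i] ps by simp
      moreover have "cox_eq I m (seg 0 (Suc l) @ (seg (Suc l) i @ rev (seg (Suc l) i))) (seg 0 (Suc l) @ [])"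
        by (intro cox_eq_append cox_eq.refl rev_cancel_right) simp
      ultimately show ?thesis by (metis append_Nil2 cox_eq.trans)
    qed
    have 2: "cox_eq I m (rev p @ ?x) (rev (seg 0 (Suc l)))"
    proof -
      have pxI: "set (?x @ p) \<subseteq> I" using pq rwI by auto
      have "cox_eq I m (rev (?x @ p)) (rev (seg 0 (Suc l)))"
      proof -
        have "cox_eq I m ((?x @ p) @ rev (seg 0 (Suc l))) (seg 0 (Suc l) @ rev (seg 0 (Suc l)))"
          by (intro cox_eq_append 1 cox_eq.refl)
        then have "cox_eq I m ((?x @ p) @ rev (seg 0 (Suc l))) []"
          by (rule cox_eq.trans) (rule rev_cancel_right, simp)
        then have "cox_eq I m (rev (rev (?x @ p)) @ rev (seg 0 (Suc l))) []" by simp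
        then have "cox_eq I m (rev (seg 0 (Suc l))) (rev (?x @ p))"
          by (rule cancel_prefix[rotated]) (use pxI in simp)
        then show ?thesis by (rule cox_eq.sym)
      qed
      then show ?thesis by simp
    qed
    have "cox_eq I m ((?x @ p) @ [r] @ (rev p @ ?x)) (seg 0 (Suc l) @ [r] @ rev (seg 0 (Suc l)))"
      by (intro cox_eq_append 1 2 cox_eq.refl)
    moreover have "cox_eq I m (seg 0 (Suc l) @ [r] @ rev (seg 0 (Suc l))) (rw l (alt l))"
      using cox_eq.ctx[OF cancel2[OF alt_I, of l "alt l # rev (seg 0 l)"], of "seg 0 l" "[]"]
      by (simp add: seg_Suc l(3) rw_def)
    ultimately have "cl (?x @ (p @ r # rev p) @ ?x) = cl (rw l (alt l))"
      by (intro cl_eqI) (simp, meson cox_eq.trans)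
    moreover have "cl (?x @ (p @ r # rev p) @ ?x) = cl ?x \<otimes>\<^bsub>G\<^esub> (t \<otimes>\<^bsub>G\<^esub> cl ?x)"
      using rwI pI tp by (simp add: mult_cl)
    moreover have "cl ?x \<otimes>\<^bsub>G\<^esub> (t \<otimes>\<^bsub>G\<^esub> cl ?x) \<in> \<Gamma>"
      by (rule mult_gamma[OF generate.incl[OF XI[OF e]] mult_gamma[OF t(2) generate.incl[OF XI[OF e]]]])
    ultimately show ?thesis using internal_wall[of l] l(1) s(2) by simp
  qed
qed

lemma exit_chamber:
  "set w \<subseteq> I \<Longrightarrow> (\<exists>j<k. cox_eq I m w (seg 0 j)) \<or>
    (\<exists>p s q j. w = p @ s # q \<and> ext j s \<and> cox_eq I m p (seg 0 j))"
proof (induction w rule: rev_induct)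
  case Nil
  then show ?case using k1 by (intro disjI1 exI[of _ 0]) (simp add: cox_eq.refl)
next
  case (snoc s w)
  then consider j where "j < k" "cox_eq I m w (seg 0 j)"
    | p s' q j where "w = p @ s' # q" "ext j s'" "cox_eq I m p (seg 0 j)" by auto
  then show ?case
  proof cases
    case 1
    show ?thesis
    proof (cases "ext j s")
      case True
      then show ?thesis using 1 by blast
    next
      case False
      then obtain i where i: "i < k" "cox_eq I m (seg 0 j @ [s]) (seg 0 i)"
        using step_chamber[OF 1(1), of s] snoc.prems by auto
      have "cox_eq I m (w @ [s]) (seg 0 i)"
        using cox_eq.trans[OF cox_eq_append[OF 1(2) cox_eq.refl] i(2)] .
      then show ?thesis using i by blast
    qed
  next
    case 2
    then have "w @ [s] = p @ s' # (q @ [s])" by simp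
    then show ?thesis using 2 by blast
  qed
qed

text \<open>For the harder inclusion, a reduced word of a canonical generator \<open>t\<close> has
  to leave the domain through the wall of some \<open>x\<close> in \<open>X\<close>. Multiplication
  by \<open>x\<close> deletes the letter at this crossing and shortens \<open>t\<close>, so the
  minimality of \<open>t\<close> gives \<open>x = t\<close>.\<close>

theorem canonical_gens_gamma: "canonical_gens I m \<Gamma> = X"
proof
  show "X \<subseteq> canonical_gens I m \<Gamma>"
  proof
    fix x assume x: "x \<in> X"
    then obtain i s where e: "ext i s" "x = cl (rw i s)" by (auto simp: X_def)
    have "x \<in> cox_reflections I m"
      using reflectionI[of "seg 0 i" s] e by (simp add: rw_def ext_def)
    moreover have "x \<in> \<Gamma>" using x by (rule generate.incl)
    ultimately show "x \<in> canonical_gens I m \<Gamma>"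
      using X_canonical[OF e(1)] e(2) unfolding canonical_gens_def by blast
  qed
  show "canonical_gens I m \<Gamma> \<subseteq> X"
  proof
    fix t assume "t \<in> canonical_gens I m \<Gamma>"
    then have t: "t \<in> cox_reflections I m" "t \<in> \<Gamma>"
      and min: "\<And>t'. t' \<in> cox_reflections I m \<Longrightarrow> t' \<in> \<Gamma> \<Longrightarrow>
        cox_length I m (t' \<otimes>\<^bsub>G\<^esub> t) < cox_length I m t \<Longrightarrow> t' = t"
      by (auto simp: canonical_gens_def)
    obtain g r where g: "set g \<subseteq> I" "r \<in> I" "t = cl (g @ r # rev g)" using t(1) by (rule reflectionE)
    let ?g = "g @ r # rev g"
    have gI: "set ?g \<subseteq> I" using g by auto
    obtain w where w: "set w \<subseteq> I" "cox_eq I m w ?g" "length w = len ?g" using reducedE[OF gI] by metis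
    have tw: "t = cl w" using cl_eqI[OF w(2)] g by simp
    \<comment> \<open>A gallery that stays inside would end in the base chamber by
      \<open>transversal\<close>, making the reflection \<open>t\<close> trivial.\<close>
    have "\<not> (\<exists>j<k. cox_eq I m w (seg 0 j))"
    proof
      assume "\<exists>j<k. cox_eq I m w (seg 0 j)"
      then obtain j where j: "j < k" "cox_eq I m w (seg 0 j)" by blast
      obtain u where u: "set u \<subseteq> X" "t = cl (wrd u)" using t(2) gamma_iff by blast
      have "cox_eq I m (wrd u) w" using u(2) tw cl_eq_iff[of "wrd u" w] by simp
      then have "cox_eq I m (wrd u @ seg 0 0) (seg 0 j)" 
        using cox_eq.trans[OF _ j(2)] by simp
      then have "j = 0" using transversal[OF u(1) j(1), of 0] k1 by simp
      then have "cox_eq I m ?g []" 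
        using cox_eq.trans[OF cox_eq.sym[OF w(2)] j(2)] by simp
      then show False using reflection_ne_one[OF g(1,2)] by simp
    qed
    then obtain p s q j where p: "w = p @ s # q" "ext j s" "cox_eq I m p (seg 0 j)"
      using exit_chamber[OF w(1)] by blast
    let ?x = "cl (rw j s)"
    have I: "s \<in> I" "set p \<subseteq> I" "set q \<subseteq> I" using p w by auto
    have rp: "cox_eq I m (rev p) (rev (seg 0 j))"
    proof -
      have "cox_eq I m (rev (rev p) @ rev (seg 0 j)) (seg 0 j @ rev (seg 0 j))"
        using cox_eq_append[OF p(3) cox_eq.refl, of "rev (seg 0 j)"] by simp
      then have "cox_eq I m (rev (rev p) @ rev (seg 0 j)) []"
        by (rule cox_eq.trans) (rule rev_cancel_right, simp)
      then have "cox_eq I m (rev (seg 0 j)) (rev p)" by (rule cancel_prefix[rotated]) (use I in simp)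
      then show ?thesis by (rule cox_eq.sym)
    qed
    have "cox_eq I m (p @ [s] @ rev p) (seg 0 j @ [s] @ rev (seg 0 j))"
      by (intro cox_eq_append p(3) rp cox_eq.refl)
    then have x: "?x = cl (p @ s # rev p)" using cl_eqI by (fastforce simp: rw_def)
    have "cox_eq I m ((p @ s # rev p) @ p @ s # q) (p @ q)" using w(1) p(1) by (intro delete_letter) auto
    then have "?x \<otimes>\<^bsub>G\<^esub> t = cl (p @ q)" using I x tw p(1) cl_eqI by (fastforce simp: mult_cl)
    then have "cox_length I m (?x \<otimes>\<^bsub>G\<^esub> t) \<le> length (p @ q)"
      using len_le[of "p @ q" "p @ q"] I by (simp add: cox_eq.refl len_def)
    also have "\<dots> < len ?g" using w(3) p(1) by simp
    also have "len ?g = cox_length I m t" using g by (simp add: len_def)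
    finally have "?x = t"
      using min[of ?x] XI[OF p(2)] reflectionI[of "seg 0 j" s] I generate.incl[of ?x X G]
      by (simp add: rw_def)
    then show "t \<in> X" using XI[OF p(2)] by simp
  qed
qed

lemma pow_cl: "set w \<subseteq> I \<Longrightarrow> cl w [^]\<^bsub>G\<^esub> (n::nat) = cl (concat (replicate n w))"
proof (induction n)
  case (Suc n)
  have "cl w [^]\<^bsub>G\<^esub> Suc n = cl (concat (replicate n w)) \<otimes>\<^bsub>G\<^esub> cl w" using Suc by simp
  also have "\<dots> = cl (concat (replicate n w) @ w)" using Suc.prems by (intro mult_cl) auto
  also have "concat (replicate n w) @ w = concat (replicate (Suc n) w)"
    by (induction n) auto
  finally show ?case .
qed (simp add: one_cl)

text \<open>By \<open>wrd_inj\<close> the powers of the product can be tested in the abstract group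
  with matrix \<open>mB\<close>, where a nonempty good word is never trivial.\<close>

theorem sub_coxeter_matrix_X:
  assumes "x \<in> X" "y \<in> X"
  shows "sub_coxeter_matrix I m x y = mB x y"
proof -
  have xy: "x \<otimes>\<^bsub>G\<^esub> y = cl (wd x @ wd y)" using mult_cl[of "wd x" "wd y"] cl_wd assms by simp
  have pw: "(x \<otimes>\<^bsub>G\<^esub> y) [^]\<^bsub>G\<^esub> n = cl (wrd (concat (replicate n [x, y])))" for n :: nat
  proof -
    have "wrd (concat (replicate n [x, y])) = concat (replicate n (wd x @ wd y))" by (induction n) auto
    then show ?thesis using pow_cl[of "wd x @ wd y" n] by (simp add: xy)
  qed
  have one: "(x \<otimes>\<^bsub>G\<^esub> y) [^]\<^bsub>G\<^esub> n = \<one>\<^bsub>G\<^esub> \<longleftrightarrow> cox_eq X mB (concat (replicate n [x, y])) []" for n :: nat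
  proof
    have sub: "set (concat (replicate n [x, y])) \<subseteq> X" using assms by auto
    show "cox_eq X mB (concat (replicate n [x, y])) []" if "(x \<otimes>\<^bsub>G\<^esub> y) [^]\<^bsub>G\<^esub> n = \<one>\<^bsub>G\<^esub>"
      using wrd_inj[OF sub, of "[]"] that by (simp add: pw one_cl)
    show "(x \<otimes>\<^bsub>G\<^esub> y) [^]\<^bsub>G\<^esub> n = \<one>\<^bsub>G\<^esub>" if "cox_eq X mB (concat (replicate n [x, y])) []"
      using cl_eqI[OF wrd_cong[OF that]] by (simp add: pw one_cl)
  qed
  have nontriv: "\<not> cox_eq X mB u []" if "good_word mB u" "r \<in> desc mB u" "set u \<subseteq> X" for u r
  proof
    assume "cox_eq X mB u []"
    then have "act B u (\<lambda>_. -1) r = -1" using XR.act_cox_eq[OF compat_B] by simp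
    moreover have "act B u (\<lambda>_. -1) r > 0"
      using XR.act_sign[OF compat_B, of "\<lambda>_. -1" u] that desc_subset[of mB u] by auto
    ultimately show False by simp
  qed
  show ?thesis
  proof (cases "x = y")
    case True
    have "cox_eq X mB [x, x] []" using XR.cancel2[OF assms(1), of "[]"] .
    then have ex: "0 < (1::nat) \<and> (x \<otimes>\<^bsub>G\<^esub> y) [^]\<^bsub>G\<^esub> (1::nat) = \<one>\<^bsub>G\<^esub>" using one[of 1] True by simp
    then have "(LEAST k. k > 0 \<and> (x \<otimes>\<^bsub>G\<^esub> y) [^]\<^bsub>G\<^esub> (k::nat) = \<one>\<^bsub>G\<^esub>) = 1"
      by (intro Least_equality) auto
    then show ?thesis using ex True
      unfolding sub_coxeter_matrix_def elt_order_def mB_def by (auto simp: one_enat_def)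
  next
    case ne: False
    show ?thesis
    proof (cases "B x y = 0")
      case True
      then have m2: "mB x y = 2" "mB y x = 2" using ne B_sym[of x y] by (auto simp: mB_def)
      have "cox_eq X mB (concat (replicate 2 [x, y])) []"
        using assms m2 by (intro cox_eq.rel) (auto simp: numeral_eq_enat)
      then have ex: "0 < (2::nat) \<and> (x \<otimes>\<^bsub>G\<^esub> y) [^]\<^bsub>G\<^esub> (2::nat) = \<one>\<^bsub>G\<^esub>" using one by simp
      have "\<not> cox_eq X mB [x, y] []" using nontriv[of "[x, y]" x] ne assms by auto
      then have not1: "(x \<otimes>\<^bsub>G\<^esub> y) [^]\<^bsub>G\<^esub> (1::nat) \<noteq> \<one>\<^bsub>G\<^esub>" using one[of 1] by simp
      have "(LEAST k. k > 0 \<and> (x \<otimes>\<^bsub>G\<^esub> y) [^]\<^bsub>G\<^esub> (k::nat) = \<one>\<^bsub>G\<^esub>) = 2"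
      proof (rule Least_equality)
        show "0 < (2::nat) \<and> (x \<otimes>\<^bsub>G\<^esub> y) [^]\<^bsub>G\<^esub> (2::nat) = \<one>\<^bsub>G\<^esub>" by (rule ex)
        fix j :: nat assume "0 < j \<and> (x \<otimes>\<^bsub>G\<^esub> y) [^]\<^bsub>G\<^esub> j = \<one>\<^bsub>G\<^esub>"
        then show "2 \<le> j" using not1 by (cases "j = 1") auto
      qed
      moreover have "\<exists>k>0. (x \<otimes>\<^bsub>G\<^esub> y) [^]\<^bsub>G\<^esub> (k::nat) = \<one>\<^bsub>G\<^esub>" using ex by blast
      ultimately show ?thesis using m2 unfolding sub_coxeter_matrix_def elt_order_def
        by (simp add: numeral_eq_enat)
    next
      case False
      then have minf: "mB x y = \<infinity>" "mB y x = \<infinity>" using ne B_sym[of x y] by (auto simp: mB_def)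
      have gd: "good_word mB (concat (replicate n [x, y])) \<and>
          desc mB (concat (replicate n [x, y])) = (if n = 0 then {} else {x})" for n
        by (induction n) (use ne minf in auto)
      have "\<not> (\<exists>k>0. (x \<otimes>\<^bsub>G\<^esub> y) [^]\<^bsub>G\<^esub> (k::nat) = \<one>\<^bsub>G\<^esub>)"
      proof
        assume "\<exists>k>0. (x \<otimes>\<^bsub>G\<^esub> y) [^]\<^bsub>G\<^esub> (k::nat) = \<one>\<^bsub>G\<^esub>"
        then obtain n where "n > 0" "cox_eq X mB (concat (replicate n [x, y])) []" using one by blast
        then show False using nontriv[of "concat (replicate n [x, y])" x] gd[of n] assms by auto
      qed
      then show ?thesis using minf by (simp add: sub_coxeter_matrix_def elt_order_def)
    qed
  qed
qed

lemma finite_X: "finite X"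
proof -
  have "X \<subseteq> (\<lambda>(i, s). cl (rw i s)) ` ({..<k} \<times> I)" by (auto simp: X_def ext_def)
  then show ?thesis using fin by (auto intro: finite_subset)
qed

end

section \<open>The Lie algebra of a set of matrices\<close>

text \<open>The matrix \<open>A (1 + t Y)\<close>.\<close>

definition shift_mat :: "nat \<Rightarrow> (nat \<Rightarrow> nat \<Rightarrow> real) \<Rightarrow> real mat \<Rightarrow> real \<Rightarrow> real mat" where
  "shift_mat n Y A t = mat n n (\<lambda>(i, j). A $$ (i, j) + t * (\<Sum>k<n. A $$ (i, k) * Y k j))"

text \<open>The left-invariant vector field of \<open>Y\<close>, applied to \<open>p\<close>. The
  set \<open>poly_fun\<close> consists of functions without a fixed polynomial expression, so the
  derivation is defined analytically; \<open>poly_fun_grad\<close> provides the derivative.\<close>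

definition right_der :: "nat \<Rightarrow> (nat \<Rightarrow> nat \<Rightarrow> real) \<Rightarrow> (real mat \<Rightarrow> real) \<Rightarrow> real mat \<Rightarrow> real" where
  "right_der n Y p A = (THE D. ((\<lambda>t. p (shift_mat n Y A t)) has_real_derivative D) (at 0))"

definition fmul :: "nat \<Rightarrow> (nat \<Rightarrow> nat \<Rightarrow> real) \<Rightarrow> (nat \<Rightarrow> nat \<Rightarrow> real) \<Rightarrow> nat \<Rightarrow> nat \<Rightarrow> real" where
  "fmul n Y Z = (\<lambda>i j. \<Sum>k<n. Y i k * Z k j)"

lemma right_derI:
  "((\<lambda>t. p (shift_mat n Y A t)) has_real_derivative D) (at 0) \<Longrightarrow> right_der n Y p A = D"
  unfolding right_der_def by (rule the_equality) (auto intro: DERIV_unique)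

lemma poly_fun_cong:
  "p \<in> poly_fun n \<Longrightarrow> (\<And>i j. i < n \<Longrightarrow> j < n \<Longrightarrow> A $$ (i, j) = B $$ (i, j)) \<Longrightarrow> p A = p B"
  by (induction rule: poly_fun.induct) auto

lemma poly_fun_sum: "finite T \<Longrightarrow> (\<And>x. x \<in> T \<Longrightarrow> f x \<in> poly_fun n) \<Longrightarrow> (\<lambda>A. \<Sum>x\<in>T. f x A) \<in> poly_fun n"
  by (induction rule: finite_induct) (auto intro: poly_fun.intros)

text \<open>A gradient with polynomial entries. The chain rule is built in for arbitrary
  differentiable curves, so that one gradient serves both the lines \<open>shift_mat\<close> and the
  hyperbolas of \<open>lie_curve\<close>.\<close>

definition is_grad :: "nat \<Rightarrow> (real mat \<Rightarrow> real) \<Rightarrow> (nat \<Rightarrow> nat \<Rightarrow> real mat \<Rightarrow> real) \<Rightarrow> bool" where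
  "is_grad n p g \<longleftrightarrow> (\<forall>i<n. \<forall>j<n. g i j \<in> poly_fun n) \<and>
    (\<forall>C C' t. (\<forall>i<n. \<forall>j<n. ((\<lambda>t. C t $$ (i, j)) has_real_derivative C' i j) (at t)) \<longrightarrow>
      ((\<lambda>t. p (C t)) has_real_derivative (\<Sum>i<n. \<Sum>j<n. g i j (C t) * C' i j)) (at t))"

lemma is_gradD:
  "is_grad n p g \<Longrightarrow> \<forall>i<n. \<forall>j<n. ((\<lambda>t. C t $$ (i, j)) has_real_derivative C' i j) (at t) \<Longrightarrow>
    ((\<lambda>t. p (C t)) has_real_derivative (\<Sum>i<n. \<Sum>j<n. g i j (C t) * C' i j)) (at t)"
  by (simp add: is_grad_def)

lemma poly_fun_grad: "p \<in> poly_fun n \<Longrightarrow> \<exists>g. is_grad n p g"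
proof (induction rule: poly_fun.induct)
  case (const c)
  show ?case by (rule exI[of _ "\<lambda>_ _ _. 0"]) (auto simp: is_grad_def intro: poly_fun.const)
next
  case (entry i j)
  have "is_grad n (\<lambda>A. A $$ (i, j)) (\<lambda>k l A. if k = i \<and> l = j then 1 else 0)"
    unfolding is_grad_def
  proof (intro conjI allI impI)
    fix C :: "real \<Rightarrow> real mat" and C' :: "nat \<Rightarrow> nat \<Rightarrow> real" and t :: real
    assume C: "\<forall>i<n. \<forall>j<n. ((\<lambda>t. C t $$ (i, j)) has_real_derivative C' i j) (at t)"
    have "(\<Sum>k<n. \<Sum>l<n. (if k = i \<and> l = j then 1 else 0) * C' k l) =
        (\<Sum>k<n. \<Sum>l<n. if l = j then if k = i then C' i j else 0 else 0)"
      by (intro sum.cong refl) auto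
    then show "((\<lambda>t. C t $$ (i, j)) has_real_derivative
        (\<Sum>k<n. \<Sum>l<n. (if k = i \<and> l = j then 1 else 0) * C' k l)) (at t)"
      using C entry by simp
  qed (auto intro: poly_fun.const)
  then show ?case by blast
next
  case (add p q)
  then obtain g h where g: "is_grad n p g" and h: "is_grad n q h" by blast
  have "is_grad n (\<lambda>A. p A + q A) (\<lambda>i j A. g i j A + h i j A)"
    unfolding is_grad_def
  proof (intro conjI allI impI)
    fix C :: "real \<Rightarrow> real mat" and C' :: "nat \<Rightarrow> nat \<Rightarrow> real" and t :: real
    assume "\<forall>i<n. \<forall>j<n. ((\<lambda>t. C t $$ (i, j)) has_real_derivative C' i j) (at t)"
    then have "((\<lambda>t. p (C t) + q (C t)) has_real_derivative
       (\<Sum>i<n. \<Sum>j<n. g i j (C t) * C' i j) + (\<Sum>i<n. \<Sum>j<n. h i j (C t) * C' i j)) (at t)"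
      using g h by (auto simp: is_grad_def intro!: derivative_intros)
    then show "((\<lambda>t. p (C t) + q (C t)) has_real_derivative
       (\<Sum>i<n. \<Sum>j<n. (g i j (C t) + h i j (C t)) * C' i j)) (at t)"
      by (simp add: sum.distrib algebra_simps)
  qed (use g h in \<open>auto simp: is_grad_def intro!: poly_fun.add\<close>)
  then show ?case by blast
next
  case (mult p q)
  then obtain g h where g: "is_grad n p g" and h: "is_grad n q h" by blast
  have "is_grad n (\<lambda>A. p A * q A) (\<lambda>i j A. g i j A * q A + p A * h i j A)"
    unfolding is_grad_def
  proof (intro conjI allI impI)
    fix C :: "real \<Rightarrow> real mat" and C' :: "nat \<Rightarrow> nat \<Rightarrow> real" and t :: real
    assume C: "\<forall>i<n. \<forall>j<n. ((\<lambda>t. C t $$ (i, j)) has_real_derivative C' i j) (at t)"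
    have 1: "((\<lambda>t. p (C t)) has_real_derivative (\<Sum>i<n. \<Sum>j<n. g i j (C t) * C' i j)) (at t)"
      and 2: "((\<lambda>t. q (C t)) has_real_derivative (\<Sum>i<n. \<Sum>j<n. h i j (C t) * C' i j)) (at t)"
      using g h C by (auto simp: is_grad_def)
    have "(\<Sum>i<n. \<Sum>j<n. g i j (C t) * C' i j) * q (C t) + (\<Sum>i<n. \<Sum>j<n. h i j (C t) * C' i j) * p (C t) =
       (\<Sum>i<n. \<Sum>j<n. (g i j (C t) * q (C t) + p (C t) * h i j (C t)) * C' i j)"
      by (simp add: sum_distrib_left sum_distrib_right sum.distrib algebra_simps)
    with DERIV_mult'[OF 1 2] show "((\<lambda>t. p (C t) * q (C t)) has_real_derivative
       (\<Sum>i<n. \<Sum>j<n. (g i j (C t) * q (C t) + p (C t) * h i j (C t)) * C' i j)) (at t)"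
      by (simp add: algebra_simps)
  qed (use g h mult.hyps in \<open>auto simp: is_grad_def intro!: poly_fun.add poly_fun.mult\<close>)
  then show ?case by blast
qed

lemma grad_cong:
  assumes "is_grad n p g" "\<And>i j. i < n \<Longrightarrow> j < n \<Longrightarrow> A $$ (i, j) = B $$ (i, j)"
  shows "(\<Sum>i<n. \<Sum>j<n. g i j A * D i j) = (\<Sum>i<n. \<Sum>j<n. g i j B * D i j)"
proof -
  have "g i j A = g i j B" if "i < n" "j < n" for i j
    using that assms by (intro poly_fun_cong[of "g i j" n]) (auto simp: is_grad_def)
  then show ?thesis by simp
qed

lemma shift_mat_deriv:
  assumes "is_grad n p g"
  shows "((\<lambda>t. p (shift_mat n Y A t)) has_real_derivative
    (\<Sum>i<n. \<Sum>j<n. g i j (shift_mat n Y A t) * (\<Sum>k<n. A $$ (i, k) * Y k j))) (at t)"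
proof -
  have "\<forall>i<n. \<forall>j<n. ((\<lambda>t. shift_mat n Y A t $$ (i, j)) has_real_derivative
      (\<Sum>k<n. A $$ (i, k) * Y k j)) (at t)"
    by (auto simp: shift_mat_def intro!: derivative_eq_intros)
  then show ?thesis by (rule is_gradD[OF assms])
qed

lemma right_der_grad:
  assumes "is_grad n p g"
  shows "right_der n Y p A = (\<Sum>i<n. \<Sum>j<n. g i j A * (\<Sum>k<n. A $$ (i, k) * Y k j))"
proof -
  have "right_der n Y p A = (\<Sum>i<n. \<Sum>j<n. g i j (shift_mat n Y A 0) * (\<Sum>k<n. A $$ (i, k) * Y k j))"
    by (rule right_derI[OF shift_mat_deriv[OF assms]])
  also have "\<dots> = (\<Sum>i<n. \<Sum>j<n. g i j A * (\<Sum>k<n. A $$ (i, k) * Y k j))"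
    by (rule grad_cong[OF assms]) (simp add: shift_mat_def)
  finally show ?thesis .
qed

lemma has_right_der:
  assumes "p \<in> poly_fun n"
  shows "((\<lambda>t. p (shift_mat n Y A t)) has_real_derivative right_der n Y p A) (at 0)"
proof -
  obtain g where "is_grad n p g" using poly_fun_grad[OF assms] by blast
  from shift_mat_deriv[OF this, of Y A 0] show ?thesis
    using right_derI[OF shift_mat_deriv[OF \<open>is_grad n p g\<close>, of Y A 0]] by simp
qed

lemma right_der_poly_fun: "p \<in> poly_fun n \<Longrightarrow> right_der n Y p \<in> poly_fun n"
proof -
  assume p: "p \<in> poly_fun n"
  obtain g where g: "is_grad n p g" using poly_fun_grad[OF p] by blast
  have "right_der n Y p = (\<lambda>A. \<Sum>i<n. \<Sum>j<n. g i j A * (\<Sum>k<n. A $$ (i, k) * Y k j))"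
    using right_der_grad[OF g] by blast
  then show ?thesis using g
    by (auto simp: is_grad_def intro!: poly_fun_sum poly_fun.mult poly_fun.entry poly_fun.const)
qed

lemma right_der_linear:
  assumes "p \<in> poly_fun n"
  shows "right_der n (\<lambda>i j. a * Y i j + b * Z i j) p A = a * right_der n Y p A + b * right_der n Z p A"
proof -
  obtain g where g: "is_grad n p g" using poly_fun_grad[OF assms] by blast
  show ?thesis unfolding right_der_grad[OF g]
    by (simp add: sum_distrib_left sum.distrib algebra_simps)
qed

lemma right_der_cong:
  assumes "p \<in> poly_fun n" "\<And>i j. i < n \<Longrightarrow> j < n \<Longrightarrow> Y i j = Z i j"
  shows "right_der n Y p A = right_der n Z p A"
proof -
  obtain g where g: "is_grad n p g" using poly_fun_grad[OF assms(1)] by blast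
  show ?thesis unfolding right_der_grad[OF g] using assms(2) by simp
qed

lemma right_der_const: "right_der n Y (\<lambda>A. c) = (\<lambda>A. 0)"
  by (intro ext right_derI) simp

lemma right_der_entry:
  "i < n \<Longrightarrow> j < n \<Longrightarrow> right_der n Y (\<lambda>A. A $$ (i, j)) = (\<lambda>A. \<Sum>k<n. A $$ (i, k) * Y k j)"
  by (intro ext right_derI) (auto simp: shift_mat_def intro!: derivative_eq_intros)

lemma right_der_add:
  assumes "p \<in> poly_fun n" "q \<in> poly_fun n"
  shows "right_der n Y (\<lambda>A. p A + q A) = (\<lambda>A. right_der n Y p A + right_der n Y q A)"
  by (intro ext right_derI DERIV_add has_right_der assms)

lemma right_der_mult:
  assumes "p \<in> poly_fun n" "q \<in> poly_fun n"
  shows "right_der n Y (\<lambda>A. p A * q A) = (\<lambda>A. right_der n Y p A * q A + p A * right_der n Y q A)"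
proof
  fix A
  have "p (shift_mat n Y A 0) = p A" "q (shift_mat n Y A 0) = q A"
    by (rule poly_fun_cong[OF assms(1)] poly_fun_cong[OF assms(2)]; simp add: shift_mat_def)+
  then show "right_der n Y (\<lambda>A. p A * q A) A = right_der n Y p A * q A + p A * right_der n Y q A"
    using DERIV_mult'[OF has_right_der[OF assms(1), of Y A] has_right_der[OF assms(2), of Y A]]
    by (intro right_derI) (simp add: algebra_simps)
qed

lemma right_der_cmult:
  assumes "p \<in> poly_fun n"
  shows "right_der n Y (\<lambda>A. p A * c) = (\<lambda>A. right_der n Y p A * c)"
  using right_der_mult[OF assms poly_fun.const[of c]] by (simp add: right_der_const)

lemma right_der_sum:
  assumes "finite T" "\<And>x. x \<in> T \<Longrightarrow> f x \<in> poly_fun n"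
  shows "right_der n Y (\<lambda>A. \<Sum>x\<in>T. f x A) = (\<lambda>A. \<Sum>x\<in>T. right_der n Y (f x) A)"
  using assms
  by (induction rule: finite_induct) (simp_all add: right_der_const right_der_add poly_fun_sum)

lemma right_der_right_der_entry:
  assumes "i < n" "j < n"
  shows "right_der n Y (right_der n Z (\<lambda>A. A $$ (i, j))) A = (\<Sum>l<n. A $$ (i, l) * fmul n Y Z l j)"
proof -
  have "right_der n Y (\<lambda>A. \<Sum>k<n. A $$ (i, k) * Z k j) =
      (\<lambda>A. \<Sum>k<n. right_der n Y (\<lambda>A. A $$ (i, k) * Z k j) A)"
    by (rule right_der_sum) (use assms in \<open>auto intro!: poly_fun.mult poly_fun.entry poly_fun.const\<close>)
  then have "right_der n Y (right_der n Z (\<lambda>A. A $$ (i, j))) A =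
      (\<Sum>k<n. right_der n Y (\<lambda>A. A $$ (i, k) * Z k j) A)"
    using assms by (simp add: right_der_entry)
  also have "\<dots> = (\<Sum>k<n. (\<Sum>l<n. A $$ (i, l) * Y l k) * Z k j)"
    using assms by (simp add: right_der_cmult right_der_entry poly_fun.entry)
  also have "\<dots> = (\<Sum>l<n. A $$ (i, l) * fmul n Y Z l j)"
    unfolding fmul_def sum_distrib_left sum_distrib_right
    by (subst sum.swap) (simp add: algebra_simps)
  finally show ?thesis .
qed

text \<open>Both sides are derivations in \<open>p\<close>, so it is enough that they agree on the
  matrix entries.\<close>

lemma right_der_bracket:
  assumes "p \<in> poly_fun n"
  shows "right_der n (\<lambda>i j. fmul n Y Z i j - fmul n Z Y i j) p A =
    right_der n Y (right_der n Z p) A - right_der n Z (right_der n Y p) A"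
  using assms
proof (induction arbitrary: A rule: poly_fun.induct)
  case (entry i j)
  then show ?case
    using right_der_right_der_entry[OF entry, of Y Z A] right_der_right_der_entry[OF entry, of Z Y A]
    by (simp add: right_der_entry sum_subtractf right_diff_distrib)
next
  case (mult p q)
  let ?W = "\<lambda>i j. fmul n Y Z i j - fmul n Z Y i j"
  have "right_der n Y (right_der n Z r) A = right_der n ?W r A + right_der n Z (right_der n Y r) A"
    if "r = p \<or> r = q" for r using that mult.IH[of A] by auto
  then show ?case using mult.hyps
    by (simp add: right_der_mult right_der_add right_der_poly_fun poly_fun.mult algebra_simps)
qed (simp_all add: right_der_const right_der_add right_der_poly_fun)

definition lie :: "nat \<Rightarrow> real mat set \<Rightarrow> (nat \<Rightarrow> nat \<Rightarrow> real) \<Rightarrow> bool" where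
  "lie n H Y \<longleftrightarrow> (\<forall>p\<in>poly_fun n. (\<forall>A\<in>H. p A = 0) \<longrightarrow> (\<forall>A\<in>H. right_der n Y p A = 0))"

definition zclosure :: "nat \<Rightarrow> real mat set \<Rightarrow> real mat set" where
  "zclosure n H = {A \<in> carrier_mat n n. \<forall>p\<in>poly_fun n. (\<forall>B\<in>H. p B = 0) \<longrightarrow> p A = 0}"

lemma lie_lin: "lie n H Y \<Longrightarrow> lie n H Z \<Longrightarrow> lie n H (\<lambda>i j. a * Y i j + b * Z i j)"
  by (simp add: lie_def right_der_linear)

lemma lie_cong:
  "lie n H Y \<Longrightarrow> (\<And>i j. i < n \<Longrightarrow> j < n \<Longrightarrow> Y i j = Z i j) \<Longrightarrow> lie n H Z"
  unfolding lie_def using right_der_cong[of _ n Y Z] by fastforce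

lemma lie_bracket: "lie n H Y \<Longrightarrow> lie n H Z \<Longrightarrow> lie n H (\<lambda>i j. fmul n Y Z i j - fmul n Z Y i j)"
  by (simp add: lie_def right_der_bracket right_der_poly_fun)

lemma lie_zero: "lie n H (\<lambda>i j. 0)"
  unfolding lie_def
proof (intro ballI impI)
  fix p A assume "p \<in> poly_fun n"
  then show "right_der n (\<lambda>i j. 0) p A = 0"
    using right_der_linear[of p n 0 "\<lambda>_ _. 0" 0 "\<lambda>_ _. 0" A] by simp
qed

lemma lie_scale: "lie n H Y \<Longrightarrow> lie n H (\<lambda>i j. a * Y i j)"
  using lie_lin[OF _ lie_zero, of n H Y a 0] by simp

lemma lie_sum:
  "finite T \<Longrightarrow> (\<And>x. x \<in> T \<Longrightarrow> lie n H (f x)) \<Longrightarrow> lie n H (\<lambda>i j. \<Sum>x\<in>T. f x i j)"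
proof (induction rule: finite_induct)
  case (insert x T)
  then show ?case using lie_lin[of n H "f x" "\<lambda>i j. \<Sum>x\<in>T. f x i j" 1 1] by simp
qed (simp add: lie_zero)

lemma poly_fun_shift_poly: "p \<in> poly_fun n \<Longrightarrow> \<exists>q. \<forall>t. p (shift_mat n Y A t) = poly q t"
proof (induction rule: poly_fun.induct)
  case (const c)
  show ?case by (rule exI[of _ "[:c:]"]) simp
next
  case (entry i j)
  then show ?case
    by (intro exI[of _ "[:A $$ (i, j), \<Sum>k<n. A $$ (i, k) * Y k j:]"]) (simp add: shift_mat_def)
next
  case (add p q)
  then show ?case by (metis poly_add)
next
  case (mult p q)
  then show ?case by (metis poly_mult)
qed

text \<open>Along \<open>t \<mapsto> A (1 + t Y)\<close> with \<open>Y\<^sup>2 = 0\<close>, a polynomial \<open>p\<close> has the \<open>k\<close>-th derivative \<open>(L\<^sub>Y\<^sup>k p)(A)\<close>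
  at \<open>0\<close>, and these all vanish when \<open>L\<^sub>Y\<close> preserves the vanishing ideal.\<close>
lemma zclosure_shift:
  assumes Y: "lie n H Y" and sq: "\<And>i j. i < n \<Longrightarrow> j < n \<Longrightarrow> fmul n Y Y i j = 0"
    and A: "A \<in> zclosure n H"
  shows "shift_mat n Y A t \<in> zclosure n H"
proof -
  have "p (shift_mat n Y A t) = 0" if p: "p \<in> poly_fun n" "\<forall>B\<in>H. p B = 0" for p
  proof -
    define L where "L k = (right_der n Y ^^ k) p" for k
    have L: "L k \<in> poly_fun n \<and> (\<forall>B\<in>H. L k B = 0)" for k
      by (induction k) (use p Y in \<open>auto simp: L_def lie_def right_der_poly_fun\<close>)
    have der: "((\<lambda>t. L k (shift_mat n Y A t)) has_real_derivative L (Suc k) (shift_mat n Y A t)) (at t)"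
      for k t
    proof -
      obtain g where g: "is_grad n (L k) g" using poly_fun_grad L by blast
      have "(\<Sum>l<n. shift_mat n Y A t $$ (i, l) * Y l j) = (\<Sum>l<n. A $$ (i, l) * Y l j)"
        if "i < n" "j < n" for i j
      proof -
        have "(\<Sum>l<n. shift_mat n Y A t $$ (i, l) * Y l j) =
          (\<Sum>l<n. A $$ (i, l) * Y l j) + t * (\<Sum>l<n. (\<Sum>k<n. A $$ (i, k) * Y k l) * Y l j)"
          using that by (simp add: shift_mat_def sum.distrib sum_distrib_left algebra_simps)
        also have "(\<Sum>l<n. (\<Sum>k<n. A $$ (i, k) * Y k l) * Y l j) = (\<Sum>k<n. A $$ (i, k) * fmul n Y Y k j)"
          unfolding fmul_def sum_distrib_left sum_distrib_right
          by (subst sum.swap) (simp add: algebra_simps)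
        also have "\<dots> = 0" using that sq by simp
        finally show ?thesis by simp
      qed
      then have "L (Suc k) (shift_mat n Y A t) =
          (\<Sum>i<n. \<Sum>j<n. g i j (shift_mat n Y A t) * (\<Sum>l<n. A $$ (i, l) * Y l j))"
        by (simp add: L_def right_der_grad[OF g[unfolded L_def]])
      then show ?thesis using shift_mat_deriv[OF g, of Y A t] by simp
    qed
    obtain q where q: "\<And>t. p (shift_mat n Y A t) = poly q t"
      using poly_fun_shift_poly[OF p(1)] by blast
    have Lq: "L k (shift_mat n Y A t) = poly ((pderiv ^^ k) q) t" for k t
    proof (induction k arbitrary: t)
      case (Suc k)
      then have "((\<lambda>t. poly ((pderiv ^^ k) q) t) has_real_derivative L (Suc k) (shift_mat n Y A t)) (at t)"
        using der[of k t] by simp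
      then show ?case using DERIV_unique[OF _ poly_DERIV] by fastforce
    qed (simp add: q L_def)
    have "coeff q k = 0" for k
    proof -
      have "L k A = 0" using A L by (auto simp: zclosure_def)
      moreover have "L k A = L k (shift_mat n Y A 0)"
        by (rule poly_fun_cong[OF L[THEN conjunct1]]) (simp add: shift_mat_def)
      ultimately have "coeff ((pderiv ^^ k) q) 0 = 0" using Lq by (simp add: poly_0_coeff_0)
      then show ?thesis by (simp add: coeff_higher_pderiv flip: pochhammer_fact)
    qed
    then have "q = 0" by (simp add: poly_eq_iff)
    then show ?thesis by (simp add: q)
  qed
  then show ?thesis by (simp add: zclosure_def shift_mat_def)
qed

section \<open>Tangents of curves given by Laurent polynomials\<close>

lemma poly_fun_laurent:
  assumes "p \<in> poly_fun n"
  shows "\<exists>q d. \<forall>\<mu>. \<mu> \<noteq> 0 \<longrightarrow>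
    \<mu> ^ d * p (mat n n (\<lambda>(i, j). a i j + b i j * \<mu> + c i j * inverse \<mu>)) = poly q \<mu>"
  using assms
proof (induction rule: poly_fun.induct)
  case (const c)
  show ?case by (rule exI[of _ "[:c:]"], rule exI[of _ 0]) simp
next
  case (entry i j)
  then show ?case
    by (intro exI[of _ "[:c i j, a i j, b i j:]"] exI[of _ 1])
      (auto simp: field_simps power2_eq_square)
next
  case (add p q)
  let ?M = "\<lambda>\<mu>. mat n n (\<lambda>(i, j). a i j + b i j * \<mu> + c i j * inverse \<mu>)"
  obtain P d where P: "\<And>\<mu>. \<mu> \<noteq> 0 \<Longrightarrow> \<mu> ^ d * p (?M \<mu>) = poly P \<mu>" using add.IH by blast
  obtain Q e where Q: "\<And>\<mu>. \<mu> \<noteq> 0 \<Longrightarrow> \<mu> ^ e * q (?M \<mu>) = poly Q \<mu>" using add.IH by blast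
  have "\<mu> ^ (d + e) * (p (?M \<mu>) + q (?M \<mu>)) = poly (monom 1 e * P + monom 1 d * Q) \<mu>"
    if "\<mu> \<noteq> 0" for \<mu>
    by (simp add: poly_monom power_add algebra_simps flip: P[OF that] Q[OF that])
  then show ?case by blast
next
  case (mult p q)
  let ?M = "\<lambda>\<mu>. mat n n (\<lambda>(i, j). a i j + b i j * \<mu> + c i j * inverse \<mu>)"
  obtain P d where P: "\<And>\<mu>. \<mu> \<noteq> 0 \<Longrightarrow> \<mu> ^ d * p (?M \<mu>) = poly P \<mu>" using mult.IH by blast
  obtain Q e where Q: "\<And>\<mu>. \<mu> \<noteq> 0 \<Longrightarrow> \<mu> ^ e * q (?M \<mu>) = poly Q \<mu>" using mult.IH by blast
  have "\<mu> ^ (d + e) * (p (?M \<mu>) * q (?M \<mu>)) = poly (P * Q) \<mu>" if "\<mu> \<noteq> 0" for \<mu>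
    by (simp add: power_add algebra_simps flip: P[OF that] Q[OF that])
  then show ?case by blast
qed

text \<open>After clearing denominators, one polynomial in \<mu> vanishes at the infinitely many
  powers of \<open>l\<close>.\<close>

lemma poly_fun_laurent_zero:
  assumes p: "p \<in> poly_fun n" and "l > 1" "\<mu> \<noteq> 0"
    and zero: "\<And>k::nat. p (mat n n (\<lambda>(i, j). a i j + b i j * l ^ k + c i j * inverse (l ^ k))) = 0"
  shows "p (mat n n (\<lambda>(i, j). a i j + b i j * \<mu> + c i j * inverse \<mu>)) = (0::real)"
proof -
  obtain q d where q: "\<And>\<mu>. \<mu> \<noteq> 0 \<Longrightarrow>
    \<mu> ^ d * p (mat n n (\<lambda>(i, j). a i j + b i j * \<mu> + c i j * inverse \<mu>)) = poly q \<mu>"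
    using poly_fun_laurent[OF p, of a b c] by blast
  have "poly q (l ^ k) = 0" for k using q[of "l ^ k"] zero[of k] assms(2) by simp
  then have "range (\<lambda>k. l ^ k) \<subseteq> {x. poly q x = 0}" by auto
  moreover have "inj (\<lambda>k::nat. l ^ k)" using assms(2) by (simp add: inj_on_def)
  ultimately have "infinite {x. poly q x = 0}"
    using range_inj_infinite infinite_super by metis
  then have "q = 0" using poly_roots_finite by blast
  then show ?thesis using q[OF assms(3)] assms(3) by simp
qed

text \<open>The discrete points with parameter \<open>l ^ k\<close> force every polynomial of the
  vanishing ideal to vanish on the whole hyperbola. Its velocity at \<mu> = 1 is
  \<open>2 c A Y\<close>: the function \<mu> + 1/\<mu> - 2 has a double zero there, so
  \<open>Z\<close> drops out.\<close>

lemma lie_curve: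
  assumes l: "l > 1" and c: "c \<noteq> 0"
    and H: "\<And>A k. A \<in> H \<Longrightarrow> mat n n (\<lambda>(i, j). \<Sum>m<n. A $$ (i, m) *
      ((if m = j then 1 else 0) + c * (l ^ k - inverse (l ^ k)) * Y m j
        + e * (l ^ k + inverse (l ^ k) - 2) * Z m j)) \<in> H"
  shows "lie n H Y"
  unfolding lie_def
proof (intro ballI impI)
  fix p A assume p: "p \<in> poly_fun n" "\<forall>A\<in>H. p A = 0" and A: "A \<in> H"
  define y where "y i j = (\<Sum>m<n. A $$ (i, m) * Y m j)" for i j
  define z where "z i j = (\<Sum>m<n. A $$ (i, m) * Z m j)" for i j
  define M where "M \<mu> = mat n n (\<lambda>(i, j). (A $$ (i, j) - 2 * e * z i j) +
    (c * y i j + e * z i j) * \<mu> + (e * z i j - c * y i j) * inverse \<mu>)" for \<mu>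
  have entry: "(\<Sum>m<n. A $$ (i, m) * ((if m = j then 1 else 0) + s * Y m j + t * Z m j)) =
     A $$ (i, j) + s * y i j + t * z i j" if "i < n" "j < n" for i j s t
  proof -
    have "(\<Sum>m<n. A $$ (i, m) * ((if m = j then 1 else 0) + s * Y m j + t * Z m j)) =
       (\<Sum>m<n. (if m = j then A $$ (i, m) else 0) + s * (A $$ (i, m) * Y m j) + t * (A $$ (i, m) * Z m j))"
      by (intro sum.cong) (auto simp: algebra_simps)
    then show ?thesis using that by (simp add: sum.distrib y_def z_def sum_distrib_left)
  qed
  have Mk: "M (l ^ k) \<in> H" for k
  proof -
    define s t where "s = c * (l ^ k - inverse (l ^ k))" and "t = e * (l ^ k + inverse (l ^ k) - 2)"
    have "M (l ^ k) = mat n n (\<lambda>(i, j). A $$ (i, j) + s * y i j + t * z i j)"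
      by (intro eq_matI) (auto simp: M_def s_def t_def algebra_simps)
    also have "\<dots> = mat n n (\<lambda>(i, j). \<Sum>m<n. A $$ (i, m) *
        ((if m = j then 1 else 0) + s * Y m j + t * Z m j))"
      by (intro eq_matI) (simp_all only: index_mat split entry dim_row_mat dim_col_mat)
    finally show ?thesis using H[OF A, of k] by (simp only: s_def t_def)
  qed
  have zero: "p (M \<mu>) = 0" if "\<mu> \<noteq> 0" for \<mu>
    unfolding M_def
    by (rule poly_fun_laurent_zero[OF p(1) l that]) (use Mk p in \<open>auto simp: M_def\<close>)
  obtain g where g: "is_grad n p g" using poly_fun_grad[OF p(1)] by blast
  have "\<forall>i<n. \<forall>j<n. ((\<lambda>\<mu>. M \<mu> $$ (i, j)) has_real_derivative 2 * c * y i j) (at 1)"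
    by (auto simp: M_def intro!: derivative_eq_intros)
  then have "((\<lambda>\<mu>. p (M \<mu>)) has_real_derivative
      (\<Sum>i<n. \<Sum>j<n. g i j (M 1) * (2 * c * y i j))) (at 1)"
    by (rule is_gradD[OF g])
  then have "(\<Sum>i<n. \<Sum>j<n. g i j (M 1) * (2 * c * y i j)) = 0"
    by (rule DERIV_local_const[of _ _ _ 1]) (use zero in auto)
  also have "(\<Sum>i<n. \<Sum>j<n. g i j (M 1) * (2 * c * y i j)) =
      (\<Sum>i<n. \<Sum>j<n. g i j A * (2 * c * y i j))"
    by (rule grad_cong[OF g]) (simp add: M_def algebra_simps)
  also have "\<dots> = 2 * c * right_der n Y p A"
    by (simp add: right_der_grad[OF g] y_def sum_distrib_left algebra_simps)
  finally show "right_der n Y p A = 0" using c by simp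
qed

section \<open>Generation of the special linear Lie algebra\<close>

definition eu :: "nat \<Rightarrow> nat \<Rightarrow> nat \<Rightarrow> nat \<Rightarrow> real" where
  "eu a b = (\<lambda>i j. if i = a \<and> j = b then 1 else 0)"

text \<open>This is \<open>K M L - L M K\<close>, the coefficient matrix of a commutator: in a
  product of two rank-one terms, the inner form and vector contract to an entry of
  \<open>M\<close>.\<close>

definition bracket3 :: "(nat \<Rightarrow> nat \<Rightarrow> real) \<Rightarrow> (nat \<Rightarrow> nat \<Rightarrow> real) \<Rightarrow> (nat \<Rightarrow> nat \<Rightarrow> real) \<Rightarrow>
    nat \<Rightarrow> nat \<Rightarrow> real" where
  "bracket3 M K L = (\<lambda>a b. \<Sum>c<3. \<Sum>d<3. K a c * M c d * L d b - L a c * M c d * K d b)"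

text \<open>An abstraction of the set of coefficient matrices \<open>K\<close> for which
  \<open>\<Sum>a b. K a b \<cdot> v\<^sub>a \<otimes> \<alpha>\<^sub>b\<close> lies in the Lie algebra, for three reflections
  with Cartan matrix \<open>M\<close>.\<close>
locale coeff_lie =
  fixes Q :: "(nat \<Rightarrow> nat \<Rightarrow> real) \<Rightarrow> bool" and M :: "nat \<Rightarrow> nat \<Rightarrow> real"
  assumes lin: "Q K \<Longrightarrow> Q L \<Longrightarrow> Q (\<lambda>a b. r * K a b + s * L a b)"
    and br: "Q K \<Longrightarrow> Q L \<Longrightarrow> Q (bracket3 M K L)"
    and cong: "Q K \<Longrightarrow> (\<And>a b. a < 3 \<Longrightarrow> b < 3 \<Longrightarrow> K a b = L a b) \<Longrightarrow> Q L"
    and M2: "M 0 0 = 2" "M 1 1 = 2" "M 2 2 = 2"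
begin

lemma all3: "(\<forall>a<3. P a) \<longleftrightarrow> P 0 \<and> P 1 \<and> P (2::nat)"
  by (auto simp: numeral_3_eq_3 less_Suc_eq numeral_2_eq_2)

lemma cong3: "Q K \<Longrightarrow> (\<forall>a<3. \<forall>b<3. K a b = L a b) \<Longrightarrow> Q L"
  using cong by blast

lemma sum3: "(\<Sum>c<3. f c) = f 0 + f 1 + f (2::nat)" for f :: "nat \<Rightarrow> real"
  by (simp add: numeral_3_eq_3 numeral_2_eq_2)

lemma comb: "Q K \<Longrightarrow> Q L \<Longrightarrow> \<forall>a<3. \<forall>b<3. X a b = r * K a b + s * L a b \<Longrightarrow> Q X"
  by (rule cong3[OF lin[of K L r s]]) auto

lemma comb3: "Q K \<Longrightarrow> Q L \<Longrightarrow> Q T \<Longrightarrow>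
    \<forall>a<3. \<forall>b<3. X a b = r * K a b + s * L a b + t * T a b \<Longrightarrow> Q X"
  by (rule comb[OF lin[of K L r s], of T _ 1 t]) auto

lemma comb_br3: "Q K \<Longrightarrow> Q L \<Longrightarrow> Q T \<Longrightarrow> Q U \<Longrightarrow>
    \<forall>a<3. \<forall>b<3. X a b = r * bracket3 M K L a b + s * T a b + t * U a b \<Longrightarrow> Q X"
  by (rule comb3[OF br[of K L], of T U]) auto

lemma comb_br4: "Q K \<Longrightarrow> Q L \<Longrightarrow> Q T \<Longrightarrow> Q U \<Longrightarrow> Q V \<Longrightarrow>
    \<forall>a<3. \<forall>b<3. X a b = r * bracket3 M K L a b + s * T a b + t * U a b + w * V a b \<Longrightarrow> Q X"
  by (rule comb3[OF lin[OF br[of K L], of T r s], of U V _ 1 t w]) auto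

lemma unscale: "Q (\<lambda>i j. c * K i j) \<Longrightarrow> c \<noteq> 0 \<Longrightarrow> Q K"
  by (rule comb[of "\<lambda>i j. c * K i j" "\<lambda>i j. c * K i j" _ "1 / c" 0]) auto

lemma unscale_add: "Q (\<lambda>i j. c * K i j + r * L i j) \<Longrightarrow> c \<noteq> 0 \<Longrightarrow> Q (\<lambda>i j. K i j + r / c * L i j)"
  by (rule unscale[of c]) (simp_all add: distrib_left)

lemmas ev = all3 bracket3_def sum3 eu_def M2 M2(2)[unfolded One_nat_def] algebra_simps

text \<open>Prolongs an antisymmetric element along a path. If \<open>M 0 2 = M 2 0\<close>, the
  diagonal term vanishes and the path can grow further; on the closing edge of an asymmetric cycle
  it survives and becomes the hypothesis \<open>w\<close> of \<open>base_step\<close>.\<close>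

lemma path_step:
  assumes "M 0 1 = M 1 0" "M 1 2 = M 2 1"
    and a: "Q (\<lambda>i j. eu 0 1 i j - eu 1 0 i j)" and b: "Q (\<lambda>i j. eu 1 2 i j - eu 2 1 i j)"
  shows "Q (\<lambda>i j. 2 * (eu 0 2 i j - eu 2 0 i j) + (M 0 2 - M 2 0) * eu 1 1 i j)"
  by (rule comb_br3[OF a b a b, where r = 1 and s = "M 1 2" and t = "M 0 1"])
    (use assms(1,2) in \<open>simp add: ev\<close>)

text \<open>Here \<open>0\<close> and \<open>1\<close> are the ends of the asymmetric edge, and
  \<open>2\<close> is joined to \<open>1\<close> and pairs symmetrically with both ends.\<close>

lemma base_step:
  assumes sym: "M 0 2 = M 2 0" "M 1 2 = M 2 1" and ne: "M 0 1 \<noteq> M 1 0"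
    and le: "M 0 1 \<le> -3" "M 1 0 \<le> -3" "M 1 2 \<noteq> 0"
    and z02: "Q (\<lambda>i j. eu 0 2 i j - eu 2 0 i j)" and z21: "Q (\<lambda>i j. eu 2 1 i j - eu 1 2 i j)"
    and y: "Q (\<lambda>i j. M 0 1 * eu 0 1 i j - M 1 0 * eu 1 0 i j)"
    and w: "Q (\<lambda>i j. 2 * (eu 0 1 i j - eu 1 0 i j) + (M 0 1 - M 1 0) * eu 2 2 i j)"
  shows "Q (\<lambda>i j. 2 * eu 1 2 i j - M 2 1 * eu 2 2 i j)"
    and "Q (\<lambda>i j. 2 * eu 2 1 i j - M 1 2 * eu 2 2 i j)"
    and "Q (\<lambda>i j. eu 1 1 i j - eu 2 2 i j)"
proof -
  define x x' Y Z where "x = M 0 1" and "x' = M 1 0" and "Y = M 1 2" and "Z = M 0 2"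
  have M: "M 0 1 = x" "M (Suc 0) 0 = x'" "M 0 (Suc 0) = x" "M 1 0 = x'" "M 1 2 = Y" "M 2 1 = Y"
    "M (Suc 0) 2 = Y" "M 2 (Suc 0) = Y" "M 0 2 = Z" "M 2 0 = Z"
    using sym by (simp_all add: x_def x'_def Y_def Z_def)
  note ev = ev M
  have d: "x - x' \<noteq> 0" "2 + 3 * x \<noteq> 0" "2 - 3 * x \<noteq> 0" "2 + 3 * x' \<noteq> 0" "2 - 3 * x' \<noteq> 0" "Y \<noteq> 0"
    using ne le by (auto simp: x_def x'_def Y_def)
  \<comment> \<open>Because of the asymmetry, \<open>y\<close> and \<open>w\<close> are independent
    combinations of \<open>eu 0 1\<close> and \<open>eu 1 0\<close> modulo \<open>eu 2 2\<close>, so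
    each of the two can be isolated.\<close>
  have u: "Q (\<lambda>i j. 2 * eu 1 0 i j - x * eu 2 2 i j)"
    by (rule unscale[OF comb[OF y w, where r = 2 and s = "- x"] d(1)]) (simp add: ev)
  have u': "Q (\<lambda>i j. 2 * eu 0 1 i j - x' * eu 2 2 i j)"
    by (rule unscale[OF comb[OF y w, where r = 2 and s = "- x'"] d(1)]) (simp add: ev)
  have i1: "Q (\<lambda>i j. 2 * (2 * eu 2 0 i j - Z * eu 1 1 i j) + 3 * x * (2 * eu 1 2 i j - Y * eu 2 2 i j))"
    by (rule comb_br3[OF z21 u u z21, where r = 1 and s = Y and t = "- 2 * x"]) (simp add: ev)
  have i4: "Q (\<lambda>i j. 2 * (2 * eu 1 2 i j - Y * eu 0 0 i j) + 3 * x * (2 * eu 2 0 i j - Z * eu 2 2 i j))"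
    by (rule comb_br3[OF u z02 u z02, where r = 1 and s = Z and t = "- 2 * x"]) (simp add: ev)
  have i2: "Q (\<lambda>i j. 2 * (2 * eu 2 1 i j - Y * eu 0 0 i j) + 3 * x' * (2 * eu 0 2 i j - Z * eu 2 2 i j))"
    by (rule comb_br3[OF u' z02 u' z02, where r = 1 and s = Z and t = "2 * x'"]) (simp add: ev)
  have i3: "Q (\<lambda>i j. 2 * (2 * eu 0 2 i j - Z * eu 1 1 i j) + 3 * x' * (2 * eu 2 1 i j - Y * eu 2 2 i j))"
    by (rule comb_br3[OF z21 u' u' z21, where r = 1 and s = Y and t = "2 * x'"]) (simp add: ev)
  \<comment> \<open>\<open>P\<close> and \<open>N\<close> are the diagonal remainders of the sum and
    the difference of \<open>i1\<close> and \<open>i4\<close> after division by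
    \<open>2 + 3 x\<close> and \<open>2 - 3 x\<close>. The brackets \<open>i2\<close> and
    \<open>i3\<close> produce the same remainders with \<open>x'\<close> in place of
    \<open>x\<close>. As \<open>x\<close> and \<open>x'\<close> differ, subtraction leaves a nonzero
    multiple of the remainder plus known antisymmetric elements.\<close>
  define P where "P = (\<lambda>i j. Z * (eu 2 2 i j - eu 1 1 i j) + Y * (eu 2 2 i j - eu 0 0 i j))"
  define N where "N = (\<lambda>i j. Z * (eu 2 2 i j - eu 1 1 i j) - Y * (eu 2 2 i j - eu 0 0 i j))"
  have p1: "Q (\<lambda>i j. 2 * (eu 2 0 i j + eu 1 2 i j) - (Y + Z) * eu 2 2 i j + 2 / (2 + 3 * x) * P i j)"
    by (rule unscale_add[OF comb[OF i1 i4, where r = 1 and s = "1"] d(2)])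
      (simp add: ev P_def)
  have p2: "Q (\<lambda>i j. 2 * (eu 0 2 i j + eu 2 1 i j) - (Y + Z) * eu 2 2 i j + 2 / (2 + 3 * x') * P i j)"
    by (rule unscale_add[OF comb[OF i2 i3, where r = 1 and s = "1"] d(4)])
      (simp add: ev P_def)
  have n1: "Q (\<lambda>i j. 2 * (eu 2 0 i j - eu 1 2 i j) - (Z - Y) * eu 2 2 i j + 2 / (2 - 3 * x) * N i j)"
    by (rule unscale_add[OF comb[OF i1 i4, where r = 1 and s = "- 1"] d(3)])
      (simp add: ev N_def)
  have n2: "Q (\<lambda>i j. 2 * (eu 0 2 i j - eu 2 1 i j) - (Z - Y) * eu 2 2 i j + 2 / (2 - 3 * x') * N i j)"
    by (rule unscale_add[OF comb[OF i3 i2, where r = 1 and s = "- 1"] d(5)])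
      (simp add: ev N_def)
  have P: "Q P"
  proof -
    define e where "e = 2 / (2 + 3 * x) - 2 / (2 + 3 * x')"
    have "e \<noteq> 0" using d by (simp add: e_def divide_simps)
    have 1: "Q (\<lambda>i j. 2 * (eu 2 0 i j + eu 1 2 i j - eu 0 2 i j - eu 2 1 i j) + e * P i j)"
      by (rule comb[OF p1 p2, where r = 1 and s = "-1"]) (simp add: all3 eu_def e_def algebra_simps)
    show ?thesis
      by (rule comb3[OF 1 z02 z21, where r = "1 / e" and s = "2 / e" and t = "2 / e"])
        (use \<open>e \<noteq> 0\<close> in \<open>simp add: all3 eu_def field_simps\<close>)
  qed
  have N: "Q N"
  proof -
    define e where "e = 2 / (2 - 3 * x) - 2 / (2 - 3 * x')"
    have "e \<noteq> 0" using d by (simp add: e_def divide_simps)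
    have 1: "Q (\<lambda>i j. 2 * (eu 2 0 i j - eu 1 2 i j - eu 0 2 i j + eu 2 1 i j) + e * N i j)"
      by (rule comb[OF n1 n2, where r = 1 and s = "-1"]) (simp add: all3 eu_def e_def algebra_simps)
    show ?thesis
      by (rule comb3[OF 1 z02 z21, where r = "1 / e" and s = "2 / e" and t = "- 2 / e"])
        (use \<open>e \<noteq> 0\<close> in \<open>simp add: all3 eu_def field_simps\<close>)
  qed
  have p1': "Q (\<lambda>i j. 2 * (eu 2 0 i j + eu 1 2 i j) - (Y + Z) * eu 2 2 i j)"
    by (rule comb[OF p1 P, where r = 1 and s = "- (2 / (2 + 3 * x))"]) (simp add: all3)
  have n1': "Q (\<lambda>i j. 2 * (eu 2 0 i j - eu 1 2 i j) - (Z - Y) * eu 2 2 i j)"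
    by (rule comb[OF n1 N, where r = 1 and s = "- (2 / (2 - 3 * x))"]) (simp add: all3)
  have a: "Q (\<lambda>i j. 2 * eu 1 2 i j - Y * eu 2 2 i j)"
    by (rule comb[OF p1' n1', where r = "1 / 2" and s = "- 1 / 2"]) (simp add: all3 eu_def field_simps)
  have b: "Q (\<lambda>i j. 2 * eu 2 1 i j - Y * eu 2 2 i j)"
    by (rule comb[OF a z21, where r = 1 and s = 2]) (simp add: all3 eu_def)
  show "Q (\<lambda>i j. 2 * eu 1 2 i j - M 2 1 * eu 2 2 i j)"
    "Q (\<lambda>i j. 2 * eu 2 1 i j - M 1 2 * eu 2 2 i j)" using a b by (simp_all only: M)
  show "Q (\<lambda>i j. eu 1 1 i j - eu 2 2 i j)"
    by (rule comb_br3[OF a b a b, where r = "1 / 8" and s = "Y / 4" and t = "Y / 4"])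
      (simp add: ev field_simps)
qed

text \<open>Two successive brackets with the known pair return the new elements multiplied by
  \<open>8 - 2 x x'\<close>. This is why a product of entries equal to 4 has to be excluded.\<close>

lemma grow_step:
  assumes ne: "M 0 1 * M 1 0 \<noteq> 4" "M 0 2 \<noteq> 0" "M 2 0 \<noteq> 0"
    and a: "Q (\<lambda>i j. 2 * eu 0 1 i j - M 1 0 * eu 0 0 i j)"
    and b: "Q (\<lambda>i j. 2 * eu 1 0 i j - M 0 1 * eu 0 0 i j)"
    and c: "Q (\<lambda>i j. eu 0 0 i j - eu 1 1 i j)"
    and y: "Q (\<lambda>i j. M 0 2 * eu 0 2 i j - M 2 0 * eu 2 0 i j)"
  shows "Q (\<lambda>i j. 2 * eu 0 2 i j - M 2 0 * eu 0 0 i j)"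
    and "Q (\<lambda>i j. 2 * eu 2 0 i j - M 0 2 * eu 0 0 i j)"
    and "Q (\<lambda>i j. eu 0 0 i j - eu 2 2 i j)"
proof -
  define x x' where "x = M 0 1" and "x' = M 1 0"
  define p p' q q' where "p = M 0 2" and "p' = M 2 0" and "q = M 1 2" and "q' = M 2 1"
  have M: "M 0 1 = x" "M (Suc 0) 0 = x'" "M 0 (Suc 0) = x" "M 1 0 = x'" "M 0 2 = p" "M 2 0 = p'"
    "M (Suc 0) 2 = q" "M 2 (Suc 0) = q'" "M 1 2 = q" "M 2 1 = q'"
    by (simp_all add: x_def x'_def p_def p'_def q_def q'_def)
  note ev = ev M and abcy = a[unfolded M] b[unfolded M] c y[unfolded M]
  have d: "4 - x * x' \<noteq> 0" "p \<noteq> 0" "p' \<noteq> 0" using ne by (simp_all add: M)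
  have r: "Q (\<lambda>i j. 2 * (2 * eu 1 2 i j - x * eu 0 2 i j) - (2 * q' - x * p') * eu 0 0 i j)"
    by (rule unscale[OF comb_br3[OF abcy(2) abcy(4) abcy(2) abcy(2), where r = 1 and s = "p * p'" and t = 0] d(2)])
      (simp add: ev)
  have s: "Q (\<lambda>i j. 2 * (2 * eu 2 1 i j - x' * eu 2 0 i j) - (2 * q - x' * p) * eu 0 0 i j)"
    by (rule unscale[OF comb_br3[OF abcy(1) abcy(4) abcy(1) abcy(1), where r = 1 and s = "p * p'" and t = 0] d(3)])
      (simp add: ev)
  have t1: "Q (\<lambda>i j. 2 * eu 0 2 i j - p' * eu 0 0 i j)"
    by (rule unscale[OF comb_br4[OF abcy(1) r abcy(1,2,3), where r = 1 and s = "- 4 * q'"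
          and t = "- 2 * x' * p'" and w = "- 8 * p'"], of "8 - 2 * x * x'"])
      (use d in \<open>simp_all add: ev\<close>)
  have t2: "Q (\<lambda>i j. 2 * eu 2 0 i j - p * eu 0 0 i j)"
    by (rule unscale[OF comb_br4[OF s abcy(2) abcy(2,1,3), where r = 1 and s = "- 4 * q"
          and t = "- 2 * x * p" and w = "- 8 * p"], of "8 - 2 * x * x'"])
      (use d in \<open>simp_all add: ev\<close>)
  show "Q (\<lambda>i j. 2 * eu 0 2 i j - M 2 0 * eu 0 0 i j)"
    "Q (\<lambda>i j. 2 * eu 2 0 i j - M 0 2 * eu 0 0 i j)" using t1 t2 by (simp_all only: M)
  show "Q (\<lambda>i j. eu 0 0 i j - eu 2 2 i j)"
    by (rule comb_br3[OF t1 t2 t1 t2, where r = "1 / 8" and s = "- p / 4" and t = "- p' / 4"])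
      (simp add: ev field_simps)
qed

lemma compose_step:
  assumes a: "Q (\<lambda>i j. 2 * eu 0 1 i j - M 1 0 * eu 1 1 i j)"
    and b: "Q (\<lambda>i j. 2 * eu 1 2 i j - M 2 1 * eu 1 1 i j)"
  shows "Q (\<lambda>i j. 2 * eu 0 2 i j - M 2 0 * eu 1 1 i j)"
  by (rule comb_br3[OF a b a b, where r = "1 / 4" and s = "M 2 1 / 2" and t = "M 1 0 / 2"])
    (simp add: ev field_simps)

end

section \<open>Rank-one matrices and Zariski density\<close>

definition rmul :: "nat \<Rightarrow> real mat \<Rightarrow> (nat \<Rightarrow> nat \<Rightarrow> real) \<Rightarrow> real mat" where
  "rmul n B K = mat n n (\<lambda>(i, j). \<Sum>k<n. B $$ (i, k) * K k j)"

definition rk1 :: "(nat \<Rightarrow> real) \<Rightarrow> (nat \<Rightarrow> real) \<Rightarrow> nat \<Rightarrow> nat \<Rightarrow> real" where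
  "rk1 u f = (\<lambda>i j. (if i = j then 1 else 0) + u i * f j)"

definition pairing :: "nat \<Rightarrow> (nat \<Rightarrow> real) \<Rightarrow> (nat \<Rightarrow> real) \<Rightarrow> real" where
  "pairing n f u = (\<Sum>i<n. f i * u i)"

lemma rmul_carrier [simp]: "rmul n B K \<in> carrier_mat n n"
  by (simp add: rmul_def)

lemma rmul_mult: "A \<in> carrier_mat n n \<Longrightarrow> A * mat n n (\<lambda>(i, j). K i j) = rmul n A K"
  by (intro eq_matI) (auto simp: rmul_def scalar_prod_def lessThan_atLeast0)

lemma rmul_rmul: "rmul n (rmul n A K) L = rmul n A (fmul n K L)"
proof (intro eq_matI)
  fix i j assume "i < dim_row (rmul n A (fmul n K L))" "j < dim_col (rmul n A (fmul n K L))"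
  then have "i < n" "j < n" by (simp_all add: rmul_def)
  then have "rmul n (rmul n A K) L $$ (i, j) = (\<Sum>k<n. (\<Sum>l<n. A $$ (i, l) * K l k) * L k j)"
    by (simp add: rmul_def)
  also have "\<dots> = (\<Sum>l<n. A $$ (i, l) * (\<Sum>k<n. K l k * L k j))"
    unfolding sum_distrib_left sum_distrib_right by (subst sum.swap) (simp add: algebra_simps)
  finally show "rmul n (rmul n A K) L $$ (i, j) = rmul n A (fmul n K L) $$ (i, j)"
    using \<open>i < n\<close> \<open>j < n\<close> by (simp add: rmul_def fmul_def)
qed (simp_all add: rmul_def)

lemma rmul_cong: "(\<And>i j. i < n \<Longrightarrow> j < n \<Longrightarrow> K i j = L i j) \<Longrightarrow> rmul n A K = rmul n A L"
  by (intro eq_matI) (auto simp: rmul_def)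

lemma rmul_id: "A \<in> carrier_mat n n \<Longrightarrow> rmul n A (\<lambda>i j. if i = j then 1 else 0) = A"
  by (intro eq_matI) (auto simp: rmul_def if_distrib cong: if_cong)

lemma rmul_rk1_entry:
  assumes "i < n" "j < n"
  shows "rmul n A (rk1 u f) $$ (i, j) = A $$ (i, j) + (\<Sum>k<n. A $$ (i, k) * u k) * f j"
proof -
  have "rmul n A (rk1 u f) $$ (i, j) =
    (\<Sum>k<n. (if k = j then A $$ (i, k) else 0) + A $$ (i, k) * u k * f j)"
    using assms by (auto simp: rmul_def rk1_def algebra_simps intro!: sum.cong)
  then show ?thesis using assms by (simp add: sum.distrib sum_distrib_right)
qed

lemma fmul_rk1: "fmul n (rk1 u f) (rk1 u g) i j =
    (if i = j then 1 else 0) + u i * (f j + g j + pairing n f u * g j)" if "i < n" "j < n"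
proof -
  have "fmul n (rk1 u f) (rk1 u g) i j = (\<Sum>k<n. (if k = i then (if k = j then 1 else 0) + u i * g j else 0)
     + ((if k = j then u i * f j else 0) + f k * u k * (u i * g j)))"
    by (auto simp: fmul_def rk1_def algebra_simps intro!: sum.cong)
  moreover have "(\<Sum>k<n. f k * u k * (u i * g j)) = pairing n f u * (u i * g j)"
    by (simp add: pairing_def sum_distrib_right)
  ultimately show ?thesis using that by (simp add: sum.distrib distrib_left)
qed

lemma rmul_rk1_inverse:
  assumes "pairing n f u = 0" "A \<in> carrier_mat n n"
  shows "rmul n (rmul n A (rk1 u f)) (rk1 u (\<lambda>j. - f j)) = A"
proof -
  have "rmul n (rmul n A (rk1 u f)) (rk1 u (\<lambda>j. - f j)) = rmul n A (\<lambda>i j. if i = j then 1 else 0)"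
    unfolding rmul_rmul by (intro rmul_cong) (simp add: fmul_rk1 assms)
  then show ?thesis using assms by (simp add: rmul_id)
qed

lemma rmul_rk1_involution:
  assumes "pairing n f u = -2" "A \<in> carrier_mat n n"
  shows "rmul n (rmul n A (rk1 u f)) (rk1 u f) = A"
proof -
  have "rmul n (rmul n A (rk1 u f)) (rk1 u f) = rmul n A (\<lambda>i j. if i = j then 1 else 0)"
    unfolding rmul_rmul by (intro rmul_cong) (simp add: fmul_rk1 assms)
  then show ?thesis using assms by (simp add: rmul_id)
qed

text \<open>The matrix determinant lemma: one block matrix with identity diagonal blocks is factored
  into block triangular matrices in two ways.\<close>

lemma det_rk1: "det (mat n n (\<lambda>(i, j). rk1 u f i j)) = 1 + pairing n f u"
proof -
  define U where "U = mat n 1 (\<lambda>(i, j). - u i)"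
  define P where "P = mat 1 n (\<lambda>(i, j). f j)"
  let ?K = "mat n n (\<lambda>(i, j). rk1 u f i j)"
  let ?s = "mat 1 1 (\<lambda>_. 1 + pairing n f u)"
  let ?M = "four_block_mat (1\<^sub>m n) U P (1\<^sub>m 1)"
  have c: "U \<in> carrier_mat n 1" "P \<in> carrier_mat 1 n" by (simp_all add: U_def P_def)
  have "four_block_mat (1\<^sub>m n) (0\<^sub>m n 1) P (1\<^sub>m 1) * four_block_mat (1\<^sub>m n) U (0\<^sub>m 1 n) ?s = ?M"
    using c by (subst mult_four_block_mat[of _ n n _ 1 _ 1 _ _ n _ 1])
      (auto intro!: arg_cong4[where f=four_block_mat] eq_matI
        simp: U_def P_def scalar_prod_def pairing_def lessThan_atLeast0 sum_negf)
  moreover have "four_block_mat ?K U (0\<^sub>m 1 n) (1\<^sub>m 1) * four_block_mat (1\<^sub>m n) (0\<^sub>m n 1) P (1\<^sub>m 1) = ?M"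
    using c by (subst mult_four_block_mat[of _ n n _ 1 _ 1 _ _ n _ 1])
      (auto intro!: arg_cong4[where f=four_block_mat] eq_matI
        simp: U_def P_def rk1_def scalar_prod_def)
  moreover have "det (four_block_mat (1\<^sub>m n) (0\<^sub>m n 1) P (1\<^sub>m 1)) = 1"
    using c by (subst det_four_block_mat_upper_right_zero) auto
  moreover have "det (four_block_mat (1\<^sub>m n) U (0\<^sub>m 1 n) ?s) = 1 + pairing n f u"
    using c by (subst det_four_block_mat_lower_left_zero) (auto simp: det_single)
  moreover have "det (four_block_mat ?K U (0\<^sub>m 1 n) (1\<^sub>m 1)) = det ?K"
    using c by (subst det_four_block_mat_lower_left_zero[where n=n and m=1]) auto
  moreover have "four_block_mat (1\<^sub>m n) (0\<^sub>m n 1) P (1\<^sub>m 1) \<in> carrier_mat (n + 1) (n + 1)"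
    "four_block_mat (1\<^sub>m n) U (0\<^sub>m 1 n) ?s \<in> carrier_mat (n + 1) (n + 1)"
    "four_block_mat ?K U (0\<^sub>m 1 n) (1\<^sub>m 1) \<in> carrier_mat (n + 1) (n + 1)"
    using c by auto
  ultimately show ?thesis
    using det_mult[of "four_block_mat (1\<^sub>m n) (0\<^sub>m n 1) P (1\<^sub>m 1)" "n + 1"
        "four_block_mat (1\<^sub>m n) U (0\<^sub>m 1 n) ?s"]
      det_mult[of "four_block_mat ?K U (0\<^sub>m 1 n) (1\<^sub>m 1)" "n + 1"
        "four_block_mat (1\<^sub>m n) (0\<^sub>m n 1) P (1\<^sub>m 1)"]
    by simp
qed

lemma det_rmul_rk1:
  "A \<in> carrier_mat n n \<Longrightarrow> det (rmul n A (rk1 u f)) = det A * (1 + pairing n f u)"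
  by (subst rmul_mult[symmetric]) (simp_all add: det_mult[where n=n] det_rk1)

text \<open>Column operations, organized by rows: \<open>U j\<close> says that the first
  \<open>j\<close> rows are already those of the identity, and the induction runs downwards from
  \<open>n\<close>. Allowing all rank-one transvections clears the rest of a row in a single move,
  once its diagonal entry is 1.\<close>

lemma SL_generated_by_transvections:
  assumes one: "1\<^sub>m n \<in> C"
    and closed: "\<And>B u f. B \<in> C \<Longrightarrow> pairing n f u = 0 \<Longrightarrow> rmul n B (rk1 u f) \<in> C"
    and A: "A \<in> carrier_mat n n" "det A = 1"
  shows "A \<in> C"
proof -
  define U :: "nat \<Rightarrow> real mat \<Rightarrow> bool" where "U j A \<longleftrightarrow> A \<in> carrier_mat n n \<and> det A = 1 \<and>
    (\<forall>i<j. \<forall>l<n. A $$ (i, l) = (if i = l then 1 else 0))" for j A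
  have undo: "B \<in> C" if "rmul n B (rk1 u f) \<in> C" "pairing n f u = 0" "B \<in> carrier_mat n n" for B u f
  proof -
    have "pairing n (\<lambda>j. - f j) u = 0" using that by (simp add: pairing_def sum_negf)
    from closed[OF that(1) this] show ?thesis using rmul_rk1_inverse[OF that(2,3)] by simp
  qed
  have pres: "U j (rmul n B (rk1 u f))" if "U j B" "pairing n f u = 0" "\<And>k. k < j \<Longrightarrow> u k = 0" "j < n"
    for j B u f
    unfolding U_def
  proof (intro conjI allI impI)
    show "det (rmul n B (rk1 u f)) = 1" using that by (simp add: U_def det_rmul_rk1)
    fix i l assume il: "i < j" "l < n"
    have "(\<Sum>k<n. B $$ (i, k) * u k) = (\<Sum>k<n. if k = i then u i else 0)"
      using that il by (intro sum.cong) (auto simp: U_def)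
    then show "rmul n B (rk1 u f) $$ (i, l) = (if i = l then 1 else 0)"
      using that il by (simp add: rmul_rk1_entry U_def)
  qed simp
  let ?e = "\<lambda>c j i. if i = j then c else (0::real)"
  have pe: "pairing n (?e c j) (?e d k) = 0" if "j \<noteq> k" for c d j k
    using that by (simp add: pairing_def if_distrib sum.neutral)
  have sume: "(\<Sum>k<n. B $$ (i, k) * ?e c j k) = B $$ (i, j) * c" if "j < n" for B :: "real mat" and i j c
    using that by (simp add: if_distrib cong: if_cong)
  have clear: "B \<in> C" if IH: "\<And>B. U (Suc j) B \<Longrightarrow> B \<in> C" and B: "U j B" "B $$ (j, j) = 1" "j < n" for j B
  proof -
    let ?f = "\<lambda>k. if k = j then 0 else - B $$ (j, k)"
    have p: "pairing n ?f (?e 1 j) = 0" by (simp add: pairing_def if_distrib sum.neutral)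
    have "U j (rmul n B (rk1 (?e 1 j) ?f))" using B p by (intro pres) auto
    moreover have "rmul n B (rk1 (?e 1 j) ?f) $$ (j, l) = (if j = l then 1 else 0)" if "l < n" for l
      using that B by (auto simp: rmul_rk1_entry sume)
    ultimately have "U (Suc j) (rmul n B (rk1 (?e 1 j) ?f))" by (auto simp: U_def less_Suc_eq)
    then show ?thesis using IH undo[OF _ p] B by (auto simp: U_def)
  qed
  have pivot: "B \<in> C" if IH: "\<And>B. U (Suc j) B \<Longrightarrow> B \<in> C" and B: "U j B" "j < l" "l < n" "B $$ (j, l) \<noteq> 0"
    for j l B
  proof -
    define c where "c = (1 - B $$ (j, j)) / B $$ (j, l)"
    have p: "pairing n (?e 1 j) (?e c l) = 0" using B by (intro pe) auto
    have "U j (rmul n B (rk1 (?e c l) (?e 1 j)))" using B p by (intro pres) auto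
    moreover have "rmul n B (rk1 (?e c l) (?e 1 j)) $$ (j, j) = 1"
      using B by (simp add: rmul_rk1_entry sume c_def)
    ultimately have "rmul n B (rk1 (?e c l) (?e 1 j)) \<in> C" 
      using B by (intro clear[of j, OF IH]) auto
    then show ?thesis using undo[OF _ p] B by (auto simp: U_def)
  qed
  have "U j B \<Longrightarrow> B \<in> C" if "j \<le> n" for j B
    using that
  proof (induction j arbitrary: B rule: inc_induct)
    case base
    then have "B = 1\<^sub>m n" by (intro eq_matI) (auto simp: U_def)
    then show ?case using one by simp
  next
    case (step j)
    have IH: "\<And>B. U (Suc j) B \<Longrightarrow> B \<in> C" using step.IH .
    note j = \<open>j < n\<close>
    have Bc: "B \<in> carrier_mat n n" using step.prems by (simp add: U_def)
    show ?case
    proof (cases "\<exists>l. j < l \<and> l < n \<and> B $$ (j, l) \<noteq> 0")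
      case True
      then show ?thesis using pivot[of j, OF IH step.prems] by blast
    next
      case False
      have nz: "B $$ (j, j) \<noteq> 0"
      \<comment> \<open>Otherwise row \<open>j\<close> lives in the first \<open>j\<close> columns,
        where the earlier rows are unit vectors, and the matrix would be singular.\<close>
      proof
        assume z: "B $$ (j, j) = 0"
        have "det B \<noteq> 0" using step.prems by (simp add: U_def)
        then have "B \<in> Units (ring_mat TYPE(real) n ())" by (rule det_non_zero_imp_unit[OF Bc])
        then obtain D where D: "D \<in> carrier_mat n n" "B * D = 1\<^sub>m n"
          by (auto simp: Units_def ring_mat_def)
        have BD: "(\<Sum>l<n. B $$ (i, l) * D $$ (l, k)) = (if i = k then 1 else 0)" if "i < n" "k < n" for i k
          using arg_cong[OF D(2), of "\<lambda>M. M $$ (i, k)"] that Bc D(1)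
          by (simp add: scalar_prod_def lessThan_atLeast0)
        have "D $$ (i, j) = 0" if "i < j" for i
        proof -
          have "(\<Sum>l<n. B $$ (i, l) * D $$ (l, j)) = (\<Sum>l<n. if l = i then D $$ (i, j) else 0)"
            using that step.prems j by (intro sum.cong) (auto simp: U_def)
          then show ?thesis using BD[of i j] that j by simp
        qed
        then have "(\<Sum>l<n. B $$ (j, l) * D $$ (l, j)) = 0"
          using False z by (intro sum.neutral) (metis lessThan_iff linorder_neqE_nat mult_zero_left mult_zero_right)
        then show False using BD[of j j] j by simp
      qed
      show ?thesis
      proof (cases "Suc j < n")
        case True
        \<comment> \<open>Adding column \<open>j\<close> to the next one creates a nonzero entry to
          the right of the diagonal, which reduces this case to \<open>pivot\<close>.\<close>
        have p: "pairing n (?e 1 (Suc j)) (?e 1 j) = 0" by (intro pe) auto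
        have "U j (rmul n B (rk1 (?e 1 j) (?e 1 (Suc j))))" using step.prems p j by (intro pres) auto
        moreover have "rmul n B (rk1 (?e 1 j) (?e 1 (Suc j))) $$ (j, Suc j) \<noteq> 0"
          using nz True False by (simp add: rmul_rk1_entry sume)
        ultimately have "rmul n B (rk1 (?e 1 j) (?e 1 (Suc j))) \<in> C"
          using True by (intro pivot[of j _ "Suc j", OF IH]) auto
        then show ?thesis using undo[OF _ p] Bc by auto
      next
        case last: False
        then have nj: "n = Suc j" using j by simp
        \<comment> \<open>The last row has no further column to work with; there the determinant
          fixes the diagonal entry.\<close>
        have "det B = prod_list (diag_mat B)"
          using step.prems nj by (intro det_lower_triangular[OF _ Bc]) (auto simp: U_def less_Suc_eq)
        also have "diag_mat B = replicate j 1 @ [B $$ (j, j)]"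
          using step.prems nj Bc by (auto simp: diag_mat_def U_def intro!: nth_equalityI simp: nth_append less_Suc_eq)
        finally have "B $$ (j, j) = 1" using step.prems by (simp add: U_def)
        then show ?thesis using j by (intro clear[of j, OF IH step.prems])
      qed
    qed
  qed
  then show ?thesis using A U_def[of 0 A] by auto
qed

lemma poly_fun_rmul: "p \<in> poly_fun n \<Longrightarrow> (\<lambda>B. p (rmul n B K)) \<in> poly_fun n"
proof (induction rule: poly_fun.induct)
  case (entry i j)
  then have "(\<lambda>B. rmul n B K $$ (i, j)) = (\<lambda>B. \<Sum>k<n. B $$ (i, k) * K k j)"
    by (auto simp: rmul_def)
  then show ?case using entry by (auto intro!: poly_fun_sum poly_fun.mult poly_fun.entry poly_fun.const)
qed (auto intro!: poly_fun.const poly_fun.add poly_fun.mult)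

lemma zclosure_rmul:
  assumes "\<And>B. B \<in> H \<Longrightarrow> rmul n B K \<in> H" "A \<in> zclosure n H"
  shows "rmul n A K \<in> zclosure n H"
proof -
  have *: "q A = 0" if "q \<in> poly_fun n" "\<forall>B\<in>H. q B = 0" for q
    using assms(2) that by (simp add: zclosure_def)
  have "p (rmul n A K) = 0" if "p \<in> poly_fun n" "\<forall>B\<in>H. p B = 0" for p
    using *[OF poly_fun_rmul[OF that(1), of K]] that(2) assms(1) by simp
  then show ?thesis by (simp add: zclosure_def)
qed

text \<open>Transvections reach determinant 1; one reflection moves the component of determinant -1
  there and back.\<close>

lemma zclosure_contains_SLpm:
  assumes one: "1\<^sub>m n \<in> H"
    and lie: "\<And>u f. pairing n f u = 0 \<Longrightarrow> lie n H (\<lambda>i j. u i * f j)"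
    and refl: "pairing n g w = -2" "\<And>B. B \<in> H \<Longrightarrow> rmul n B (rk1 w g) \<in> H"
  shows "SLpm_R n \<subseteq> zclosure n H"
proof
  fix A assume "A \<in> SLpm_R n"
  have SL: "B \<in> zclosure n H" if B: "B \<in> carrier_mat n n" "det B = 1" for B
  proof (rule SL_generated_by_transvections[OF _ _ B])
    show "1\<^sub>m n \<in> zclosure n H" using one by (simp add: zclosure_def)
    fix B u f assume B: "B \<in> zclosure n H" and p: "pairing n f u = 0"
    have sq: "fmul n (\<lambda>i j. u i * f j) (\<lambda>i j. u i * f j) i j = 0" for i j
    proof -
      have "fmul n (\<lambda>i j. u i * f j) (\<lambda>i j. u i * f j) i j = (\<Sum>k<n. f k * u k) * (u i * f j)"
        unfolding fmul_def sum_distrib_right by (simp add: algebra_simps)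
      then show ?thesis using p by (simp add: pairing_def)
    qed
    have "shift_mat n (\<lambda>i j. u i * f j) B 1 = rmul n B (rk1 u f)"
    proof (rule eq_matI)
      fix i j assume "i < dim_row (rmul n B (rk1 u f))" "j < dim_col (rmul n B (rk1 u f))"
      then have "i < n" "j < n" by (simp_all add: rmul_def)
      then show "shift_mat n (\<lambda>i j. u i * f j) B 1 $$ (i, j) = rmul n B (rk1 u f) $$ (i, j)"
        by (simp add: rmul_rk1_entry) (simp add: shift_mat_def sum_distrib_right mult.assoc)
    qed (simp_all add: shift_mat_def rmul_def)
    then show "rmul n B (rk1 u f) \<in> zclosure n H"
      using zclosure_shift[OF lie[OF p] sq B, of 1] by simp
  qed
  show "A \<in> zclosure n H"
  proof (cases "det A = 1")
    case True
    then show ?thesis using SL \<open>A \<in> SLpm_R n\<close> by (simp add: SLpm_R_def)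
  next
    case False
    then have A: "A \<in> carrier_mat n n" "det A = -1" using \<open>A \<in> SLpm_R n\<close> by (auto simp: SLpm_R_def)
    then have "rmul n A (rk1 w g) \<in> zclosure n H" using refl(1) by (intro SL) (auto simp: det_rmul_rk1)
    then have "rmul n (rmul n A (rk1 w g)) (rk1 w g) \<in> zclosure n H"
      using zclosure_rmul[of H n "rk1 w g"] refl(2) by blast
    then show ?thesis using rmul_rk1_involution[OF refl(1) A(1)] by simp
  qed
qed

section \<open>The Lie algebra of a group generated by reflections\<close>

locale rank_one_refl =
  fixes n :: nat and \<alpha> v :: "'x \<Rightarrow> nat \<Rightarrow> real" and X :: "'x set" and H :: "real mat set"
  assumes pair_diag: "x \<in> X \<Longrightarrow> pairing n (\<alpha> x) (v x) = 2"
    and pair_off: "x \<in> X \<Longrightarrow> y \<in> X \<Longrightarrow> x \<noteq> y \<Longrightarrow>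
      (pairing n (\<alpha> x) (v y) = 0 \<and> pairing n (\<alpha> y) (v x) = 0) \<or>
      (pairing n (\<alpha> x) (v y) \<le> -3 \<and> pairing n (\<alpha> y) (v x) \<le> -3)"
    and one_H: "1\<^sub>m n \<in> H"
    and carrier_H: "H \<subseteq> carrier_mat n n"
    and refl_H: "x \<in> X \<Longrightarrow> B \<in> H \<Longrightarrow> rmul n B (rk1 (\<lambda>i. - v x i) (\<alpha> x)) \<in> H"
begin

abbreviation cm :: "'x \<Rightarrow> 'x \<Rightarrow> real" where
  "cm x y \<equiv> pairing n (\<alpha> x) (v y)"

definition E :: "'x \<Rightarrow> 'x \<Rightarrow> nat \<Rightarrow> nat \<Rightarrow> real" where
  "E x y = (\<lambda>i j. v x i * \<alpha> y j)"

definition edge :: "'x \<Rightarrow> 'x \<Rightarrow> bool" where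
  "edge x y \<longleftrightarrow> x \<in> X \<and> y \<in> X \<and> x \<noteq> y \<and> cm x y \<noteq> 0"

lemma edge_sym: "edge x y \<Longrightarrow> edge y x"
  using pair_off[of x y] by (auto simp: edge_def)

lemma edge_le: "edge x y \<Longrightarrow> cm x y \<le> -3"
  using pair_off[of x y] by (auto simp: edge_def)

lemma edge_prod: "edge x y \<Longrightarrow> cm x y * cm y x \<ge> 9"
  using mult_mono[of 3 "- cm x y" 3 "- cm y x"] edge_le[of x y] edge_le[OF edge_sym, of x y]
  by simp

lemma fmul_E: "fmul n (E x y) (E z w) i j = cm y z * E x w i j"
  unfolding fmul_def E_def pairing_def sum_distrib_right by (simp add: algebra_simps)

text \<open>The powers of a product of two reflections lie on a hyperbola whose tangent at the
  identity is the commutator of the two reflections.\<close>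
lemma lie_edge:
  assumes "edge x y"
  shows "lie n H (\<lambda>i j. cm x y * E x y i j - cm y x * E y x i j)"
proof -
  let ?Y = "\<lambda>i j. cm x y * E x y i j - cm y x * E y x i j"
  let ?Z = "\<lambda>i j. cm x y * E x y i j + cm y x * E y x i j - 2 * E x x i j - 2 * E y y i j"
  have X: "x \<in> X" "y \<in> X" using assms by (auto simp: edge_def)
  note d = pair_diag[OF X(1)] pair_diag[OF X(2)]
  define a b where "a = cm x y" and "b = cm y x"
  \<comment> \<open>The trace of the product of the two reflections on the plane spanned by their
    vectors; \<open>l\<close> and \<open>w\<close> below are its eigenvalues there.\<close>
  define q where "q = a * b - 2"
  have q: "q \<ge> 7" using edge_prod[OF assms] by (simp add: q_def a_def b_def)
  define r where "r = sqrt (q\<^sup>2 - 4)"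
  define l where "l = (q + r) / 2"
  define w where "w = (q - r) / 2"
  have "q\<^sup>2 \<ge> 4" using power_mono[of 2 q 2] q by simp
  then have s0: "r \<ge> 0" and s2: "r\<^sup>2 = q\<^sup>2 - 4" by (auto simp: r_def)
  have lw: "l * w = 1" using s2 by (simp add: l_def w_def field_simps power2_eq_square)
  have lpw: "l + w = a * b - 2" by (simp add: l_def w_def q_def field_simps)
  have l1: "l > 1" using add_mono[OF q s0] by (simp add: l_def)
  have w1: "w = inverse l" using lw l1 by (simp add: field_simps)
  have "w < 1" using l1 by (simp add: w1 inverse_less_1_iff)
  \<comment> \<open>Chosen so that \<open>s 1 = t 1 = 1 / 2\<close>. Then \<open>K 1\<close> is the
    product of the two reflections and \<open>K k\<close> is its \<open>k\<close>-th power.\<close>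
  define c e where "c = 1 / (2 * (l - w))" and "e = 1 / (2 * (l + w - 2))"
  have c: "c * (l - w) = 1 / 2" "c \<noteq> 0" using l1 \<open>w < 1\<close> by (auto simp: c_def field_simps)
  have e: "e * (l + w - 2) = 1 / 2" using q by (simp add: e_def lpw q_def)
  have ce: "c * (l + w + 2) = e * (l - w)"
  proof -
    have "(l - w) * (l - w) = (l + w - 2) * (l + w + 2)" using lw by (simp add: algebra_simps)
    then have "c * (l - w) * (e * (l - w)) = e * (l + w - 2) * (c * (l + w + 2))"
      by (metis (no_types, opaque_lifting) mult.assoc mult.commute mult.left_commute)
    then show ?thesis using c e by simp
  qed
  define s t where "s k = c * (l ^ k - w ^ k)" and "t k = e * (l ^ k + w ^ k - 2)" for k :: nat
  define K where "K k = (\<lambda>i j. (if i = j then 1 else 0) + s k * ?Y i j + t k * ?Z i j)" for k :: nat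
  have rec_s: "s (Suc k) - t (Suc k) = - (s k + t k)" for k
  proof -
    have "s (Suc k) - t (Suc k) + s k + t k =
      c * (l + w + 2) * ((l ^ k - w ^ k) / 2) - e * (l - w) * ((l ^ k - w ^ k) / 2)
      + (c * (l - w)) * ((l ^ k + w ^ k) / 2) - (e * (l + w - 2)) * ((l ^ k + w ^ k) / 2 + 0)"
      by (simp add: s_def t_def field_simps)
    then show ?thesis using ce c(1) e by simp
  qed
  have rec_t: "2 * t (Suc k) = 1 - 2 * t k + a * b * (s k + t k)" for k
  proof -
    have ab: "a * b = l + w + 2" using lpw by simp
    have "1 - 2 * t k + a * b * (s k + t k) - 2 * t (Suc k) =
       (c * (l + w + 2) - e * (l - w)) * (l ^ k - w ^ k) + (1 - 2 * (e * (l + w - 2)))"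
      unfolding ab by (simp add: s_def t_def algebra_simps)
    then show ?thesis using ce e by simp
  qed
  have step: "fmul n (fmul n (K k) (rk1 (\<lambda>i. - v x i) (\<alpha> x))) (rk1 (\<lambda>i. - v y i) (\<alpha> y)) i j = K (Suc k) i j"
    if "i < n" "j < n" for k i j
  proof -
    have right: "fmul n L (rk1 (\<lambda>i. - v z i) (\<alpha> z)) i j = L i j - fmul n L (E z z) i j"
      if "i < n" "j < n" for L z i j
    proof -
      have "fmul n L (rk1 (\<lambda>i. - v z i) (\<alpha> z)) i j =
        (\<Sum>k<n. (if k = j then L i k else 0) - L i k * E z z k j)"
        by (auto simp: fmul_def rk1_def E_def algebra_simps intro!: sum.cong)
      then show ?thesis using that by (simp add: sum_subtractf fmul_def)
    qed
    have lin5: "fmul n (\<lambda>i j. (if i = j then 1 else 0) + A * E x x i j + B * E x y i j + C * E y x i j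
        + D * E y y i j) (E z z) i j = E z z i j + A * fmul n (E x x) (E z z) i j
        + B * fmul n (E x y) (E z z) i j + C * fmul n (E y x) (E z z) i j + D * fmul n (E y y) (E z z) i j"
      if "i < n" for A B C D z i j
    proof -
      have "(\<Sum>k<n. (if i = k then 1 else 0) * E z z k j) = E z z i j"
        using that by (simp add: if_distrib[of "\<lambda>x. x * _"] cong: if_cong)
      then show ?thesis
        by (simp add: fmul_def distrib_right sum.distrib sum_distrib_left mult.assoc)
    qed
    define T where "T = s k + t k"
    have K5: "K k = (\<lambda>i j. (if i = j then 1 else 0) + (- 2 * t k) * E x x i j + (a * T) * E x y i j
        + (b * (t k - s k)) * E y x i j + (- 2 * t k) * E y y i j)"
      by (auto simp: K_def T_def a_def b_def algebra_simps)
    have 1: "fmul n (K k) (rk1 (\<lambda>i. - v x i) (\<alpha> x)) i j =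
       (if i = j then 1 else 0) + (2 * t k - 1 - a * b * T) * E x x i j + (a * T) * E x y i j
        + (b * T) * E y x i j + (- 2 * t k) * E y y i j" if "i < n" "j < n" for i j
      unfolding right[OF that] unfolding K5 lin5[OF that(1)]
      by (simp add: fmul_E d a_def b_def T_def algebra_simps)
    have "fmul n (fmul n (K k) (rk1 (\<lambda>i. - v x i) (\<alpha> x))) (rk1 (\<lambda>i. - v y i) (\<alpha> y)) i j =
       fmul n (\<lambda>i j. (if i = j then 1 else 0) + (2 * t k - 1 - a * b * T) * E x x i j + (a * T) * E x y i j
        + (b * T) * E y x i j + (- 2 * t k) * E y y i j) (rk1 (\<lambda>i. - v y i) (\<alpha> y)) i j"
      using \<open>i < n\<close> by (simp add: fmul_def[of _ _ "rk1 (\<lambda>i. - v y i) (\<alpha> y)"] 1)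
    also have "\<dots> = (if i = j then 1 else 0) + (2 * t k - 1 - a * b * T) * E x x i j
        + a * (1 - 2 * t k + a * b * T - T) * E x y i j
        + (b * T) * E y x i j + (2 * t k - 1 - a * b * T) * E y y i j"
      unfolding right[OF \<open>i < n\<close> \<open>j < n\<close>] lin5[OF \<open>i < n\<close>]
      by (simp add: fmul_E d a_def b_def algebra_simps)
    also have "\<dots> = K (Suc k) i j"
    proof -
      have "2 * t k - 1 - a * b * T = - 2 * t (Suc k)" "1 - 2 * t k + a * b * T - T = s (Suc k) + t (Suc k)"
        "T = t (Suc k) - s (Suc k)"
        using rec_t[of k] rec_s[of k] by (simp_all add: T_def)
      then show ?thesis
        by (simp only:) (simp add: K_def a_def b_def algebra_simps)
    qed
    finally show ?thesis .
  qed
  have KH: "rmul n A (K k) \<in> H" if A: "A \<in> H" for A k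
  proof (induction k)
    case 0
    have "rmul n A (K 0) = A" using rmul_id[of A n] carrier_H A by (auto simp: K_def s_def t_def)
    then show ?case using A by simp
  next
    case (Suc k)
    have "rmul n (rmul n (rmul n A (K k)) (rk1 (\<lambda>i. - v x i) (\<alpha> x))) (rk1 (\<lambda>i. - v y i) (\<alpha> y)) \<in> H"
      using Suc X by (intro refl_H)
    also have "rmul n (rmul n (rmul n A (K k)) (rk1 (\<lambda>i. - v x i) (\<alpha> x))) (rk1 (\<lambda>i. - v y i) (\<alpha> y)) =
      rmul n A (K (Suc k))"
      unfolding rmul_rmul
      by (rule rmul_cong) (rule step)
    finally show ?case .
  qed
  have "mat n n (\<lambda>(i, j). \<Sum>m<n. A $$ (i, m) * ((if m = j then 1 else 0)
        + c * (l ^ k - inverse (l ^ k)) * ?Y m j + e * (l ^ k + inverse (l ^ k) - 2) * ?Z m j)) \<in> H"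
    if "A \<in> H" for A k
    using KH[OF that, of k] unfolding rmul_def K_def s_def t_def w1 power_inverse .
  then show ?thesis by (rule lie_curve[OF l1 c(2)])
qed

definition E3 :: "(nat \<Rightarrow> 'x) \<Rightarrow> (nat \<Rightarrow> nat \<Rightarrow> real) \<Rightarrow> nat \<Rightarrow> nat \<Rightarrow> real" where
  "E3 x K = (\<lambda>i j. \<Sum>a<3. \<Sum>b<3. K a b * E (x a) (x b) i j)"

lemma fmul_sum_left: "fmul n (\<lambda>i j. \<Sum>a\<in>T. f a i j) L i j = (\<Sum>a\<in>T. fmul n (f a) L i j)"
  and fmul_sum_right: "fmul n L (\<lambda>i j. \<Sum>a\<in>T. f a i j) i j = (\<Sum>a\<in>T. fmul n L (f a) i j)"
  and fmul_scale_left: "fmul n (\<lambda>i j. c * g i j) L i j = c * fmul n g L i j"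
  and fmul_scale_right: "fmul n L (\<lambda>i j. c * g i j) i j = c * fmul n L g i j"
  unfolding fmul_def sum_distrib_left sum_distrib_right
  by (rule sum.swap sum.cong[OF HOL.refl]; simp)+

lemma fmul_E3:
  "fmul n (E3 x K) (E3 x L) i j =
    E3 x (\<lambda>a b. \<Sum>c<3. \<Sum>d<3. K a c * cm (x c) (x d) * L d b) i j"
proof -
  have "fmul n (E3 x K) (E3 x L) i j = (\<Sum>a<3. \<Sum>c<3. K a c * (\<Sum>d<3. \<Sum>b<3. L d b * (cm (x c) (x d) * E (x a) (x b) i j)))"
    unfolding E3_def by (simp only: fmul_sum_left fmul_scale_left fmul_sum_right fmul_scale_right fmul_E)
  also have "\<dots> = (\<Sum>a<3. \<Sum>c<3. \<Sum>b<3. \<Sum>d<3. K a c * cm (x c) (x d) * L d b * E (x a) (x b) i j)"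
    unfolding sum_distrib_left 
    by (rule sum.cong[OF HOL.refl], rule sum.cong[OF HOL.refl], subst sum.swap) (simp add: algebra_simps)
  also have "\<dots> = (\<Sum>a<3. \<Sum>b<3. \<Sum>c<3. \<Sum>d<3. K a c * cm (x c) (x d) * L d b * E (x a) (x b) i j)"
    by (rule sum.cong[OF HOL.refl], rule sum.swap)
  finally show ?thesis unfolding E3_def sum_distrib_right .
qed

lemma coeff_lie_E3:
  assumes "x 0 \<in> X" "x 1 \<in> X" "x 2 \<in> X"
  shows "coeff_lie (\<lambda>K. lie n H (E3 x K)) (\<lambda>a b. cm (x a) (x b))"
proof
  fix K L :: "nat \<Rightarrow> nat \<Rightarrow> real" and r s :: real
  assume K: "lie n H (E3 x K)"
  show "lie n H (E3 x (\<lambda>a b. r * K a b + s * L a b))" if "lie n H (E3 x L)"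
    by (rule lie_cong[OF lie_lin[OF K that, of r s]])
      (simp add: E3_def sum_distrib_left sum.distrib distrib_right mult.assoc)
  show "lie n H (E3 x (bracket3 (\<lambda>a b. cm (x a) (x b)) K L))" if "lie n H (E3 x L)"
    by (rule lie_cong[OF lie_bracket[OF K that]])
      (unfold fmul_E3, simp add: E3_def bracket3_def sum_subtractf left_diff_distrib)
  show "lie n H (E3 x L)" if "\<And>a b. a < 3 \<Longrightarrow> b < 3 \<Longrightarrow> K a b = L a b"
    by (rule lie_cong[OF K]) (simp add: E3_def that)
qed (use assms pair_diag in simp_all)

definition tri :: "'x \<Rightarrow> 'x \<Rightarrow> 'x \<Rightarrow> nat \<Rightarrow> 'x" where
  "tri x y z = (\<lambda>a. if a = 0 then x else if a = 1 then y else z)"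

lemma tri_simps [simp]: "tri x y z 0 = x" "tri x y z (Suc 0) = y" "tri x y z 1 = y" "tri x y z 2 = z"
  by (simp_all add: tri_def)

lemma E3_simp: "E3 (tri x y z) K i j =
    K 0 0 * E x x i j + K 0 1 * E x y i j + K 0 2 * E x z i j +
    K 1 0 * E y x i j + K 1 1 * E y y i j + K 1 2 * E y z i j +
    K 2 0 * E z x i j + K 2 1 * E z y i j + K 2 2 * E z z i j"
proof -
  have "(\<Sum>c<3. f c) = f 0 + f 1 + f (2::nat)" for f :: "nat \<Rightarrow> real"
    by (simp add: numeral_3_eq_3 numeral_2_eq_2)
  then show ?thesis by (simp add: E3_def tri_def)
qed

lemma lie_E3:
  "lie n H Y \<Longrightarrow> (\<And>i j. Y i j = E3 x K i j) \<Longrightarrow> lie n H (E3 x K)"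
  by (erule lie_cong) simp

text \<open>The trace of \<open>E x y\<close> is \<open>cm y x\<close> and that of
  \<open>E x x\<close> is 2, so these span the traceless combinations supported on the two
  vertices.\<close>

definition full :: "'x \<Rightarrow> 'x \<Rightarrow> bool" where
  "full x y \<longleftrightarrow> lie n H (\<lambda>i j. 2 * E x y i j - cm y x * E x x i j) \<and>
    lie n H (\<lambda>i j. 2 * E y x i j - cm x y * E x x i j) \<and> lie n H (\<lambda>i j. E x x i j - E y y i j)"

lemma full_sym:
  assumes "full x y" shows "full y x"
proof -
  have 1: "lie n H (\<lambda>i j. 2 * E x y i j - cm y x * E x x i j)"
    and 2: "lie n H (\<lambda>i j. 2 * E y x i j - cm x y * E x x i j)"
    and 3: "lie n H (\<lambda>i j. E x x i j - E y y i j)" using assms by (auto simp: full_def)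
  show ?thesis unfolding full_def
    by (intro conjI lie_cong[OF lie_lin[OF 2 3, of 1 "cm x y"]] lie_cong[OF lie_lin[OF 1 3, of 1 "cm y x"]]
        lie_cong[OF lie_scale[OF 3, of "-1"]]) (simp_all add: algebra_simps)
qed

lemma full_grow:
  assumes "full x y" "edge x y" "edge x z"
  shows "full x z"
proof -
  let ?t = "tri x y z"
  have X: "x \<in> X" "y \<in> X" "z \<in> X" using assms by (auto simp: edge_def)
  interpret coeff_lie "\<lambda>K. lie n H (E3 ?t K)" "\<lambda>a b. cm (?t a) (?t b)"
    by (rule coeff_lie_E3) (use X in simp_all)
  have ne: "cm (?t 0) (?t 1) * cm (?t 1) (?t 0) \<noteq> 4" "cm (?t 0) (?t 2) \<noteq> 0" "cm (?t 2) (?t 0) \<noteq> 0"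
    using edge_prod[OF assms(2)] assms(3) edge_sym[OF assms(3)] by (auto simp: edge_def)
  have f: "lie n H (\<lambda>i j. 2 * E x y i j - cm y x * E x x i j)"
    "lie n H (\<lambda>i j. 2 * E y x i j - cm x y * E x x i j)" "lie n H (\<lambda>i j. E x x i j - E y y i j)"
    using assms(1) by (auto simp: full_def)
  note g = grow_step[OF ne lie_E3[OF f(1)] lie_E3[OF f(2)] lie_E3[OF f(3)] lie_E3[OF lie_edge[OF assms(3)]]]
  have "lie n H (\<lambda>i j. 2 * E x z i j - cm z x * E x x i j)"
    by (rule lie_cong[OF g(1)]) (simp_all add: E3_simp eu_def)
  moreover have "lie n H (\<lambda>i j. 2 * E z x i j - cm x z * E x x i j)"
    by (rule lie_cong[OF g(2)]) (simp_all add: E3_simp eu_def)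
  moreover have "lie n H (\<lambda>i j. E x x i j - E z z i j)"
    by (rule lie_cong[OF g(3)]) (simp_all add: E3_simp eu_def)
  ultimately show ?thesis by (simp add: full_def)
qed

lemma compose:
  assumes X: "x \<in> X" "edge y z" and "full y z"
    and xy: "lie n H (\<lambda>i j. 2 * E x y i j - cm y x * E y y i j)"
  shows "lie n H (\<lambda>i j. 2 * E x z i j - cm z x * E z z i j)"
proof -
  let ?t = "tri x y z"
  interpret coeff_lie "\<lambda>K. lie n H (E3 ?t K)" "\<lambda>a b. cm (?t a) (?t b)"
    by (rule coeff_lie_E3) (use X in \<open>simp_all add: edge_def\<close>)
  have f: "lie n H (\<lambda>i j. 2 * E y z i j - cm z y * E y y i j)" "lie n H (\<lambda>i j. E y y i j - E z z i j)"
    using assms(3) by (auto simp: full_def)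
  note g = compose_step[OF lie_E3[OF xy] lie_E3[OF f(1)]]
  have "lie n H (\<lambda>i j. 2 * E x z i j - cm z x * E y y i j)"
    by (rule lie_cong[OF g]) (simp_all add: E3_simp eu_def)
  from lie_lin[OF this f(2), of 1 "cm z x"] show ?thesis
    by (rule lie_cong) (simp add: algebra_simps)
qed

text \<open>Symmetry is assumed for chords as well, since an asymmetric chord would leave a diagonal
  term in \<open>path_step\<close>. The range of \<open>k\<close> stops before the last vertex,
  which closes the asymmetric edge.\<close>

lemma path_lie:
  assumes cs: "distinct cs" "set cs \<subseteq> X" "\<And>i. Suc i < length cs \<Longrightarrow> edge (cs ! i) (cs ! Suc i)"
    and sym: "\<And>i j. i < length cs \<Longrightarrow> j < length cs \<Longrightarrow> {i, j} \<noteq> {0, length cs - 1} \<Longrightarrow>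
      cm (cs ! i) (cs ! j) = cm (cs ! j) (cs ! i)"
  shows "Suc k < length cs - 1 \<Longrightarrow>
    lie n H (\<lambda>i j. E (cs ! 0) (cs ! Suc k) i j - E (cs ! Suc k) (cs ! 0) i j)"
proof (induction k)
  case 0
  have e: "edge (cs ! 0) (cs ! Suc 0)" using cs(3)[of 0] 0 by simp
  have s: "cm (cs ! Suc 0) (cs ! 0) = cm (cs ! 0) (cs ! Suc 0)" using sym[of "Suc 0" 0] 0
    by (cases "cs = []") (auto simp: doubleton_eq_iff)
  show ?case
    by (rule lie_cong[OF lie_scale[OF lie_edge[OF e], of "1 / cm (cs ! 0) (cs ! Suc 0)"]])
      (use e in \<open>simp add: s edge_def field_simps\<close>)
next
  case (Suc k)
  let ?x = "cs ! 0" and ?y = "cs ! Suc k" and ?z = "cs ! Suc (Suc k)"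
  let ?t = "tri ?x ?y ?z"
  have X: "?x \<in> X" "?y \<in> X" "?z \<in> X" using Suc.prems cs(2) by (auto intro!: subsetD[OF cs(2)] nth_mem)
  interpret coeff_lie "\<lambda>K. lie n H (E3 ?t K)" "\<lambda>a b. cm (?t a) (?t b)"
    by (rule coeff_lie_E3) (use X in simp_all)
  have e: "edge ?y ?z" using cs(3)[of "Suc k"] Suc.prems by simp
  have s: "cm ?x ?y = cm ?y ?x" "cm ?y ?z = cm ?z ?y" "cm ?x ?z = cm ?z ?x"
    using sym[of 0 "Suc k"] sym[of "Suc k" "Suc (Suc k)"] sym[of 0 "Suc (Suc k)"] Suc.prems
    by (cases "cs = []"; auto simp: doubleton_eq_iff)+
  have z: "lie n H (\<lambda>i j. E ?y ?z i j - E ?z ?y i j)"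
    by (rule lie_cong[OF lie_scale[OF lie_edge[OF e], of "1 / cm ?y ?z"]])
      (use e in \<open>simp add: s edge_def field_simps\<close>)
  have xy: "lie n H (\<lambda>i j. E ?x ?y i j - E ?y ?x i j)" using Suc by simp
  note g = path_step[OF _ _ lie_E3[OF xy] lie_E3[OF z]]
  have "lie n H (\<lambda>i j. 2 * (E ?x ?z i j - E ?z ?x i j))"
    by (rule lie_cong[OF g]) (simp_all add: E3_simp eu_def s)
  from lie_scale[OF this, of "1 / 2"] show ?case by (rule lie_cong) simp
qed

text \<open>Vertices \<open>0\<close> and \<open>1\<close> of \<open>base_step\<close> are the ends
  of the path, and \<open>2\<close> is the vertex before the last one, reached from the first by
  \<open>path_lie\<close>. One more \<open>path_step\<close> produces the asymmetric element
  \<open>w\<close>.\<close>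

lemma cycle_full:
  assumes len: "length cs \<ge> 3"
    and cs: "distinct cs" "set cs \<subseteq> X" "\<And>i. Suc i < length cs \<Longrightarrow> edge (cs ! i) (cs ! Suc i)"
    and close: "edge (cs ! 0) (last cs)"
    and sym: "\<And>i j. i < length cs \<Longrightarrow> j < length cs \<Longrightarrow> {i, j} \<noteq> {0, length cs - 1} \<Longrightarrow>
      cm (cs ! i) (cs ! j) = cm (cs ! j) (cs ! i)"
    and asym: "cm (cs ! 0) (last cs) \<noteq> cm (last cs) (cs ! 0)"
  shows "\<exists>x y. edge x y \<and> full x y"
proof -
  define k where "k = length cs - 3"
  have k: "length cs = Suc (Suc (Suc k))" using len by (simp add: k_def)
  have "cs \<noteq> []" using len by auto
  then have lst: "last cs = cs ! Suc (Suc k)" by (simp add: last_conv_nth k)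
  let ?p = "cs ! 0" and ?q = "last cs" and ?j = "cs ! Suc k"
  have X: "?p \<in> X" "?q \<in> X" "?j \<in> X" using cs(2) close k by (auto simp: edge_def)
  have e: "edge ?j ?q" using cs(3)[of "Suc k"] k lst by simp
  have s: "cm ?p ?j = cm ?j ?p" "cm ?j ?q = cm ?q ?j"
    using sym[of 0 "Suc k"] sym[of "Suc k" "Suc (Suc k)"] k lst
    by (cases "cs = []"; auto simp: doubleton_eq_iff)+
  have pj: "lie n H (\<lambda>i j. E ?p ?j i j - E ?j ?p i j)" using path_lie[OF cs sym, of k] k by simp
  have jq: "lie n H (\<lambda>i j. E ?j ?q i j - E ?q ?j i j)"
    by (rule lie_cong[OF lie_scale[OF lie_edge[OF e], of "1 / cm ?j ?q"]])
      (use e in \<open>simp add: s edge_def field_simps\<close>)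
  have w: "lie n H (\<lambda>i j. 2 * (E ?p ?q i j - E ?q ?p i j) + (cm ?p ?q - cm ?q ?p) * E ?j ?j i j)"
  proof -
    let ?t = "tri ?p ?j ?q"
    interpret coeff_lie "\<lambda>K. lie n H (E3 ?t K)" "\<lambda>a b. cm (?t a) (?t b)"
      by (rule coeff_lie_E3) (use X in simp_all)
    note g = path_step[OF _ _ lie_E3[OF pj] lie_E3[OF jq]]
    show ?thesis by (rule lie_cong[OF g]) (simp_all add: E3_simp eu_def s)
  qed
  let ?t = "tri ?p ?q ?j"
  interpret coeff_lie "\<lambda>K. lie n H (E3 ?t K)" "\<lambda>a b. cm (?t a) (?t b)"
    by (rule coeff_lie_E3) (use X in simp_all)
  have ne: "cm (?t 0) (?t 2) = cm (?t 2) (?t 0)" "cm (?t 1) (?t 2) = cm (?t 2) (?t 1)"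
    "cm (?t 0) (?t 1) \<noteq> cm (?t 1) (?t 0)" "cm (?t 0) (?t 1) \<le> -3" "cm (?t 1) (?t 0) \<le> -3"
    "cm (?t 1) (?t 2) \<noteq> 0"
    using s asym edge_le[OF close] edge_le[OF edge_sym[OF close]] edge_sym[OF e] by (auto simp: edge_def)
  note g = base_step[OF ne lie_E3[OF pj] lie_E3[OF jq] lie_E3[OF lie_edge[OF close]] lie_E3[OF w]]
  have "lie n H (\<lambda>i j. 2 * E ?q ?j i j - cm ?j ?q * E ?j ?j i j)"
    by (rule lie_cong[OF g(1)]) (simp_all add: E3_simp eu_def)
  moreover have "lie n H (\<lambda>i j. 2 * E ?j ?q i j - cm ?q ?j * E ?j ?j i j)"
    by (rule lie_cong[OF g(2)]) (simp_all add: E3_simp eu_def)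
  moreover have "lie n H (\<lambda>i j. E ?q ?q i j - E ?j ?j i j)"
    by (rule lie_cong[OF g(3)]) (simp_all add: E3_simp eu_def)
  ultimately have "full ?j ?q" using lie_scale[of n H "\<lambda>i j. E ?q ?q i j - E ?j ?j i j" "-1"]
    by (simp add: full_def)
  then show ?thesis using e by blast
qed

theorem density:
  assumes base: "edge x0 y0" "full x0 y0"
    and conn: "\<And>x y. x \<in> X \<Longrightarrow> y \<in> X \<Longrightarrow> edge\<^sup>*\<^sup>* x y"
    and "finite X"
    and span_v: "\<And>u. \<exists>c. \<forall>i<n. u i = (\<Sum>x\<in>X. c x * v x i)"
    and span_\<alpha>: "\<And>u. \<exists>c. \<forall>i<n. u i = (\<Sum>x\<in>X. c x * \<alpha> x i)"
  shows "SLpm_R n \<subseteq> zclosure n H"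
proof -
  have x0: "x0 \<in> X" using base by (simp add: edge_def)
  have some: "\<exists>y. edge x y \<and> full x y" if "edge\<^sup>*\<^sup>* x0 x" for x
    using that
  proof (induction rule: rtranclp_induct)
    case base
    then show ?case using assms(1,2) by blast
  next
    case (step y z)
    then show ?case using full_grow full_sym edge_sym by blast
  qed
  have full: "full x y" if "edge x y" for x y
    using some[of x] conn[OF x0, of x] that full_grow by (auto simp: edge_def)
  have diag: "lie n H (\<lambda>i j. E x0 x0 i j - E x x i j)" if "edge\<^sup>*\<^sup>* x0 x" for x
    using that
  proof (induction rule: rtranclp_induct)
    case base
    then show ?case by (simp add: lie_zero)
  next
    case (step y z)
    have "lie n H (\<lambda>i j. E y y i j - E z z i j)" using full[OF step.hyps(2)] by (simp add: full_def)
    from lie_lin[OF step.IH this, of 1 1] show ?case by (rule lie_cong) simp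
  qed
  have pair: "lie n H (\<lambda>i j. 2 * E x y i j - cm y x * E y y i j)" if "x \<in> X" "edge\<^sup>*\<^sup>* x y" for x y
    using that(2)
  proof (induction rule: rtranclp_induct)
    case base
    then show ?case using pair_diag that by (simp add: lie_zero)
  next
    case (step y z)
    then show ?case using compose[OF that(1) step.hyps(2) full[OF step.hyps(2)]] by simp
  qed
  have gen: "lie n H (\<lambda>i j. 2 * E x y i j - cm y x * E x0 x0 i j)" if "x \<in> X" "y \<in> X" for x y
    by (rule lie_cong[OF lie_lin[OF pair[OF that(1) conn[OF that]] diag[OF conn[OF x0 that(2)]], of 1 "- cm y x"]])
      (simp add: algebra_simps)
  show ?thesis
  proof (rule zclosure_contains_SLpm[OF one_H])
    show "pairing n (\<alpha> x0) (\<lambda>i. - v x0 i) = -2"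
      using pair_diag[OF x0] by (simp add: pairing_def sum_negf)
    show "\<And>B. B \<in> H \<Longrightarrow> rmul n B (rk1 (\<lambda>i. - v x0 i) (\<alpha> x0)) \<in> H" using refl_H[OF x0] .
    fix u f assume p: "pairing n f u = 0"
    obtain c where c: "\<forall>i<n. u i = (\<Sum>x\<in>X. c x * v x i)" using span_v by blast
    obtain d where d: "\<forall>i<n. f i = (\<Sum>x\<in>X. d x * \<alpha> x i)" using span_\<alpha> by blast
    \<comment> \<open>After all diagonal terms are moved to the single vertex \<open>x0\<close>, the
      total coefficient of \<open>E x0 x0\<close> is a multiple of the trace of
      \<open>u \<otimes> f\<close>, which is 0.\<close>
    have tr: "(\<Sum>x\<in>X. \<Sum>y\<in>X. c x * d y * cm y x) = 0"
    proof -
      have "pairing n f u = (\<Sum>i<n. \<Sum>y\<in>X. \<Sum>x\<in>X. d y * \<alpha> y i * (c x * v x i))"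
        unfolding pairing_def using c d by (simp add: sum_product)
      also have "\<dots> = (\<Sum>y\<in>X. \<Sum>x\<in>X. \<Sum>i<n. d y * \<alpha> y i * (c x * v x i))"
        by (subst sum.swap, rule sum.cong[OF HOL.refl], subst sum.swap) simp
      also have "\<dots> = (\<Sum>y\<in>X. \<Sum>x\<in>X. c x * d y * cm y x)"
        by (simp add: pairing_def sum_distrib_left algebra_simps)
      also have "\<dots> = (\<Sum>x\<in>X. \<Sum>y\<in>X. c x * d y * cm y x)" by (rule sum.swap)
      finally show ?thesis using p by simp
    qed
    have "lie n H (\<lambda>i j. \<Sum>x\<in>X. \<Sum>y\<in>X. (c x * d y / 2) * (2 * E x y i j - cm y x * E x0 x0 i j))"
      using gen \<open>finite X\<close> by (intro lie_sum lie_scale) auto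
    then show "lie n H (\<lambda>i j. u i * f j)"
    proof (rule lie_cong)
      fix i j assume ij: "i < n" "j < n"
      have "(\<Sum>x\<in>X. \<Sum>y\<in>X. (c x * d y / 2) * (2 * E x y i j - cm y x * E x0 x0 i j)) =
        (\<Sum>x\<in>X. \<Sum>y\<in>X. c x * d y * E x y i j - c x * d y * cm y x * (E x0 x0 i j / 2))"
        by (rule sum.cong[OF HOL.refl], rule sum.cong[OF HOL.refl]) (simp add: right_diff_distrib)
      also have "\<dots> = (\<Sum>x\<in>X. \<Sum>y\<in>X. c x * d y * E x y i j) -
          (\<Sum>x\<in>X. \<Sum>y\<in>X. c x * d y * cm y x) * (E x0 x0 i j / 2)"
        by (simp only: sum_distrib_right sum_subtractf)
      also have "\<dots> = (\<Sum>x\<in>X. \<Sum>y\<in>X. (c x * v x i) * (d y * \<alpha> y j))"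
        unfolding tr by (simp add: E_def algebra_simps)
      also have "\<dots> = u i * f j" using c d ij by (simp add: sum_product)
      finally show "(\<Sum>x\<in>X. \<Sum>y\<in>X. (c x * d y / 2) * (2 * E x y i j - cm y x * E x0 x0 i j)) = u i * f j" .
    qed
  qed
qed

end

section \<open>Linear reflection representations of the subgroup\<close>

definition vec_coord :: "real vec \<Rightarrow> nat \<Rightarrow> real" where "vec_coord y = (\<lambda>i. y $ i)"

text \<open>The point \<open>z\<close>, where all forms are at most -1, is both the starting point
  for ping-pong and the centre of a ball inside the cone.\<close>

locale dihedral_rep = dihedral I m a b k for I :: "'i set" and m a b k +
  fixes n :: nat and al v :: "'i list set \<Rightarrow> nat \<Rightarrow> real" and z :: "nat \<Rightarrow> real"
  assumes al_Ints: "x \<in> X \<Longrightarrow> i < n \<Longrightarrow> al x i \<in> \<int>"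
    and v_Ints: "x \<in> X \<Longrightarrow> i < n \<Longrightarrow> v x i \<in> \<int>"
    and pair_diag: "x \<in> X \<Longrightarrow> pairing n (al x) (v x) = 2"
    and pair_zero: "x \<in> X \<Longrightarrow> y \<in> X \<Longrightarrow> x \<noteq> y \<Longrightarrow> B x y = 0 \<Longrightarrow> pairing n (al x) (v y) = 0"
    and pair_neg: "x \<in> X \<Longrightarrow> y \<in> X \<Longrightarrow> x \<noteq> y \<Longrightarrow> B x y \<noteq> 0 \<Longrightarrow> pairing n (al x) (v y) \<le> -3"
    and base_point: "x \<in> X \<Longrightarrow> pairing n (al x) z \<le> -1"
begin

definition R :: "'i list set \<Rightarrow> real mat" where
  "R x = (if x \<in> X then mat n n (\<lambda>(i, j). rk1 (\<lambda>i. - v x i) (al x) i j) else 1\<^sub>m n)"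

definition mw :: "'i list set list \<Rightarrow> real mat" where
  "mw w = foldr (\<lambda>x M. R x * M) w (1\<^sub>m n)"

text \<open>Independent of the chosen word: by \<open>wrd_inj\<close> two words for \<open>g\<close>
  agree in the abstract Coxeter group, and \<open>mw\<close> respects its relations.\<close>

definition rho :: "'i list set \<Rightarrow> real mat" where
  "rho g = mw (SOME w. set w \<subseteq> X \<and> g = cl (wrd w))"

definition A :: "'i list set \<Rightarrow> 'i list set \<Rightarrow> real" where
  "A x y = pairing n (al x) (v y)"

lemma R_carrier [simp]: "R x \<in> carrier_mat n n" by (simp add: R_def)

lemma mw_carrier [simp]: "mw w \<in> carrier_mat n n"
  by (induction w) (auto simp: mw_def intro: mult_carrier_mat[OF R_carrier])

lemma mw_simps: "mw [] = 1\<^sub>m n" "mw (x # w) = R x * mw w" by (simp_all add: mw_def)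

lemma mw_append: "mw (u @ w) = mw u * mw w"
  by (induction u) (simp_all add: mw_simps assoc_mult_mat[OF R_carrier mw_carrier mw_carrier]
      left_mult_one_mat[OF mw_carrier])

lemma mw_single: "mw [x] = R x" by (simp add: mw_simps right_mult_one_mat[OF R_carrier])

lemma R_mult_entry:
  assumes "x \<in> X" "y \<in> X" "i < n" "j < n"
  shows "(R x * R y) $$ (i, j) = (if i = j then 1 else 0) - v x i * al x j - v y i * al y j
    + A x y * v x i * al y j"
proof -
  have "(R x * R y) $$ (i, j) = rmul n (R x) (rk1 (\<lambda>i. - v y i) (al y)) $$ (i, j)"
    using assms by (simp add: R_def[of y] rmul_mult)
  also have "\<dots> = R x $$ (i, j) + (\<Sum>l<n. R x $$ (i, l) * - v y l) * al y j"
    using assms by (intro rmul_rk1_entry)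
  also have "(\<Sum>l<n. R x $$ (i, l) * - v y l) = (\<Sum>l<n. (if l = i then - v y i else 0) + v x i * (al x l * v y l))"
    using assms by (intro sum.cong) (auto simp: R_def rk1_def algebra_simps)
  also have "\<dots> = - v y i + v x i * A x y"
    using assms by (simp add: sum.distrib A_def pairing_def sum_distrib_left)
  finally show ?thesis using assms by (simp add: R_def rk1_def algebra_simps)
qed

lemma square_mat_eqI:
  "M \<in> carrier_mat n n \<Longrightarrow> N \<in> carrier_mat n n \<Longrightarrow>
    (\<And>i j. i < n \<Longrightarrow> j < n \<Longrightarrow> M $$ (i, j) = N $$ (i, j)) \<Longrightarrow> M = N"
  by (rule eq_matI) auto

lemma R_mult_carrier: "R x * R y \<in> carrier_mat n n" by (rule mult_carrier_mat[OF R_carrier R_carrier])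

lemma R_involution: "R x * R x = 1\<^sub>m n"
proof (cases "x \<in> X")
  case True
  have "A x x = 2" using pair_diag[OF True] by (simp add: A_def)
  then show ?thesis
    by (intro square_mat_eqI R_mult_carrier one_carrier_mat, subst R_mult_entry[OF True True]) simp_all
qed (simp add: R_def)

lemma R_commute:
  assumes "x \<in> X" "y \<in> X" "x \<noteq> y" "B x y = 0" shows "R x * R y = R y * R x"
proof -
  have "A x y = 0" "A y x = 0" using pair_zero[of x y] pair_zero[of y x] assms B_sym[of x y] by (auto simp: A_def)
  then show ?thesis
    by (intro square_mat_eqI R_mult_carrier, subst R_mult_entry[OF assms(1,2)], simp, simp,
        subst R_mult_entry[OF assms(2,1)]) simp_all
qed

lemma mw_cong: "cox_eq X mB u w \<Longrightarrow> mw u = mw w"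
proof (induction rule: cox_eq.induct)
  case (ctx v w a b)
  then show ?case by (simp add: mw_append)
next
  case (rel s t j)
  show ?case
  proof (cases "s = t")
    case True
    then have "j = 1" using rel by (simp add: mB_def one_enat_def)
    then show ?thesis using True R_involution by (simp add: mw_simps right_mult_one_mat[OF R_carrier])
  next
    case False
    then have st: "B s t = 0" "j = 2" using rel by (auto simp: mB_def numeral_eq_enat split: if_splits)
    have "R t * (R s * R t) = R t * R s * R t" by (simp only: assoc_mult_mat[OF R_carrier R_carrier R_carrier])
    also have "\<dots> = R s * R t * R t" by (simp only: R_commute[OF rel(1,2) False st(1)])
    also have "\<dots> = R s * (R t * R t)" by (simp only: assoc_mult_mat[OF R_carrier R_carrier R_carrier])
    finally have "R t * (R s * R t) = R s * (R t * R t)" .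
    then have "R s * (R t * (R s * R t)) = R s * (R s * (R t * R t))" by simp
    also have "\<dots> = 1\<^sub>m n" by (simp add: R_involution right_mult_one_mat[OF R_carrier])
    finally show ?thesis by (simp add: st(2) numeral_2_eq_2 mw_simps right_mult_one_mat[OF R_carrier])
  qed
qed auto

lemma R_vec:
  assumes "x \<in> X" "y \<in> carrier_vec n"
  shows "R x *\<^sub>v y = y - (vec n (al x) \<bullet> y) \<cdot>\<^sub>v vec n (v x)"
proof (rule eq_vecI)
  fix i assume "i < dim_vec (y - (vec n (al x) \<bullet> y) \<cdot>\<^sub>v vec n (v x))"
  then have i: "i < n" using assms by simp
  have "(R x *\<^sub>v y) $ i = (\<Sum>l<n. R x $$ (i, l) * y $ l)"
    using i assms carrier_matD[OF R_carrier[of x]] by (simp add: scalar_prod_def lessThan_atLeast0)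
  also have "\<dots> = (\<Sum>l<n. (if l = i then y $ i else 0) - v x i * (al x l * y $ l))"
    using i assms by (intro sum.cong) (auto simp: R_def rk1_def algebra_simps)
  also have "\<dots> = y $ i - v x i * (\<Sum>l<n. al x l * y $ l)"
    using i by (simp add: sum_subtractf sum_distrib_left)
  finally show "(R x *\<^sub>v y) $ i = (y - (vec n (al x) \<bullet> y) \<cdot>\<^sub>v vec n (v x)) $ i"
    using i assms by (simp add: scalar_prod_def lessThan_atLeast0)
qed (use assms carrier_matD[OF R_carrier[of x]] in simp_all)

lemma mw_vec:
  assumes "y \<in> carrier_vec n"
  shows "set w \<subseteq> X \<Longrightarrow> vec n (al x) \<bullet> (mw w *\<^sub>v y) = act A w (\<lambda>x. vec n (al x) \<bullet> y) x"
proof (induction w arbitrary: x)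
  case Nil
  then show ?case using assms by (simp add: mw_simps)
next
  case (Cons r w)
  have c: "mw w *\<^sub>v y \<in> carrier_vec n" using assms by (intro mult_mat_vec_carrier[OF mw_carrier])
  have "mw (r # w) *\<^sub>v y = R r *\<^sub>v (mw w *\<^sub>v y)"
    using assms by (simp add: mw_simps assoc_mult_mat_vec[OF R_carrier mw_carrier])
  also have "\<dots> = mw w *\<^sub>v y - (vec n (al r) \<bullet> (mw w *\<^sub>v y)) \<cdot>\<^sub>v vec n (v r)"
    using Cons.prems c by (intro R_vec) auto
  finally have "vec n (al x) \<bullet> (mw (r # w) *\<^sub>v y) =
    vec n (al x) \<bullet> (mw w *\<^sub>v y) - (vec n (al r) \<bullet> (mw w *\<^sub>v y)) * (vec n (al x) \<bullet> vec n (v r))"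
    using c by (simp add: scalar_prod_minus_distrib[where n = n])
  moreover have "vec n (al x) \<bullet> vec n (v r) = A x r"
    by (simp add: A_def pairing_def scalar_prod_def lessThan_atLeast0)
  ultimately show ?case using Cons by (simp add: step_def mult.commute)
qed

lemma compat_A: "XR.compat A"
  unfolding A_def using pair_diag pair_zero pair_neg by (intro compat_mB) auto

lemma mw_inj:
  assumes "set u \<subseteq> X" "set w \<subseteq> X" "mw u = mw w"
  shows "cox_eq X mB u w"
proof -
  let ?z = "vec n z"
  let ?h = "\<lambda>x. vec n (al x) \<bullet> ?z"
  have h: "?h x \<le> -1" if "x \<in> X" for x
    using base_point[OF that] by (simp add: pairing_def scalar_prod_def lessThan_atLeast0)
  have "mw (rev w @ u) = mw (rev w @ w)" using assms(3) by (simp add: mw_append)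
  also have "\<dots> = 1\<^sub>m n" using mw_cong[OF XR.rev_cancel_left[OF assms(2)]] by (simp add: mw_simps)
  finally have "act A (rev w @ u) ?h x = ?h x" for x
    using mw_vec[of ?z "rev w @ u" x] assms by simp
  then have "cox_eq X mB (rev w @ u) []"
    using h assms by (intro XR.act_faithful[OF compat_A, of ?h]) force+
  then show ?thesis by (rule XR.cancel_prefix[OF assms(2)])
qed

lemma rho_cl: "set w \<subseteq> X \<Longrightarrow> rho (cl (wrd w)) = mw w"
proof -
  assume w: "set w \<subseteq> X"
  have "\<exists>u. set u \<subseteq> X \<and> cl (wrd w) = cl (wrd u)" using w by blast
  from someI_ex[OF this] show ?thesis
    unfolding rho_def using w by (intro mw_cong wrd_inj) auto
qed

lemma rho_X: "x \<in> X \<Longrightarrow> rho x = R x"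
  using rho_cl[of "[x]"] by (simp add: cl_wd mw_single)

lemma rho_image: "rho ` \<Gamma> = {mw w | w. set w \<subseteq> X}"
  using gamma_iff rho_cl by (auto simp: image_iff) metis+

lemma matrix_rep_rho: "matrix_rep n G \<Gamma> rho"
  unfolding matrix_rep_def
proof (intro conjI ballI)
  show "rho \<one>\<^bsub>G\<^esub> = 1\<^sub>m n" using rho_cl[of "[]"] by (simp add: one_cl mw_simps)
  fix g assume "g \<in> \<Gamma>"
  then obtain u where u: "set u \<subseteq> X" "g = cl (wrd u)" using gamma_iff by blast
  then show "rho g \<in> carrier_mat n n" by (simp add: rho_cl)
  fix h assume "h \<in> \<Gamma>"
  then obtain w where w: "set w \<subseteq> X" "h = cl (wrd w)" using gamma_iff by blast
  have gh: "g \<otimes>\<^bsub>G\<^esub> h = cl (wrd (u @ w))" using u w by (simp add: mult_cl)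
  have "rho (g \<otimes>\<^bsub>G\<^esub> h) = mw (u @ w)" unfolding gh by (rule rho_cl) (use u w in simp)
  then show "rho (g \<otimes>\<^bsub>G\<^esub> h) = rho g * rho h" using u w by (simp add: rho_cl mw_append)
qed

lemma inj_rho: "inj_on rho \<Gamma>"
proof (rule inj_onI)
  fix g h assume gh: "g \<in> \<Gamma>" "h \<in> \<Gamma>" "rho g = rho h"
  obtain u where u: "set u \<subseteq> X" "g = cl (wrd u)" using gh(1) gamma_iff by blast
  obtain w where w: "set w \<subseteq> X" "h = cl (wrd w)" using gh(2) gamma_iff by blast
  have "cox_eq X mB u w" using gh(3) u w by (intro mw_inj) (simp_all add: rho_cl)
  then show "g = h" using cl_eqI[OF wrd_cong] u w by simp
qed

lemma R_Ints: "i < n \<Longrightarrow> j < n \<Longrightarrow> R x $$ (i, j) \<in> \<int>"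
  using al_Ints v_Ints by (auto simp: R_def rk1_def)

lemma mw_Ints: "i < n \<Longrightarrow> j < n \<Longrightarrow> mw w $$ (i, j) \<in> \<int>"
proof (induction w arbitrary: i j)
  case (Cons x w)
  have "mw (x # w) $$ (i, j) = (\<Sum>l<n. R x $$ (i, l) * mw w $$ (l, j))"
    using Cons.prems carrier_matD[OF R_carrier[of x]] carrier_matD[OF mw_carrier[of w]]
    by (simp add: mw_simps scalar_prod_def lessThan_atLeast0)
  then show ?case using Cons by (auto intro!: Ints_sum Ints_mult R_Ints)
qed (simp add: mw_simps)

lemma det_R: "det (R x) = 1 \<or> det (R x) = -1"
  using det_rk1[of n "\<lambda>i. - v x i" "al x"] pair_diag[of x]
  by (simp add: R_def pairing_def sum_negf)

lemma det_mw: "det (mw w) = 1 \<or> det (mw w) = -1"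
proof (induction w)
  case (Cons x w)
  then show ?case using det_R[of x] det_mult[OF R_carrier mw_carrier, of x w] by (auto simp: mw_simps)
qed (simp add: mw_simps)

lemma rho_SLpm_Z: "rho ` \<Gamma> \<subseteq> SLpm_Z n"
  unfolding rho_image using det_mw mw_Ints by (auto simp: SLpm_Z_def SLpm_R_def)

lemma cone_interior:
  "\<exists>x\<in>carrier_vec n. \<exists>\<epsilon>>0. \<forall>y\<in>carrier_vec n.
      (\<Sum>i<n. (y $ i - x $ i)\<^sup>2) < \<epsilon>\<^sup>2 \<longrightarrow> (\<forall>s\<in>X. vec n (al s) \<bullet> y \<le> 0)"
proof -
  \<comment> \<open>\<open>C\<close> bounds the sum of the absolute coefficients of each form, so
    within distance \<open>1 / C\<close> of \<open>z\<close> a form changes by at most 1, the margin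
    in \<open>base_point\<close>.\<close>
  define C where "C = (\<Sum>s\<in>X. \<Sum>i<n. \<bar>al s i\<bar>) + 1"
  have C: "C > 0" by (simp add: C_def add_nonneg_pos sum_nonneg)
  show ?thesis
  proof (intro bexI[of _ "vec n z"] exI[of _ "1 / C"] conjI ballI impI)
    fix y :: "real vec" and s assume y: "y \<in> carrier_vec n"
      and close: "(\<Sum>i<n. (y $ i - vec n z $ i)\<^sup>2) < (1 / C)\<^sup>2" and s: "s \<in> X"
    have d: "\<bar>y $ i - z i\<bar> \<le> 1 / C" if "i < n" for i
    proof -
      have "(y $ i - z i)\<^sup>2 \<le> (\<Sum>i<n. (y $ i - vec n z $ i)\<^sup>2)"
        using that member_le_sum[of i "{..<n}" "\<lambda>i. (y $ i - vec n z $ i)\<^sup>2"] by simp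
      then have "(y $ i - z i)\<^sup>2 \<le> (1 / C)\<^sup>2" using close by simp
      then have "\<bar>y $ i - z i\<bar> \<le> \<bar>1 / C\<bar>" by (rule abs_le_square_iff[THEN iffD2])
      then show ?thesis using C by simp
    qed
    have "vec n (al s) \<bullet> y = (\<Sum>i<n. al s i * z i) + (\<Sum>i<n. al s i * (y $ i - z i))"
      using y by (simp add: scalar_prod_def lessThan_atLeast0 right_diff_distrib sum_subtractf)
    also have "(\<Sum>i<n. al s i * (y $ i - z i)) \<le> (\<Sum>i<n. \<bar>al s i\<bar> * (1 / C))"
    proof (rule sum_mono)
      fix i assume "i \<in> {..<n}"
      then have "\<bar>al s i * (y $ i - z i)\<bar> \<le> \<bar>al s i\<bar> * (1 / C)"
        unfolding abs_mult using d by (intro mult_left_mono) auto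
      then show "al s i * (y $ i - z i) \<le> \<bar>al s i\<bar> * (1 / C)" by simp
    qed
    also have "\<dots> = (\<Sum>i<n. \<bar>al s i\<bar>) / C" by (simp add: sum_divide_distrib)
    also have "(\<Sum>i<n. \<bar>al s i\<bar>) \<le> C"
      using member_le_sum[OF s _ finite_X, of "\<lambda>s. \<Sum>i<n. \<bar>al s i\<bar>"] by (simp add: C_def sum_nonneg)
    then have "(\<Sum>i<n. \<bar>al s i\<bar>) / C \<le> 1" using C by simp
    finally show "vec n (al s) \<bullet> y \<le> 0" using base_point[OF s] by (simp add: pairing_def)
  qed (use C in auto)
qed

lemma reflection_rep_rho: "reflection_rep n G \<Gamma> X (sub_coxeter_matrix I m) rho"
proof -
  have refl: "\<forall>s\<in>X. vec n (al s) \<in> carrier_vec n \<and> vec n (v s) \<in> carrier_vec n \<and>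
      vec n (al s) \<bullet> vec n (v s) = 2 \<and>
      (\<forall>x\<in>carrier_vec n. rho s *\<^sub>v x = x - (vec n (al s) \<bullet> x) \<cdot>\<^sub>v vec n (v s))"
    using R_vec rho_X pair_diag by (simp add: pairing_def scalar_prod_def lessThan_atLeast0)
  have eq: "vec n (al s) \<bullet> vec n (v t) = pairing n (al s) (v t)" for s t
    by (simp add: pairing_def scalar_prod_def lessThan_atLeast0)
  have cartan: "cartan_compatible X (sub_coxeter_matrix I m) (\<lambda>s t. vec n (al s) \<bullet> vec n (v t))"
    unfolding cartan_compatible_def eq
  proof (intro conjI ballI impI)
    show "pairing n (al s) (v s) = 2" if "s \<in> X" for s using pair_diag[OF that] .
    fix s t assume st: "s \<in> X" "t \<in> X" "s \<noteq> t"
    note p = pair_zero[of s t] pair_zero[of t s] pair_neg[of s t] pair_neg[of t s] st B_sym[of s t]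
    have mst: "sub_coxeter_matrix I m s t = (if B s t = 0 then 2 else \<infinity>)"
      using sub_coxeter_matrix_X[OF st(1,2)] st(3) by (simp add: mB_def)
    show "pairing n (al s) (v t) \<le> 0" using p by (cases "B s t = 0") auto
    show "(pairing n (al s) (v t) = 0) = (pairing n (al t) (v s) = 0)" using p by (cases "B s t = 0") auto
    show "(sub_coxeter_matrix I m s t = 2) = (pairing n (al s) (v t) = 0)"
      using p mst by (cases "B s t = 0") auto
    show "\<forall>k. sub_coxeter_matrix I m s t = enat k \<longrightarrow>
        pairing n (al s) (v t) * pairing n (al t) (v s) = 4 * (cos (pi / real k))\<^sup>2"
      using p mst by (cases "B s t = 0") (auto simp: numeral_eq_enat)
    assume "sub_coxeter_matrix I m s t = \<infinity>"
    then have "B s t \<noteq> 0" using mst by (auto split: if_splits)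
    then show "4 \<le> pairing n (al s) (v t) * pairing n (al t) (v s)"
      using p mult_mono[of 3 "- pairing n (al s) (v t)" 3 "- pairing n (al t) (v s)"] by simp
  qed
  show ?thesis
    unfolding reflection_rep_def
    by (rule conjI[OF matrix_rep_rho], rule exI[of _ "\<lambda>x. vec n (al x)"], rule exI[of _ "\<lambda>x. vec n (v x)"],
        intro conjI refl cartan cone_interior)
qed

text \<open>Reflections from a connected spanning subset \<open>X'\<close> already give density, so
  the remaining generators need not be listed.\<close>

theorem good_rep_rho:
  assumes X': "X' \<subseteq> X"
    and conn: "\<And>x y. x \<in> X' \<Longrightarrow> y \<in> X' \<Longrightarrow> (\<lambda>x y. x \<in> X' \<and> y \<in> X' \<and> x \<noteq> y \<and> B x y \<noteq> 0)\<^sup>*\<^sup>* x y"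
    and span_v: "\<And>u. \<exists>c. \<forall>i<n. u i = (\<Sum>x\<in>X'. c x * v x i)"
    and span_al: "\<And>u. \<exists>c. \<forall>i<n. u i = (\<Sum>x\<in>X'. c x * al x i)"
    and cs: "length cs \<ge> 3" "distinct cs" "set cs \<subseteq> X'" "\<And>i. Suc i < length cs \<Longrightarrow> B (cs ! i) (cs ! Suc i) \<noteq> 0"
    and close: "B (cs ! 0) (last cs) \<noteq> 0"
    and sym: "\<And>i j. i < length cs \<Longrightarrow> j < length cs \<Longrightarrow> {i, j} \<noteq> {0, length cs - 1} \<Longrightarrow>
      A (cs ! i) (cs ! j) = A (cs ! j) (cs ! i)"
    and asym: "A (cs ! 0) (last cs) \<noteq> A (last cs) (cs ! 0)"
  shows "good_rep I m n \<Gamma> rho"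
proof -
  have off: "(A x y = 0 \<and> A y x = 0 \<and> B x y = 0) \<or> (A x y \<le> -3 \<and> A y x \<le> -3 \<and> B x y \<noteq> 0)"
    if "x \<in> X" "y \<in> X" "x \<noteq> y" for x y
    using that pair_zero[of x y] pair_zero[of y x] pair_neg[of x y] pair_neg[of y x] B_sym[of x y]
    by (auto simp: A_def)
  have H: "rmul n M (rk1 (\<lambda>i. - v x i) (al x)) \<in> rho ` \<Gamma>" if x: "x \<in> X'" and M: "M \<in> rho ` \<Gamma>" for x M
  proof -
    obtain w where w: "set w \<subseteq> X" "M = mw w" using M unfolding rho_image by blast
    have "rmul n M (rk1 (\<lambda>i. - v x i) (al x)) = mw w * R x"
      using x X' w by (simp add: R_def subset_iff rmul_mult)
    also have "\<dots> = mw (w @ [x])" by (simp add: mw_append mw_single)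
    finally show ?thesis unfolding rho_image using w x X' by (intro CollectI exI[of _ "w @ [x]"]) auto
  qed
  interpret RO: rank_one_refl n al v X' "rho ` \<Gamma>"
  proof
    show "\<And>x. x \<in> X' \<Longrightarrow> pairing n (al x) (v x) = 2" using pair_diag X' by blast
    show "\<And>x y. x \<in> X' \<Longrightarrow> y \<in> X' \<Longrightarrow> x \<noteq> y \<Longrightarrow>
        pairing n (al x) (v y) = 0 \<and> pairing n (al y) (v x) = 0 \<or>
        pairing n (al x) (v y) \<le> - 3 \<and> pairing n (al y) (v x) \<le> - 3"
      using off X' by (auto simp: A_def subset_iff)
    show "1\<^sub>m n \<in> rho ` \<Gamma>" unfolding rho_image by (intro CollectI exI[of _ "[]"]) (simp add: mw_simps)
    show "rho ` \<Gamma> \<subseteq> carrier_mat n n" unfolding rho_image by auto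
  qed (rule H)
  have edge: "RO.edge x y \<longleftrightarrow> x \<in> X' \<and> y \<in> X' \<and> x \<noteq> y \<and> B x y \<noteq> 0" for x y
  proof (cases "x \<in> X' \<and> y \<in> X' \<and> x \<noteq> y")
    case True
    then show ?thesis using off[of x y] X' by (auto simp: RO.edge_def A_def subset_iff)
  qed (auto simp: RO.edge_def)
  have ne: "cs ! i \<noteq> cs ! j" if "i < length cs" "j < length cs" "i \<noteq> j" for i j
    using cs(2) that nth_eq_iff_index_eq by blast
  have lst: "last cs = cs ! (length cs - 1)" using cs(1) by (cases cs) (auto simp: last_conv_nth)
  have in': "cs ! i \<in> X'" if "i < length cs" for i using cs(3) that by auto
  have "\<exists>x y. RO.edge x y \<and> RO.full x y"
  proof (rule RO.cycle_full[OF cs(1-3)])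
    show "RO.edge (cs ! i) (cs ! Suc i)" if "Suc i < length cs" for i
      unfolding edge using that cs(4)[OF that] ne[of i "Suc i"] in'[of i] in'[of "Suc i"] by simp
    show "RO.edge (cs ! 0) (last cs)"
      unfolding edge using close cs(1) ne[of 0 "length cs - 1"] in'[of 0] in'[of "length cs - 1"]
      by (cases "cs = []") (simp_all add: lst)
    show "pairing n (al (cs ! 0)) (v (last cs)) \<noteq> pairing n (al (last cs)) (v (cs ! 0))"
      using asym by (simp add: A_def)
    show "pairing n (al (cs ! i)) (v (cs ! j)) = pairing n (al (cs ! j)) (v (cs ! i))"
      if "i < length cs" "j < length cs" "{i, j} \<noteq> {0, length cs - 1}" for i j
      using sym[OF that] by (simp add: A_def)
  qed
  then obtain x0 y0 where "RO.edge x0 y0" "RO.full x0 y0" by blast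
  moreover have "RO.edge\<^sup>*\<^sup>* x y" if "x \<in> X'" "y \<in> X'" for x y
  proof -
    have "RO.edge = (\<lambda>x y. x \<in> X' \<and> y \<in> X' \<and> x \<noteq> y \<and> B x y \<noteq> 0)" using edge by blast
    then show ?thesis using conn[OF that] by simp
  qed
  ultimately have dense: "SLpm_R n \<subseteq> zclosure n (rho ` \<Gamma>)"
    using finite_subset[OF X' finite_X] span_v span_al by (intro RO.density) auto
  have "zariski_dense_in n (rho ` \<Gamma>) (SLpm_R n)"
    unfolding zariski_dense_in_def
  proof (intro conjI ballI impI)
    show "rho ` \<Gamma> \<subseteq> SLpm_R n" using rho_SLpm_Z by (auto simp: SLpm_Z_def)
    fix p M assume "p \<in> poly_fun n" "\<forall>M\<in>rho ` \<Gamma>. p M = 0" "M \<in> SLpm_R n"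
    then show "p M = 0" using dense by (auto simp: zclosure_def)
  qed
  then show ?thesis
    unfolding good_rep_def canonical_gens_gamma
    using reflection_rep_rho inj_rho rho_SLpm_Z by simp
qed

end

section \<open>Spanning families and graphs\<close>

definition inspan :: "nat \<Rightarrow> 'x set \<Rightarrow> ('x \<Rightarrow> nat \<Rightarrow> real) \<Rightarrow> (nat \<Rightarrow> real) \<Rightarrow> bool" where
  "inspan n X v u \<longleftrightarrow> (\<exists>c. \<forall>i<n. u i = (\<Sum>x\<in>X. c x * v x i))"

lemma inspan_cong: "inspan n X v u \<Longrightarrow> (\<And>i. i < n \<Longrightarrow> u i = w i) \<Longrightarrow> inspan n X v w"
  unfolding inspan_def by (metis (no_types))

lemma inspan_gen: "finite X \<Longrightarrow> x \<in> X \<Longrightarrow> inspan n X v (v x)"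
  unfolding inspan_def
  by (rule exI[of _ "\<lambda>y. if y = x then 1 else 0"]) (simp add: if_distrib[of "\<lambda>a. a * _"] cong: if_cong)

lemma inspan_lin:
  assumes "inspan n X v u" "inspan n X v w"
  shows "inspan n X v (\<lambda>i. r * u i + s * w i)"
proof -
  obtain c d where "\<forall>i<n. u i = (\<Sum>x\<in>X. c x * v x i)" "\<forall>i<n. w i = (\<Sum>x\<in>X. d x * v x i)"
    using assms unfolding inspan_def by blast
  then show ?thesis unfolding inspan_def
    by (intro exI[of _ "\<lambda>x. r * c x + s * d x"]) (simp add: sum_distrib_left sum.distrib algebra_simps)
qed

lemma inspan_zero: "inspan n X v (\<lambda>i. 0)"
  unfolding inspan_def by (rule exI[of _ "\<lambda>_. 0"]) simp

lemma inspan_sum: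
  "finite T \<Longrightarrow> (\<And>t. t \<in> T \<Longrightarrow> inspan n X v (f t)) \<Longrightarrow> inspan n X v (\<lambda>i. \<Sum>t\<in>T. c t * f t i)"
proof (induction rule: finite_induct)
  case (insert t T)
  then show ?case using inspan_lin[of n X v "f t" "\<lambda>i. \<Sum>t\<in>T. c t * f t i" "c t" 1] by simp
qed (simp add: inspan_zero)

lemma inspan_basis:
  assumes "\<And>l. l < n \<Longrightarrow> inspan n X v (\<lambda>i. if i = l then 1 else 0)"
  shows "inspan n X v u"
proof -
  have "inspan n X v (\<lambda>i. \<Sum>l<n. u l * (if i = l then 1 else 0))" using assms by (intro inspan_sum) auto
  then show ?thesis by (rule inspan_cong) (simp add: if_distrib cong: if_cong)
qed

text \<open>Modulo 3 the matrix is twice the identity, so its determinant is \<open>2 ^ n\<close>, a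
  unit. The type \<open>3\<close> is the ring of integers modulo 3.\<close>

lemma mod3_solvable:
  fixes M :: "nat \<Rightarrow> nat \<Rightarrow> int"
  assumes diag: "\<And>i. i < n \<Longrightarrow> M i i = 2" and off: "\<And>i j. i < n \<Longrightarrow> j < n \<Longrightarrow> i \<noteq> j \<Longrightarrow> 3 dvd M i j"
  shows "\<exists>c. \<forall>i<n. u i = (\<Sum>j<n. real_of_int (M i j) * c j)"
proof -
  let ?M = "mat n n (\<lambda>(i, j). M i j)"
  have zero: "(of_int x :: 3) = 0" if "3 dvd x" for x
  proof -
    obtain y where "x = 3 * y" using \<open>3 dvd x\<close> by (elim dvdE)
    moreover have "(3 :: 3) = 0" by simp
    ultimately show ?thesis by (metis mult_zero_left of_int_mult of_int_numeral)
  qed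
  have "map_mat of_int ?M = 2 \<cdot>\<^sub>m (1\<^sub>m n :: 3 mat)"
    using diag off zero by (intro eq_matI) auto
  then have "of_int (det ?M) = (2::3) ^ n"
    by (metis of_int_hom.hom_det det_smult det_one mult.right_neutral index_one_mat(3))
  moreover have "(2::3) ^ n * 2 ^ n = 1"
  proof -
    have t: "(2::3) * 2 = 1" by simp
    show ?thesis by (simp only: t power_one flip: power_mult_distrib)
  qed
  ultimately have "det ?M \<noteq> 0" by (metis mult_zero_left of_int_0 zero_neq_one)
  then have "det (map_mat real_of_int ?M) \<noteq> 0" by (simp add: of_int_hom.hom_det)
  then have "map_mat real_of_int ?M \<in> Units (ring_mat TYPE(real) n ())"
    by (intro det_non_zero_imp_unit) auto
  then obtain D where D: "D \<in> carrier_mat n n" "map_mat real_of_int ?M * D = 1\<^sub>m n"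
    by (auto simp: Units_def ring_mat_def)
  have MD: "(\<Sum>j<n. real_of_int (M i j) * D $$ (j, l)) = (if i = l then 1 else 0)" if "i < n" "l < n" for i l
    using arg_cong[OF D(2), of "\<lambda>M. M $$ (i, l)"] that D(1)
    by (simp add: scalar_prod_def lessThan_atLeast0)
  have "u i = (\<Sum>j<n. real_of_int (M i j) * (\<Sum>l<n. D $$ (j, l) * u l))" if "i < n" for i
  proof -
    have "(\<Sum>j<n. real_of_int (M i j) * (\<Sum>l<n. D $$ (j, l) * u l)) =
      (\<Sum>l<n. (\<Sum>j<n. real_of_int (M i j) * D $$ (j, l)) * u l)"
      unfolding sum_distrib_left sum_distrib_right by (subst sum.swap) (simp add: mult.assoc)
    also have "\<dots> = (\<Sum>l<n. (if i = l then 1 else 0) * u l)" using that by (simp add: MD)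
    also have "\<dots> = u i" using that by (simp add: if_distrib[of "\<lambda>a. a * _"] cong: if_cong)
    finally show ?thesis by simp
  qed
  then show ?thesis by (intro exI[of _ "\<lambda>j. \<Sum>l<n. D $$ (j, l) * u l"]) simp
qed

lemma boundary_edge:
  "r\<^sup>*\<^sup>* x y \<Longrightarrow> x \<notin> Q \<Longrightarrow> y \<in> Q \<Longrightarrow> \<exists>u w. r u w \<and> u \<notin> Q \<and> w \<in> Q"
  by (induction rule: converse_rtranclp_induct) blast+

text \<open>Cut the path just before its first visit to \<open>a\<close>.\<close>

lemma path_avoiding:
  "r\<^sup>*\<^sup>* x a \<Longrightarrow> x \<noteq> a \<Longrightarrow> \<exists>c. r c a \<and> c \<noteq> a \<and> (\<lambda>x y. r x y \<and> x \<noteq> a \<and> y \<noteq> a)\<^sup>*\<^sup>* x c"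
proof (induction rule: converse_rtranclp_induct)
  case (step x y)
  show ?case
  proof (cases "y = a")
    case True
    then show ?thesis using step by blast
  next
    case False
    then obtain c where c: "r c a" "c \<noteq> a" "(\<lambda>x y. r x y \<and> x \<noteq> a \<and> y \<noteq> a)\<^sup>*\<^sup>* y c" using step by blast
    have "(\<lambda>x y. r x y \<and> x \<noteq> a \<and> y \<noteq> a)\<^sup>*\<^sup>* x c"
      by (rule converse_rtranclp_into_rtranclp[OF _ c(3)]) (use step False in auto)
    then show ?thesis using c by blast
  qed
qed simp

text \<open>The first vertex of a longest path has all its neighbours on that path.\<close>
lemma leaf_exists:
  assumes fin: "finite S" and ne: "S \<noteq> {}"
    and r: "\<And>x y. r x y \<Longrightarrow> x \<in> S \<and> y \<in> S \<and> x \<noteq> y \<and> r y x"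
    and acyclic: "\<not> (\<exists>vs. length vs \<ge> 3 \<and> distinct vs \<and> set vs \<subseteq> S \<and>
      (\<forall>i<length vs. r (vs ! i) (vs ! ((i + 1) mod length vs))))"
  shows "\<exists>x\<in>S. \<forall>y z. r x y \<longrightarrow> r x z \<longrightarrow> y = z"
proof (rule ccontr)
  assume "\<not> ?thesis"
  then have two: "\<exists>y z. r x y \<and> r x z \<and> y \<noteq> z" if "x \<in> S" for x using that by blast
  define P where "P = (\<lambda>p. p \<noteq> [] \<and> distinct p \<and> set p \<subseteq> S \<and> (\<forall>i. Suc i < length p \<longrightarrow> r (p ! i) (p ! Suc i)))"
  obtain x where "x \<in> S" using ne by blast
  then have "P [x]" by (simp add: P_def)
  moreover have "\<forall>p. P p \<longrightarrow> length p < Suc (card S)"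
    using fin by (auto simp: P_def less_Suc_eq_le card_mono simp flip: distinct_card)
  ultimately obtain p where p: "P p" and max: "\<forall>q. P q \<longrightarrow> length q \<le> length p"
    using ex_has_greatest_nat[of P "[x]" length "Suc (card S)"] by auto
  have p0: "p ! 0 \<in> S" "p \<noteq> []" using p by (auto simp: P_def)
  obtain y where y: "r (p ! 0) y" "length p \<ge> 2 \<longrightarrow> y \<noteq> p ! 1" using two[OF p0(1)] by metis
  have "y \<in> set p"
  proof (rule ccontr)
    assume "y \<notin> set p"
    then have "P (y # p)" using p y r p0 by (auto simp: P_def nth_Cons split: nat.splits)
    then show False using max by fastforce
  qed
  then obtain j where j: "j < length p" "y = p ! j" by (auto simp: in_set_conv_nth)
  have "j \<noteq> 0" using j(2) r[OF y(1)] by metis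
  moreover have "j \<noteq> 1" using j y(2) by auto
  ultimately have j2: "j \<ge> 2" by simp
  let ?vs = "take (Suc j) p"
  have len: "length ?vs = Suc j" using j by simp
  have "r (?vs ! i) (?vs ! ((i + 1) mod length ?vs))" if "i < length ?vs" for i
  proof (cases "i = j")
    case True
    then show ?thesis using r[OF y(1)] j p0 by (simp add: len)
  next
    case False
    then have "i < j" using that len by simp
    then show ?thesis using p j by (auto simp: P_def len)
  qed
  moreover have "distinct ?vs" "set ?vs \<subseteq> S" using p set_take_subset[of "Suc j" p] by (auto simp: P_def)
  ultimately show False using acyclic len j2 by (metis Suc_le_mono eval_nat_numeral(3) numeral_2_eq_2 One_nat_def Suc_1)
qed

section \<open>Construction of the representations\<close>

context dihedral
begin

text \<open>Here \<open>\<alpha>\<close> is the dual basis, and the vectors are the columns of a Cartan matrix with off-diagonal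
  entries \<open>0\<close> and \<open>-3\<close>, except for one entry \<open>-6\<close> which breaks the symmetry along the cycle. Its
  determinant is \<open>2\<^sup>n\<close> modulo \<open>3\<close>.\<close>
lemma rep_of_rank:
  assumes card: "card X = n"
    and conn: "\<And>x y. x \<in> X \<Longrightarrow> y \<in> X \<Longrightarrow> (\<lambda>x y. x \<in> X \<and> y \<in> X \<and> x \<noteq> y \<and> B x y \<noteq> 0)\<^sup>*\<^sup>* x y"
    and cs: "length cs \<ge> 3" "distinct cs" "set cs \<subseteq> X" "\<And>i. Suc i < length cs \<Longrightarrow> B (cs ! i) (cs ! Suc i) \<noteq> 0"
    and close: "B (cs ! 0) (last cs) \<noteq> 0"
  shows "\<exists>\<rho>. good_rep I m n \<Gamma> \<rho>"
proof -
  obtain el where "bij_betw el {..<n} X" using ex_bij_betw_nat_finite[OF finite_X] card lessThan_atLeast0 by metis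
  define idx where "idx = the_inv_into {..<n} el"
  have el: "el i \<in> X" "idx (el i) = i" if "i < n" for i
    using \<open>bij_betw el {..<n} X\<close> that by (auto simp: idx_def bij_betw_def the_inv_into_f_f)
  have idx: "idx x < n" "el (idx x) = x" if "x \<in> X" for x
    using \<open>bij_betw el {..<n} X\<close> that f_the_inv_into_f_bij_betw[of el "{..<n}" X x]
      bij_betw_the_inv_into[of el "{..<n}" X] by (auto simp: idx_def dest: bij_betwE)
  let ?p = "cs ! 0" and ?q = "last cs"
  define cm where "cm x y = (if x = y then 2 else if B x y = 0 then 0 else if x = ?p \<and> y = ?q then -6 else -3 :: int)"
    for x y
  define al where "al x i = (if i = idx x then 1 else 0 :: real)" for x i
  define v where "v y i = real_of_int (cm (el i) y)" for y i
  have pr: "pairing n (al x) u = u (idx x)" if "x \<in> X" for x u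
    using idx[OF that] by (simp add: pairing_def al_def if_distrib[of "\<lambda>a. a * _"] cong: if_cong)
  have prv: "pairing n (al x) (v y) = cm x y" if "x \<in> X" for x y
    using idx[OF that] by (simp add: pr that v_def)
  interpret DR: dihedral_rep I m a b k n al v "\<lambda>_. -1"
  proof
    show "\<And>x i. x \<in> X \<Longrightarrow> i < n \<Longrightarrow> al x i \<in> \<int>" by (simp add: al_def)
    show "\<And>x i. x \<in> X \<Longrightarrow> i < n \<Longrightarrow> v x i \<in> \<int>" by (simp add: v_def)
    show "\<And>x. x \<in> X \<Longrightarrow> pairing n (al x) (\<lambda>_. -1) \<le> -1" by (simp add: pr)
  qed (simp_all add: prv cm_def)
  have pq: "?p \<noteq> ?q" using cs(1,2) by (cases cs) (auto simp: last_conv_nth nth_eq_iff_index_eq)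
  have csX: "cs ! i \<in> X" if "i < length cs" for i using cs(3) that by auto
  have lst: "last cs = cs ! (length cs - 1)" using cs(1) by (cases cs) (auto simp: last_conv_nth)
  have len: "0 < length cs" "length cs - 1 < length cs" using cs(1) by linarith+
  have at: "cs ! i = ?p \<longleftrightarrow> i = 0" "cs ! i = ?q \<longleftrightarrow> i = length cs - 1" if "i < length cs" for i
    unfolding lst using nth_eq_iff_index_eq[OF cs(2) that] len by auto
  have "good_rep I m n \<Gamma> DR.rho"
  proof (rule DR.good_rep_rho[OF order_refl conn _ _ cs close])
    show "\<exists>c. \<forall>i<n. u i = (\<Sum>x\<in>X. c x * al x i)" for u
    proof -
      have "inspan n X al u"
      proof (rule inspan_basis)
        fix l assume "l < n"
        show "inspan n X al (\<lambda>i. if i = l then 1 else 0)"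
          by (rule inspan_cong[OF inspan_gen[OF finite_X el(1)[OF \<open>l < n\<close>]]]) (use el \<open>l < n\<close> in \<open>auto simp: al_def\<close>)
      qed
      then show ?thesis by (simp add: inspan_def)
    qed
    show "\<exists>c. \<forall>i<n. u i = (\<Sum>x\<in>X. c x * v x i)" for u
    proof -
      have "el i \<noteq> el j" if "i < n" "j < n" "i \<noteq> j" for i j using el(2) that by metis
      then have "\<exists>c. \<forall>i<n. u i = (\<Sum>j<n. real_of_int (cm (el i) (el j)) * c j)"
        by (intro mod3_solvable) (auto simp: cm_def)
      then obtain c where c: "\<forall>i<n. u i = (\<Sum>j<n. real_of_int (cm (el i) (el j)) * c j)" by blast
      have "inspan n X v (\<lambda>i. \<Sum>j<n. c j * v (el j) i)"
        by (rule inspan_sum) (auto intro: inspan_gen finite_X el)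
      then have "inspan n X v u" by (rule inspan_cong) (use c in \<open>simp add: v_def mult.commute\<close>)
      then show ?thesis by (simp add: inspan_def)
    qed
    show "DR.A (cs ! 0) (last cs) \<noteq> DR.A (last cs) (cs ! 0)"
      using pq close B_sym[of ?p ?q] csX[of 0] csX[of "length cs - 1"] cs(1)
      by (cases "cs = []") (auto simp: DR.A_def prv cm_def lst)
    show "DR.A (cs ! i) (cs ! j) = DR.A (cs ! j) (cs ! i)"
      if ij: "i < length cs" "j < length cs" "{i, j} \<noteq> {0, length cs - 1}" for i j
    proof -
      have "\<not> (cs ! i = ?p \<and> cs ! j = ?q)" "\<not> (cs ! j = ?p \<and> cs ! i = ?q)"
        using ij at by (auto simp: doubleton_eq_iff)
      then have "cm (cs ! i) (cs ! j) = cm (cs ! j) (cs ! i)"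
        unfolding cm_def B_sym[of "cs ! j" "cs ! i"] by (simp only: if_False eq_commute[of "cs ! j" "cs ! i"])
      then show ?thesis using csX ij by (simp add: DR.A_def prv)
    qed
  qed
  then show ?thesis by blast
qed

text \<open>The reflection in the \<open>s\<close>-wall of the base chamber, that is,
  \<open>s\<close> itself.\<close>

definition T :: "'i \<Rightarrow> 'i list set" where "T s = cl (rw 0 s)"

lemma root_0: "root 0 s = sroot s" by (simp add: root_def)

lemma coroot_sroot: "s \<in> I \<Longrightarrow> coroot (sroot s) t = cartan0 t s"
  using sum_sroot[of s] by (simp add: coroot_def)

lemma root_1: "c \<in> I \<Longrightarrow> root 1 c = (\<lambda>s. sroot c s - sroot a s * cartan0 a c)"
  by (simp add: root_def seg_def alt_def rstep_coroot coroot_sroot)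

lemma B_T:
  assumes "ext 0 s" "ext i t"
  shows "B (T s) (cl (rw i t)) = coroot (root i t) s"
proof -
  have "s \<in> I" using assms by (simp add: ext_def)
  then show ?thesis unfolding B_def T_def rt_cl[OF assms(1)] rt_cl[OF assms(2)] root_0
    by (simp add: bil_def ev_sroot)
qed

lemma coroot_root_1:
  assumes "s \<in> I" "c \<in> I"
  shows "coroot (root 1 c) s = cartan0 s c - cartan0 s a * cartan0 a c"
proof -
  have "coroot (root 1 c) s = (\<Sum>t\<in>I. cartan0 s t * sroot c t) - (\<Sum>t\<in>I. (cartan0 s t * cartan0 a c) * sroot a t)"
    unfolding coroot_def root_1[OF assms(2)]
    by (simp add: right_diff_distrib sum_subtractf mult.commute mult.left_commute)
  then show ?thesis using assms by (simp add: sum_sroot aI)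
qed

text \<open>The reflection \<open>a c a\<close> takes the place of the missing vertex
  \<open>a\<close>: a path towards \<open>a\<close> is cut at its last vertex \<open>d\<close>
  before \<open>a\<close>, and \<open>d\<close> pairs with \<open>a c a\<close> to
  \<open>cartan0 d c - 9\<close>, which is never 0.\<close>

lemma T_connected:
  assumes k2: "k \<ge> 2" and c: "ext 1 c" "m a c = \<infinity>"
    and conn: "\<And>s. s \<in> I \<Longrightarrow> (\<lambda>s t. s \<in> I \<and> t \<in> I \<and> s \<noteq> t \<and> m s t = \<infinity>)\<^sup>*\<^sup>* s a"
    and X': "cl (rw 1 c) \<in> X'" "\<And>s. s \<in> I - {a} \<Longrightarrow> T s \<in> X'"
    and s: "s \<in> I - {a}"
  shows "(\<lambda>x y. x \<in> X' \<and> y \<in> X' \<and> x \<noteq> y \<and> B x y \<noteq> 0)\<^sup>*\<^sup>* (T s) (cl (rw 1 c))" (is "?E\<^sup>*\<^sup>* _ _")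
proof -
  have cI: "c \<in> I" "c \<noteq> a" using c m_diag[OF aI] by (auto simp: ext_def one_enat_def)
  have e0: "ext 0 t" if "t \<in> I - {a}" for t using that k2 by (auto simp: ext_def alt_def)
  let ?r = "\<lambda>s t. s \<in> I \<and> t \<in> I \<and> s \<noteq> t \<and> m s t = \<infinity>"
  obtain d where d: "?r d a" "(\<lambda>x y. ?r x y \<and> x \<noteq> a \<and> y \<noteq> a)\<^sup>*\<^sup>* s d"
    using path_avoiding[OF conn[of s]] s by blast
  have "?E\<^sup>*\<^sup>* (T s) (T d)"
    using d(2)
  proof (induction rule: rtranclp_induct)
    case (step x y)
    have xy: "x \<in> I - {a}" "y \<in> I - {a}" "x \<noteq> y" "m x y = \<infinity>" using step by auto
    have "B (T x) (T y) = cartan0 x y" "B (T x) (T x) = 2"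
      using B_T[OF e0[OF xy(1)] e0[OF xy(2)]] B_T[OF e0[OF xy(1)] e0[OF xy(1)]] xy
      by (simp_all add: T_def root_0 coroot_sroot)
    moreover have "cartan0 x y = -3" using xy by (simp add: cartan0_def)
    ultimately have "?E (T x) (T y)" using X' xy by auto
    then show ?case by (rule rtranclp.rtrancl_into_rtrancl[OF step.IH])
  qed simp
  moreover have "?E (T d) (cl (rw 1 c))"
  proof -
    have dI: "d \<in> I - {a}" using d by auto
    have "cartan0 d a = -3" "cartan0 a c = -3" using d c cI by (auto simp: cartan0_def)
    then have "B (T d) (cl (rw 1 c)) = cartan0 d c - 9"
      using B_T[OF e0[OF dI] c(1)] coroot_root_1[of d c] dI cI by simp
    moreover have "cartan0 d c \<in> {2, 0, -3}" by (simp add: cartan0_def)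
    ultimately have "B (T d) (cl (rw 1 c)) \<noteq> 0" "B (T d) (cl (rw 1 c)) \<noteq> 2" by auto
    moreover have "B (T d) (T d) = 2" using dI e0 by (intro B_self) (simp add: T_def XI)
    ultimately show ?thesis using X' dI by auto
  qed
  ultimately show ?thesis by (rule rtranclp.rtrancl_into_rtrancl)
qed

end

lemma connected_via:
  assumes "symp E" "\<And>x. x \<in> X' \<Longrightarrow> E\<^sup>*\<^sup>* x c" "x \<in> X'" "y \<in> X'"
  shows "E\<^sup>*\<^sup>* x y"
  using assms by (meson rtranclp_trans symp_rtranclp sympD)

context dihedral
begin

text \<open>The recursion of \<open>dihedral_root\<close>, started from the \<open>c\<close>-root;
  the additional term \<open>- cartan0 (alt i) c\<close> is nonnegative and only helps.\<close>

lemma seg_growth: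
  assumes c: "c \<in> I - {a, b}" "m a c = \<infinity>" and "i \<le> 2 * j"
  defines "w \<equiv> \<lambda>i. ract (seg i (Suc (2 * j))) (sroot c)"
  shows "w i (alt i) \<ge> 3 \<and> w i (alt (Suc i)) \<ge> 0 \<and> w i (alt i) \<ge> w i (alt (Suc i)) \<and>
    (i < 2 * j \<longrightarrow> w i (alt (Suc i)) \<ge> 3)"
  using assms(3)
proof (induction rule: inc_induct)
  case base
  have "cartan0 a c = -3" using c by (auto simp: cartan0_def)
  moreover have "w (2 * j) = (\<lambda>s. sroot c s - sroot a s * cartan0 a c)"
    using c(1) by (simp add: w_def seg_def alt_def rstep_coroot coroot_sroot)
  ultimately show ?case using c ab by (auto simp: alt_def sroot_def)
next
  case (step i)
  have z: "w (Suc i) r = sroot c r" if "r \<in> I - {a, b}" for r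
    using that set_seg by (auto simp: w_def ract_ab)
  have alt2: "alt (Suc (Suc i)) = alt i" by (simp add: alt_def)
  have "coroot (w (Suc i)) (alt i) = cartan0 (alt i) a * w (Suc i) a + cartan0 (alt i) b * w (Suc i) b + cartan0 (alt i) c"
    by (rule coroot_abt[OF z c(1)])
  also have "\<dots> = 2 * w (Suc i) (alt i) - 3 * w (Suc i) (alt (Suc i)) + cartan0 (alt i) c"
    using ab mab m_sym[OF aI bI] by (auto simp: alt_def cartan0_def)
  finally have "w i (alt i) = 3 * w (Suc i) (alt (Suc i)) - w (Suc i) (alt i) - cartan0 (alt i) c"
    "w i (alt (Suc i)) = w (Suc i) (alt (Suc i))"
    using step.hyps alt_neq[of i] by (auto simp: w_def seg_Cons rstep_coroot sroot_def)
  moreover have "cartan0 (alt i) c \<le> 0" using c(1) cartan0_off[of "alt i" c] by (auto simp: alt_def split: if_splits)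
  ultimately show ?case using step.IH unfolding alt2 by simp
qed

text \<open>Odd chambers are chosen because their words end in \<open>a\<close>, which does not
  commute with \<open>c\<close>. This makes these \<open>c\<close>-walls distinct with pairwise
  non-commuting reflections.\<close>

definition C :: "'i \<Rightarrow> nat \<Rightarrow> 'i list set" where "C c i = cl (rw (Suc (2 * i)) c)"

lemma B_C:
  assumes c: "c \<in> I - {a, b}" "m a c = \<infinity>" and e: "ext (Suc (2 * i)) c" "ext (Suc (2 * j)) c" and "i < j"
  shows "B (C c i) (C c j) \<le> -3"
proof -
  let ?p = "Suc (2 * i)" and ?q = "Suc (2 * j)"
  define w where "w = ract (seg ?p ?q) (sroot c)"
  have "root ?q c = ract (seg 0 ?p) w"
    using seg_append[of 0 ?p ?q] \<open>i < j\<close> by (simp add: root_def w_def ract_append)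
  then have "ract (rev (seg 0 ?p)) (root ?q c) = w" by (simp add: ract_cancel)
  then have "B (C c i) (C c j) = coroot w c"
    using c by (simp add: B_def C_def rt_cl[OF e(1)] rt_cl[OF e(2)] bil_root)
  also have "\<dots> = cartan0 c a * w a + cartan0 c b * w b + cartan0 c c"
    by (rule coroot_abt) (use c set_seg in \<open>auto simp: w_def ract_ab\<close>)
  also have "cartan0 c a = -3" using c m_sym[OF aI, of c] by (auto simp: cartan0_def)
  finally have eq: "B (C c i) (C c j) = 2 - 3 * w a + cartan0 c b * w b" by simp
  have "alt ?p = b" "alt (Suc ?p) = a" by (simp_all add: alt_def)
  then have "w a \<ge> 3" "w b \<ge> 0" using seg_growth[OF c, of ?p j] \<open>i < j\<close> by (auto simp: w_def)
  moreover have "cartan0 c b = 0 \<or> cartan0 c b = -3" using c by (intro cartan0_off) auto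
  ultimately show ?thesis unfolding eq by auto
qed

text \<open>The representation of \<open>W\<close> in dimension \<open>card I\<close>, restricted to the subgroup, is deformed by \<open>j\<close>
  further coordinates: each of them lowers the pairing of two of the pairwise non-commuting
  reflections \<open>C\<close>.\<close>
lemma rep_of_large_dim:
  assumes c: "c \<in> I - {a, b}" "m a c = \<infinity>" and j1: "j \<ge> 1" and kj: "k = 4 * j + 2" and n: "n = card I + j"
    and conn: "\<And>s. s \<in> I \<Longrightarrow> (\<lambda>s t. s \<in> I \<and> t \<in> I \<and> s \<noteq> t \<and> m s t = \<infinity>)\<^sup>*\<^sup>* s a"
  shows "\<exists>\<rho>. good_rep I m n \<Gamma> \<rho>"
proof -
  define N where "N = card I"
  have nN: "n = N + j" by (simp add: n N_def)
  obtain el where bij: "bij_betw el {..<N} I"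
    using ex_bij_betw_nat_finite[OF fin] lessThan_atLeast0 N_def by metis
  have elI: "el i \<in> I" if "i < N" for i using bij that by (auto dest: bij_betwE)
  have el_inj: "el i = el i' \<longleftrightarrow> i = i'" if "i < N" "i' < N" for i i'
    using bij that by (auto simp: bij_betw_def inj_on_def)
  let ?C = "C c"
  \<comment> \<open>The last chamber used has index \<open>2 * (2 * j) + 1 = k - 1\<close>. The
    reflection \<open>C 0\<close> will stay unperturbed, and \<open>C 1\<close> to
    \<open>C (2 * j)\<close> form \<open>j\<close> pairs.\<close>
  have eC: "ext (Suc (2 * i)) c" if "i \<le> 2 * j" for i
    unfolding ext_def using c that kj by (auto simp: alt_def split: if_splits)
  have CX: "?C i \<in> X" if "i \<le> 2 * j" for i unfolding C_def by (rule XI[OF eC[OF that]])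
  have BC: "B (?C i) (?C i') \<le> -3" if "i \<le> 2 * j" "i' \<le> 2 * j" "i \<noteq> i'" for i i'
    using B_C[OF c eC[OF that(1)] eC[OF that(2)]] B_C[OF c eC[OF that(2)] eC[OF that(1)]]
      B_sym[of "?C i" "?C i'"] that by (cases "i < i'") auto
  have C_inj: "?C i = ?C i' \<longleftrightarrow> i = i'" if "i \<le> 2 * j" "i' \<le> 2 * j" for i i'
    using BC[OF that] B_self[OF CX[OF that(1)]] by (cases "i = i'") auto
  have e0: "ext 0 s" if "s \<in> I - {a}" for s using that k1 by (auto simp: ext_def alt_def)
  have TX: "T s \<in> X" if "s \<in> I - {a}" for s unfolding T_def by (rule XI[OF e0[OF that]])
  have rtT: "rt (T s) = sroot s" if "s \<in> I - {a}" for s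
    unfolding T_def by (simp add: rt_cl[OF e0[OF that]] root_0)
  have rtC: "rt (?C i) = root (Suc (2 * i)) c" if "i \<le> 2 * j" for i
    unfolding C_def by (rule rt_cl[OF eC[OF that]])
  have TC: "T s \<noteq> ?C i" if "s \<in> I - {a}" "i \<le> 2 * j" for s i
  proof
    assume "T s = ?C i"
    then have "sroot s a = root (Suc (2 * i)) c a" using rtT[OF that(1)] rtC[OF that(2)] by simp
    moreover have "root (Suc (2 * i)) c a \<ge> 3" using seg_growth[OF c, of 0 i] by (simp add: root_def alt_def)
    moreover have "sroot s a = 0" using that by (auto simp: sroot_def)
    ultimately show False by simp
  qed
  \<comment> \<open>The first \<open>N\<close> coordinates are the root and its coroot. The new
    coordinate \<open>N + l\<close> is 1 on the form of \<open>C (l + 1)\<close> and -1 on the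
    vector of \<open>C (j + l + 1)\<close>, so it lowers this pairing by 1 in one order only and
    breaks the symmetry.\<close>
  define al where "al x i = (if i < N then real_of_int (rt x (el i)) else if x = ?C (Suc (i - N)) then 1 else 0)"
    for x i
  define v where "v y i = (if i < N then real_of_int (coroot (rt y) (el i))
    else if y = ?C (j + Suc (i - N)) then -1 else 0)" for y i
  define eps where "eps x y = (\<Sum>l<j. if x = ?C (Suc l) \<and> y = ?C (j + Suc l) then 1 else 0 :: real)" for x y
  have split_sum: "(\<Sum>i<N + j. f i) = (\<Sum>i<N. f i) + (\<Sum>l<j. f (N + l))" for f :: "nat \<Rightarrow> real"
    by (induction j) simp_all
  have reindex: "(\<Sum>i<N. f (el i)) = (\<Sum>s\<in>I. f s)" for f :: "'i \<Rightarrow> real"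
    by (rule sum.reindex_bij_betw[OF bij])
  have pr: "pairing n (al x) (v y) = real_of_int (B x y) - eps x y" for x y
  proof -
    have "pairing n (al x) (v y) = (\<Sum>i<N. real_of_int (rt x (el i)) * real_of_int (coroot (rt y) (el i)))
      + (\<Sum>l<j. al x (N + l) * v y (N + l))"
      unfolding pairing_def nN split_sum by (simp add: al_def v_def)
    also have "(\<Sum>i<N. real_of_int (rt x (el i)) * real_of_int (coroot (rt y) (el i))) = real_of_int (B x y)"
      using reindex[of "\<lambda>s. real_of_int (rt x s) * real_of_int (coroot (rt y) s)"]
      by (simp add: B_def bil_def ev_def)
    also have "(\<Sum>l<j. al x (N + l) * v y (N + l)) = - eps x y"
      unfolding eps_def sum_negf[symmetric] by (intro sum.cong) (auto simp: al_def v_def)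
    finally show ?thesis by simp
  qed
  have eps0: "eps x y = 0" if "\<And>l. l < j \<Longrightarrow> \<not> (x = ?C (Suc l) \<and> y = ?C (j + Suc l))" for x y
    unfolding eps_def using that by (intro sum.neutral) auto
  have eps_nonneg: "eps x y \<ge> 0" for x y unfolding eps_def by (intro sum_nonneg) auto
  \<comment> \<open>The base point vanishes in the new coordinates, so the deformation does not
    affect it; on the old ones each root has a negative integer value there.\<close>
  interpret DR: dihedral_rep I m a b k n al v "\<lambda>i. if i < N then -1 else 0"
  proof
    fix x y
    show "\<And>i. al x i \<in> \<int>" "\<And>i. v x i \<in> \<int>" by (simp_all add: al_def v_def)
    assume x: "x \<in> X"
    have "eps x x = 0" by (rule eps0) (auto simp: C_inj)
    then show "pairing n (al x) (v x) = 2" using B_self[OF x] by (simp add: pr)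
    have "pairing n (al x) (\<lambda>i. if i < N then -1 else 0) = (\<Sum>i<N. - real_of_int (rt x (el i)))"
      unfolding pairing_def nN split_sum by (simp add: al_def)
    also have "\<dots> = real_of_int (ev (rt x) (\<lambda>_. -1))"
      using reindex[of "\<lambda>s. - real_of_int (rt x s)"] by (simp add: ev_def sum_negf)
    also have "\<dots> \<le> -1" using rt_negative[OF x, of 0 "\<lambda>_. -1"] k1 by simp
    finally show "pairing n (al x) (\<lambda>i. if i < N then -1 else 0) \<le> -1" .
    assume y: "y \<in> X" "x \<noteq> y"
    show "pairing n (al x) (v y) = 0" if "B x y = 0"
    proof -
      have "eps x y = 0"
      proof (rule eps0)
        fix l assume "l < j"
        then show "\<not> (x = ?C (Suc l) \<and> y = ?C (j + Suc l))" using BC[of "Suc l" "j + Suc l"] j1 that by auto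
      qed
      then show ?thesis using that by (simp add: pr)
    qed
    show "pairing n (al x) (v y) \<le> -3" if "B x y \<noteq> 0"
      using B_off[OF x y] that eps_nonneg[of x y] by (simp add: pr)
  qed
  \<comment> \<open>The wall of \<open>a\<close> is inner, so \<open>a\<close> has no
    \<open>T a\<close> here; \<open>C 0\<close>, with root \<open>c + 3 a\<close>, replaces it in
    the spanning and connectedness arguments.\<close>
  define X' where "X' = ?C ` {..2 * j} \<union> T ` (I - {a})"
  have X'X: "X' \<subseteq> X" using CX TX by (auto simp: X'_def)
  have finX': "finite X'" using fin by (simp add: X'_def)
  have CX': "?C i \<in> X'" if "i \<le> 2 * j" for i using that by (auto simp: X'_def)
  have TX': "T s \<in> X'" if "s \<in> I - {a}" for s using that by (auto simp: X'_def)
  have ca: "cartan0 a c = -3" using c by (auto simp: cartan0_def)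
  have r0: "rt (?C 0) s = sroot c s + 3 * sroot a s" for s
    using rtC[of 0] root_1[of c] c ca by simp
  let ?E = "\<lambda>x y. x \<in> X' \<and> y \<in> X' \<and> x \<noteq> y \<and> B x y \<noteq> 0"
  have conn': "?E\<^sup>*\<^sup>* x y" if "x \<in> X'" "y \<in> X'" for x y
  proof (rule connected_via[OF _ _ that, of _ "?C 0"])
    show "symp ?E" using B_sym by (auto simp: symp_def)
    fix x assume "x \<in> X'"
    then consider i where "i \<le> 2 * j" "x = ?C i" | s where "s \<in> I - {a}" "x = T s" by (auto simp: X'_def)
    then show "?E\<^sup>*\<^sup>* x (?C 0)"
    proof cases
      case 1
      then show ?thesis
        using BC[of i 0] CX'[of i] CX'[of 0] C_inj[of i 0] by (cases "i = 0") auto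
    next
      case 2
      have "cl (rw 1 c) = ?C 0" by (simp add: C_def)
      then show ?thesis
        using T_connected[of c X' s] c kj eC[of 0] conn CX'[of 0] TX' 2 by simp
    qed
  qed
  have span_al: "inspan n X' al u" for u
  proof -
    define es where "es s = (\<lambda>i. if i < N \<and> el i = s then 1 else 0 :: real)" for s
    have es1: "inspan n X' al (es s)" if "s \<in> I - {a}" for s
    proof (rule inspan_cong[OF inspan_gen[OF finX' TX'[OF that]]])
      fix i assume "i < n"
      show "al (T s) i = es s i"
        using TC[OF that, of "Suc (i - N)"] rtT[OF that] \<open>i < n\<close> nN by (auto simp: al_def es_def sroot_def)
    qed
    have es2: "inspan n X' al (es s)" if "s \<in> I" for s
    proof (cases "s = a")
      case True
      have cI: "c \<in> I - {a}" using c by auto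
      show ?thesis unfolding True
      proof (rule inspan_cong[OF inspan_lin[OF inspan_gen[OF finX' CX'[of 0]] es1[OF cI], of "1 / 3" "- 1 / 3"]])
        fix i assume "i < n"
        then show "1 / 3 * al (?C 0) i + - 1 / 3 * es c i = es a i"
          using C_inj[of 0 "Suc (i - N)"] nN by (auto simp: al_def es_def r0 sroot_def)
      qed simp
    qed (use es1 that in auto)
    show ?thesis
    proof (rule inspan_basis)
      fix l assume l: "l < n"
      show "inspan n X' al (\<lambda>i. if i = l then 1 else 0)"
      proof (cases "l < N")
        case True
        show ?thesis by (rule inspan_cong[OF es2[OF elI[OF True]]]) (use True el_inj in \<open>auto simp: es_def\<close>)
      next
        case False
        define l' where "l' = l - N"
        have l': "l = N + l'" "l' < j" using False l nN by (auto simp: l'_def)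
        \<comment> \<open>Subtracting the part in the old coordinates from the form of
          \<open>C (l' + 1)\<close> isolates the new basis vector.\<close>
        have s: "inspan n X' al (\<lambda>i. \<Sum>s\<in>I. real_of_int (rt (?C (Suc l')) s) * es s i)"
          by (rule inspan_sum[OF fin es2])
        have cx: "?C (Suc l') \<in> X'" using l' by (intro CX') auto
        show ?thesis
        proof (rule inspan_cong[OF inspan_lin[OF inspan_gen[OF finX' cx] s, of 1 "-1"]])
          fix i assume i: "i < n"
          show "1 * al (?C (Suc l')) i + - 1 * (\<Sum>s\<in>I. real_of_int (rt (?C (Suc l')) s) * es s i) =
            (if i = l then 1 else 0)"
          proof (cases "i < N")
            case True
            have "(\<Sum>s\<in>I. real_of_int (rt (?C (Suc l')) s) * es s i) =
              (\<Sum>s\<in>I. if s = el i then real_of_int (rt (?C (Suc l')) (el i)) else 0)"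
              using True by (intro sum.cong) (auto simp: es_def)
            then show ?thesis using True fin elI[OF True] l' by (simp add: al_def)
          next
            case False
            then show ?thesis using C_inj[of "Suc l'" "Suc (i - N)"] l' i nN by (auto simp: al_def es_def)
          qed
        qed
      qed
    qed
  qed
  have span_v: "inspan n X' v u" for u
  proof -
    define vs where "vs s = (\<lambda>i. if i < N then real_of_int (cartan0 (el i) s) else 0 :: real)" for s
    have vs1: "inspan n X' v (vs s)" if "s \<in> I - {a}" for s
    proof (rule inspan_cong[OF inspan_gen[OF finX' TX'[OF that]]])
      fix i assume "i < n"
      show "v (T s) i = vs s i"
      proof (cases "i < N")
        case True
        then show ?thesis using rtT[OF that] that by (simp add: v_def vs_def coroot_sroot)
      next
        case False
        then have "T s \<noteq> ?C (j + Suc (i - N))" using \<open>i < n\<close> nN by (intro TC[OF that]) auto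
        then show ?thesis using False by (simp add: v_def vs_def)
      qed
    qed
    have vs2: "inspan n X' v (vs s)" if "s \<in> I" for s
    proof (cases "s = a")
      case True
      have cI: "c \<in> I - {a}" using c by auto
      show ?thesis unfolding True
      proof (rule inspan_cong[OF inspan_lin[OF inspan_gen[OF finX' CX'[of 0]] vs1[OF cI], of "1 / 3" "- 1 / 3"]])
        fix i assume i: "i < n"
        show "1 / 3 * v (?C 0) i + - 1 / 3 * vs c i = vs a i"
        proof (cases "i < N")
          case True
          have "coroot (rt (?C 0)) (el i) = cartan0 (el i) c + 3 * cartan0 (el i) a"
            using coroot_root_1[of "el i" c] elI[OF True] c ca rtC[of 0] by simp
          then show ?thesis using True by (simp add: v_def vs_def field_simps)
        next
          case False
          then have "?C 0 \<noteq> ?C (j + Suc (i - N))" using C_inj[of 0 "j + Suc (i - N)"] i nN by simp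
          then show ?thesis using False by (simp add: v_def vs_def)
        qed
      qed simp
    qed (use vs1 that in auto)
    have low: "inspan n X' v (\<lambda>i. if i < N then u i else 0)" for u
    proof -
      have "\<exists>d. \<forall>i<N. u i = (\<Sum>l<N. real_of_int (cartan0 (el i) (el l)) * d l)"
        by (rule mod3_solvable) (auto simp: cartan0_def el_inj)
      then obtain d where d: "\<forall>i<N. u i = (\<Sum>l<N. real_of_int (cartan0 (el i) (el l)) * d l)" by blast
      have "inspan n X' v (\<lambda>i. \<Sum>l<N. d l * vs (el l) i)" by (rule inspan_sum) (auto intro: vs2 elI)
      then show ?thesis by (rule inspan_cong) (use d in \<open>simp add: vs_def mult.commute\<close>)
    qed
    show ?thesis
    proof (rule inspan_basis)
      fix l assume l: "l < n"
      show "inspan n X' v (\<lambda>i. if i = l then 1 else 0)"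
      proof (cases "l < N")
        case True
        show ?thesis by (rule inspan_cong[OF low[of "\<lambda>i. if i = l then 1 else 0"]]) (use True in auto)
      next
        case False
        define l' where "l' = l - N"
        have l': "l = N + l'" "l' < j" using False l nN by (auto simp: l'_def)
        have cx: "?C (j + Suc l') \<in> X'" using l' by (intro CX') auto
        show ?thesis
        proof (rule inspan_cong[OF inspan_lin[OF inspan_gen[OF finX' cx] low[of "v (?C (j + Suc l'))"], of "-1" 1]])
          fix i assume i: "i < n"
          show "- 1 * v (?C (j + Suc l')) i + 1 * (if i < N then v (?C (j + Suc l')) i else 0) =
            (if i = l then 1 else 0)"
          proof (cases "i < N")
            case False
            then have "?C (j + Suc l') = ?C (j + Suc (i - N)) \<longleftrightarrow> i = l"
              using C_inj[of "j + Suc l'" "j + Suc (i - N)"] l' i nN by auto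
            then show ?thesis using False by (simp add: v_def)
          qed (use l' in auto)
        qed
      qed
    qed
  qed
  have "good_rep I m n \<Gamma> DR.rho"
  \<comment> \<open>In this triangle \<open>C 0\<close> is untouched by the deformation, and only
    the edge from \<open>C 1\<close> to \<open>C (j + 1)\<close> is lowered, in one
    direction.\<close>
  proof (rule DR.good_rep_rho[OF X'X conn' _ _, of "[?C 1, ?C 0, ?C (Suc j)]"])
    show "\<exists>d. \<forall>i<n. u i = (\<Sum>x\<in>X'. d x * v x i)" for u using span_v by (simp add: inspan_def)
    show "\<exists>d. \<forall>i<n. u i = (\<Sum>x\<in>X'. d x * al x i)" for u using span_al by (simp add: inspan_def)
    show "distinct [?C 1, ?C 0, ?C (Suc j)]" using C_inj j1 by auto
    show "set [?C 1, ?C 0, ?C (Suc j)] \<subseteq> X'" using CX' j1 by auto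
    show "B ([?C 1, ?C 0, ?C (Suc j)] ! 0) (last [?C 1, ?C 0, ?C (Suc j)]) \<noteq> 0"
      using BC[of 1 "Suc j"] j1 by auto
    show "B ([?C 1, ?C 0, ?C (Suc j)] ! i) ([?C 1, ?C 0, ?C (Suc j)] ! Suc i) \<noteq> 0"
      if "Suc i < length [?C 1, ?C 0, ?C (Suc j)]" for i
      using that BC[of 1 0] BC[of 0 "Suc j"] j1 by (cases i) (auto simp: less_Suc_eq)
    have A: "DR.A x y = real_of_int (B x y) - eps x y" for x y by (simp add: DR.A_def pr)
    have z1: "eps x (?C 0) = 0" for x by (rule eps0) (use C_inj[of 0] in auto)
    have z2: "eps (?C 0) x = 0" for x by (rule eps0) (use C_inj[of 0] in auto)
    have z3: "eps (?C (Suc j)) x = 0" for x by (rule eps0) (use C_inj[of "Suc j"] j1 in auto)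
    have "eps (?C 1) (?C (Suc j)) \<ge> (if ?C 1 = ?C (Suc 0) \<and> ?C (Suc j) = ?C (j + Suc 0) then 1 else 0)"
      unfolding eps_def using j1
      by (intro member_le_sum[of 0 "{..<j}" "\<lambda>l. if ?C 1 = ?C (Suc l) \<and> ?C (Suc j) = ?C (j + Suc l) then 1 else 0"]) auto
    then have "eps (?C 1) (?C (Suc j)) \<ge> 1" by simp
    then show "DR.A ([?C 1, ?C 0, ?C (Suc j)] ! 0) (last [?C 1, ?C 0, ?C (Suc j)]) \<noteq>
        DR.A (last [?C 1, ?C 0, ?C (Suc j)]) ([?C 1, ?C 0, ?C (Suc j)] ! 0)"
      using z3[of "?C 1"] B_sym[of "?C 1" "?C (Suc j)"] by (simp add: A)
    show "DR.A ([?C 1, ?C 0, ?C (Suc j)] ! p) ([?C 1, ?C 0, ?C (Suc j)] ! q) =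
        DR.A ([?C 1, ?C 0, ?C (Suc j)] ! q) ([?C 1, ?C 0, ?C (Suc j)] ! p)"
      if "p < length [?C 1, ?C 0, ?C (Suc j)]" "q < length [?C 1, ?C 0, ?C (Suc j)]"
        "{p, q} \<noteq> {0, length [?C 1, ?C 0, ?C (Suc j)] - 1}" for p q
      using that z1 z2 B_sym by (auto simp: A less_Suc_eq numeral_2_eq_2 numeral_3_eq_3)
  qed simp_all
  then show ?thesis by blast
qed

lemma rep_of_coxeter_group:
  assumes k: "k = 1"
    and conn: "\<And>s. s \<in> I \<Longrightarrow> (\<lambda>s t. s \<in> I \<and> t \<in> I \<and> s \<noteq> t \<and> m s t = \<infinity>)\<^sup>*\<^sup>* s a"
    and vs: "length vs \<ge> 3" "distinct vs" "set vs \<subseteq> I"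
      "\<And>i. i < length vs \<Longrightarrow> m (vs ! i) (vs ! ((i + 1) mod length vs)) = \<infinity>"
  shows "\<Gamma> = carrier G \<and> (\<exists>\<rho>. good_rep I m (card I) \<Gamma> \<rho>)"
proof
  have e0: "ext 0 s" if "s \<in> I" for s unfolding ext_def using that k by auto
  have rtT: "rt (T s) = sroot s" if "s \<in> I" for s unfolding T_def by (simp add: rt_cl[OF e0[OF that]] root_0)
  have "ext i s \<longleftrightarrow> i = 0 \<and> s \<in> I" for i s using k unfolding ext_def by auto
  then have XT: "X = T ` I" by (auto simp: X_def T_def)
  have T_inj: "inj_on T I"
  proof (rule inj_onI)
    fix s t assume "s \<in> I" "t \<in> I" "T s = T t"
    then have "sroot s s = sroot t s" using rtT by metis
    then show "s = t" by (simp add: sroot_def split: if_splits)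
  qed
  have BT: "B (T s) (T t) = cartan0 s t" if "s \<in> I" "t \<in> I" for s t
    using B_T[OF e0[OF that(1)] e0[OF that(2)]] that by (simp add: T_def root_0 coroot_sroot)
  have "carrier G \<subseteq> \<Gamma>"
  proof
    fix g assume "g \<in> carrier G"
    then obtain w where w: "set w \<subseteq> I" "g = cl w" by (rule carrierE)
    obtain u i where u: "set u \<subseteq> X" "i < k" "cox_eq I m w (wrd u @ seg 0 i)" using decompose[OF w(1)] by blast
    then have "g = cl (wrd u)" using w(2) cl_eqI[OF u(3)] k by simp
    then show "g \<in> \<Gamma>" using gamma_iff u(1) by blast
  qed
  then show "\<Gamma> = carrier G" using subgroup.subset[OF subgroup_gamma] by blast
  let ?E = "\<lambda>x y. x \<in> X \<and> y \<in> X \<and> x \<noteq> y \<and> B x y \<noteq> 0"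
  have lift: "?E (T s) (T t)" if "s \<in> I" "t \<in> I" "s \<noteq> t" "m s t = \<infinity>" for s t
    using that BT[of s t] T_inj by (auto simp: XT cartan0_def inj_on_eq_iff)
  have toa: "?E\<^sup>*\<^sup>* (T s) (T a)" if "s \<in> I" for s
    using conn[OF that]
  proof (induction rule: converse_rtranclp_induct)
    case (step s t)
    have "?E (T s) (T t)" by (rule lift) (use step.hyps(1) in auto)
    then show ?case by (rule converse_rtranclp_into_rtranclp[where r = ?E, OF _ step.IH])
  qed simp
  show "\<exists>\<rho>. good_rep I m (card I) \<Gamma> \<rho>"
  proof (rule rep_of_rank[of _ "map T vs"])
    show "card X = card I" unfolding XT by (rule card_image[OF T_inj])
    show "?E\<^sup>*\<^sup>* x y" if "x \<in> X" "y \<in> X" for x y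
    proof (rule connected_via[OF _ _ that, of _ "T a"])
      show "symp ?E" using B_sym by (auto simp: symp_def)
      show "\<And>x. x \<in> X \<Longrightarrow> ?E\<^sup>*\<^sup>* x (T a)" using toa by (auto simp: XT)
    qed
    show "length (map T vs) \<ge> 3" using vs by simp
    show "distinct (map T vs)" using vs T_inj by (auto simp: distinct_map intro: inj_on_subset)
    show "set (map T vs) \<subseteq> X" using vs by (auto simp: XT)
    have ne: "vs ! p \<noteq> vs ! q" if "p < length vs" "q < length vs" "p \<noteq> q" for p q
      using vs(2) that nth_eq_iff_index_eq by blast
    have nz: "B (T (vs ! p)) (T (vs ! q)) \<noteq> 0"
      if "p < length vs" "q < length vs" "p \<noteq> q" "m (vs ! p) (vs ! q) = \<infinity>" for p q
      using that ne[of p q] vs(3) BT[of "vs ! p" "vs ! q"] by (auto simp: cartan0_def subset_iff)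
    show "B (map T vs ! i) (map T vs ! Suc i) \<noteq> 0" if "Suc i < length (map T vs)" for i
      using nz[of i "Suc i"] vs(4)[of i] that by simp
    have "vs \<noteq> []" using vs(1) by auto
    have L: "length vs - 1 < length vs" "Suc (length vs - 1) mod length vs = 0"
      using \<open>vs \<noteq> []\<close> by simp_all
    have "m (vs ! (length vs - 1)) (vs ! 0) = \<infinity>"
      using vs(4)[OF L(1)] L(2) by simp
    then have "B (T (vs ! (length vs - 1))) (T (vs ! 0)) \<noteq> 0" using vs(1) by (intro nz) auto
    then show "B (map T vs ! 0) (last (map T vs)) \<noteq> 0"
      using \<open>vs \<noteq> []\<close> B_sym[of "T (vs ! 0)"] by (simp add: last_map last_conv_nth)
  qed
qed

text \<open>Doubling along a leaf \<open>a\<close> keeps the rank and creates a triangle.\<close>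
lemma rep_of_doubled_leaf:
  assumes k: "k = 2" and leaf: "\<And>s. s \<in> I \<Longrightarrow> s \<noteq> a \<Longrightarrow> m s a = \<infinity> \<Longrightarrow> s = b"
    and z: "z \<in> I" "z \<noteq> a" "z \<noteq> b" "m z b = \<infinity>"
    and conn: "\<And>s. s \<in> I \<Longrightarrow> (\<lambda>s t. s \<in> I \<and> t \<in> I \<and> s \<noteq> t \<and> m s t = \<infinity>)\<^sup>*\<^sup>* s a"
  shows "\<exists>\<rho>. good_rep I m (card I) \<Gamma> \<rho>"
proof -
  let ?D = "cl (rw 1 b)"
  have e0: "ext 0 s" if "s \<in> I - {a}" for s unfolding ext_def using that k by (auto simp: alt_def)
  have e1: "ext 1 s" if "s \<in> I - {a}" for s unfolding ext_def using that k by (auto simp: alt_def)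
  have bI': "b \<in> I - {a}" using bI ab by auto
  have zI: "z \<in> I - {a}" using z by auto
  have rtT: "rt (T s) = sroot s" if "s \<in> I - {a}" for s unfolding T_def by (simp add: rt_cl[OF e0[OF that]] root_0)
  have ba: "cartan0 a b = -3" "cartan0 b a = -3" "cartan0 z b = -3" "cartan0 b z = -3"
    using ab mab m_sym[OF aI bI] z m_sym[OF bI z(1)] by (auto simp: cartan0_def)
  have sa: "cartan0 a s = 0" "cartan0 s a = 0" if "s \<in> I - {a, b}" for s
    using leaf[of s] that m_off[of s a] aI m_sym[OF aI, of s] by (auto simp: cartan0_def)
  have rtD: "rt ?D = (\<lambda>s. sroot b s + 3 * sroot a s)"
    unfolding rt_cl[OF e1[OF bI']] using root_1[OF bI] ba by (simp add: mult.commute)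
  have DX: "?D \<in> X" by (rule XI[OF e1[OF bI']])
  have TX: "T s \<in> X" if "s \<in> I - {a}" for s unfolding T_def by (rule XI[OF e0[OF that]])
  \<comment> \<open>Every generator other than \<open>b\<close> commutes with the leaf
    \<open>a\<close>, so its two walls give the same reflection; only \<open>b\<close> contributes a
    second one, \<open>a b a\<close>, which replaces \<open>a\<close> in the count.\<close>
  have X: "X = insert ?D (T ` (I - {a}))"
  proof
    show "X \<subseteq> insert ?D (T ` (I - {a}))"
    proof
      fix x assume "x \<in> X"
      then obtain i s where x: "ext i s" "x = cl (rw i s)" by (auto simp: X_def)
      have i: "i = 0 \<or> i = 1" using x(1) k unfolding ext_def by auto
      have s: "s \<in> I - {a}" using x(1) i k unfolding ext_def by (auto simp: alt_def)
      show "x \<in> insert ?D (T ` (I - {a}))"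
      proof (cases "i = 1 \<and> s \<noteq> b")
        case True
        then have "root 1 s = root 0 s" using root_1[of s] s sa(1)[of s] by (simp add: root_0)
        then have "cl (rw 1 s) = T s" using cl_rw_iff[OF e1[OF s] e0[OF s]] by (simp add: T_def)
        then show ?thesis using True x s by auto
      next
        case False
        then show ?thesis using i x s by (auto simp: T_def)
      qed
    qed
  qed (use DX TX in auto)
  have T_inj: "inj_on T (I - {a})"
  proof (rule inj_onI)
    fix s t assume "s \<in> I - {a}" "t \<in> I - {a}" "T s = T t"
    then have "sroot s s = sroot t s" using rtT by metis
    then show "s = t" by (simp add: sroot_def split: if_splits)
  qed
  have TD: "T s \<noteq> ?D" if "s \<in> I - {a}" for s
  proof
    assume "T s = ?D"
    then have "sroot s a = sroot b a + 3 * sroot a a" using rtT[OF that] rtD by metis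
    then show False using that ab by (auto simp: sroot_def)
  qed
  have card: "card X = card I"
    unfolding X using TD fin card_image[OF T_inj] card_Suc_Diff1[OF fin aI] by (subst card_insert_disjoint) auto
  have BT: "B (T s) (T t) = cartan0 s t" if "s \<in> I - {a}" "t \<in> I - {a}" for s t
    using B_T[OF e0[OF that(1)] e0[OF that(2)]] that by (simp add: T_def root_0 coroot_sroot)
  have BD: "B (T s) ?D = cartan0 s b + 3 * cartan0 s a" if "s \<in> I - {a}" for s
    using B_T[OF e0[OF that] e1[OF bI']] coroot_root_1[of s b] that bI ba by simp
  let ?E = "\<lambda>x y. x \<in> X \<and> y \<in> X \<and> x \<noteq> y \<and> B x y \<noteq> 0"
  have conn': "?E\<^sup>*\<^sup>* x y" if "x \<in> X" "y \<in> X" for x y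
  proof (rule connected_via[OF _ _ that, of _ ?D])
    show "symp ?E" using B_sym by (auto simp: symp_def)
    show "\<And>x. x \<in> X \<Longrightarrow> ?E\<^sup>*\<^sup>* x ?D"
      using T_connected[OF _ e1[OF bI'] mab conn DX TX] k unfolding X by auto
  qed
  have bz: "T b \<noteq> T z" using T_inj bI' zI z by (auto simp: inj_on_eq_iff)
  \<comment> \<open>The values are 2 - 9 for \<open>a b a\<close> and \<open>b\<close>, and -3 for
    the two edges at \<open>z\<close>.\<close>
  have nz: "B ?D (T b) \<noteq> 0" "B (T b) (T z) \<noteq> 0" "B ?D (T z) \<noteq> 0"
    using BD[OF bI'] BD[OF zI] BT[OF bI' zI] B_sym[of ?D] ba sa(2)[of z] z by auto
  show ?thesis
  proof (rule rep_of_rank[OF card conn', of "[?D, T b, T z]"])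
    show "distinct [?D, T b, T z]" using TD[OF bI'] TD[OF zI] bz by auto
    show "set [?D, T b, T z] \<subseteq> X" using DX TX bI' zI by auto
    show "B ([?D, T b, T z] ! i) ([?D, T b, T z] ! Suc i) \<noteq> 0" if "Suc i < length [?D, T b, T z]" for i
      using that nz by (cases i) (auto simp: less_Suc_eq)
    show "B ([?D, T b, T z] ! 0) (last [?D, T b, T z]) \<noteq> 0" using nz by simp
  qed simp_all
qed

end

theorem theorem1p2:
  fixes S :: "'s set" and m :: "'s \<Rightarrow> 's \<Rightarrow> enat" and N :: nat
  assumes "coxeter_matrix S m"
    and "irreducible_coxeter S m"
    and "right_angled S m"
    and "card S = N" and "3 \<le> N"
  shows "(\<forall>n\<ge>N. \<exists>\<Gamma> \<rho>. reflection_subgroup S m \<Gamma> \<and> finite_index (coxeter_group S m) \<Gamma> \<and>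
             good_rep S m n \<Gamma> \<rho>)
       \<and> (\<not> diagram_is_tree S m \<longrightarrow>
             (\<exists>\<rho>. good_rep S m N (carrier (coxeter_group S m)) \<rho>))"
proof -
  let ?r = "\<lambda>s t. s \<in> S \<and> t \<in> S \<and> s \<noteq> t \<and> m s t = \<infinity>"
  have fin: "finite S" and diag: "\<And>s. s \<in> S \<Longrightarrow> m s s = 1"
    and sym: "\<And>s t. s \<in> S \<Longrightarrow> t \<in> S \<Longrightarrow> m s t = m t s"
    and off: "\<And>s t. s \<in> S \<Longrightarrow> t \<in> S \<Longrightarrow> s \<noteq> t \<Longrightarrow> m s t = 2 \<or> m s t = \<infinity>"
    using assms by (auto simp: coxeter_matrix_def right_angled_def)
  have adj: "diagram_adj S m = ?r"
  proof (intro ext)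
    fix s t
    have "\<not> (3::enat) \<le> 2" by (simp add: numeral_eq_enat)
    then show "diagram_adj S m s t = ?r s t" using off[of s t] by (auto simp: diagram_adj_def)
  qed
  have conn: "?r\<^sup>*\<^sup>* s t" if "s \<in> S" "t \<in> S" for s t
    using assms(2) that by (simp add: irreducible_coxeter_def diagram_connected_def adj)
  have dihedral: "dihedral S m a b k" if "?r a b" "k \<ge> 1" for a b k
    by unfold_locales (use that fin diag sym off in auto)
  \<comment> \<open>In a connected diagram of rank at least 3, every nonempty set of at most two
    vertices has a neighbour outside.\<close>
  have boundary: "\<exists>u w. ?r u w \<and> u \<notin> Q \<and> w \<in> Q" if "finite Q" "card Q < N" "x \<in> Q" "x \<in> S" for Q x
  proof -
    have "\<not> S \<subseteq> Q" using that card_mono[of Q S] assms(4) by auto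
    then obtain y where "y \<in> S" "y \<notin> Q" by blast
    then show ?thesis using boundary_edge[OF conn[of y x]] that by blast
  qed
  obtain x where x: "x \<in> S" using assms(4,5) by fastforce
  obtain y where y: "?r x y"
  proof -
    obtain u w where "?r u w" "w \<in> {x}" using boundary[of "{x}" x] x assms(5) by auto
    then show ?thesis using that[of u] sym by auto
  qed
  have W: "\<exists>\<rho>. good_rep S m N (carrier (coxeter_group S m)) \<rho>"
    and W': "reflection_subgroup S m (carrier (coxeter_group S m)) \<and>
      finite_index (coxeter_group S m) (carrier (coxeter_group S m))"
    if cyc: "diagram_has_cycle S m"
  proof -
    obtain vs where vs: "length vs \<ge> 3" "distinct vs" "set vs \<subseteq> S"
        "\<forall>i<length vs. ?r (vs ! i) (vs ! ((i + 1) mod length vs))"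
      using cyc unfolding diagram_has_cycle_def adj by blast
    \<comment> \<open>With \<open>k = 1\<close> the gallery is the base chamber alone, so any edge
      may serve as \<open>x\<close>, \<open>y\<close>.\<close>
    interpret dihedral S m x y 1 by (rule dihedral[OF y]) simp
    have "\<Gamma> = carrier G \<and> (\<exists>\<rho>. good_rep S m (card S) \<Gamma> \<rho>)"
      by (rule rep_of_coxeter_group[of vs]) (use vs conn x in auto)
    then show "\<exists>\<rho>. good_rep S m N (carrier G) \<rho>"
      "reflection_subgroup S m (carrier G) \<and> finite_index G (carrier G)"
      using reflection_subgroup_gamma finite_index_gamma assms(4) by auto
  qed
  have tree: "\<exists>\<Gamma> \<rho>. reflection_subgroup S m \<Gamma> \<and> finite_index (coxeter_group S m) \<Gamma> \<and> good_rep S m N \<Gamma> \<rho>"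
    if acyc: "\<not> diagram_has_cycle S m"
  proof -
    have "\<exists>a\<in>S. \<forall>y z. ?r a y \<longrightarrow> ?r a z \<longrightarrow> y = z"
    proof (rule leaf_exists[OF fin])
      show "S \<noteq> {}" using x by auto
      show "\<And>s t. ?r s t \<Longrightarrow> s \<in> S \<and> t \<in> S \<and> s \<noteq> t \<and> ?r t s" using sym by auto
      show "\<not> (\<exists>vs. length vs \<ge> 3 \<and> distinct vs \<and> set vs \<subseteq> S \<and>
          (\<forall>i<length vs. ?r (vs ! i) (vs ! ((i + 1) mod length vs))))"
        using acyc unfolding diagram_has_cycle_def adj .
    qed
    then obtain a where a: "a \<in> S" and leaf: "\<And>y z. ?r a y \<Longrightarrow> ?r a z \<Longrightarrow> y = z" by blast
    obtain b where b: "?r a b"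
    proof -
      obtain u w where "?r u w" "w \<in> {a}" using boundary[of "{a}" a] a assms(5) by auto
      then show ?thesis using that[of u] sym by auto
    qed
    obtain u w where uw: "?r u w" "u \<notin> {a, b}" "w \<in> {a, b}" using boundary[of "{a, b}" a] a b assms(5) by auto
    \<comment> \<open>The leaf \<open>a\<close> has no neighbour besides \<open>b\<close>, so the
      third vertex is attached to \<open>b\<close>, as the triangle requires.\<close>
    have "w \<noteq> a" using uw leaf[of b u] b sym[of u a] by auto
    then have u: "?r u b" using uw by auto
    interpret dihedral S m a b 2 by (rule dihedral[OF b]) simp
    have "\<exists>\<rho>. good_rep S m (card S) \<Gamma> \<rho>"
    proof (rule rep_of_doubled_leaf[of u])
      show "s = b" if "s \<in> S" "s \<noteq> a" "m s a = \<infinity>" for s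
        using leaf[of s b] b that sym[of a s] a by auto
    qed (use u uw conn a in auto)
    then show ?thesis using reflection_subgroup_gamma finite_index_gamma assms(4) by auto
  qed
  have large: "\<exists>\<Gamma> \<rho>. reflection_subgroup S m \<Gamma> \<and> finite_index (coxeter_group S m) \<Gamma> \<and> good_rep S m n \<Gamma> \<rho>"
    if n: "N < n" for n
  proof -
    obtain u w where uw: "?r u w" "u \<notin> {x, y}" "w \<in> {x, y}" using boundary[of "{x, y}" x] x y assms(5) by auto
    \<comment> \<open>A vertex with two different neighbours; these may or may not be joined to each
      other.\<close>
    have "\<exists>a b c. ?r a b \<and> ?r a c \<and> c \<noteq> b"
    proof (cases "w = x")
      case True
      then show ?thesis using uw y sym[of u x] by (intro exI[of _ x] exI[of _ y] exI[of _ u]) auto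
    next
      case False
      then show ?thesis using uw y sym[of u y] sym[of x y]
        by (intro exI[of _ y] exI[of _ x] exI[of _ u]) auto
    qed
    then obtain a b c where abc: "?r a b" "?r a c" "c \<noteq> b" by blast
    define j where "j = n - N"
    interpret dihedral S m a b "4 * j + 2" by (rule dihedral[OF abc(1)]) simp
    have "\<exists>\<rho>. good_rep S m n \<Gamma> \<rho>"
      by (rule rep_of_large_dim[of c j]) (use abc conn n assms(4) in \<open>auto simp: j_def\<close>)
    then show ?thesis using reflection_subgroup_gamma finite_index_gamma by blast
  qed
  have "\<exists>\<Gamma> \<rho>. reflection_subgroup S m \<Gamma> \<and> finite_index (coxeter_group S m) \<Gamma> \<and> good_rep S m n \<Gamma> \<rho>"
    if "N \<le> n" for n
    using large[of n] tree W W' that by (cases "n = N") auto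
  moreover have "\<exists>\<rho>. good_rep S m N (carrier (coxeter_group S m)) \<rho>" if "\<not> diagram_is_tree S m"
    using that W assms(2) by (auto simp: diagram_is_tree_def irreducible_coxeter_def)
  ultimately show ?thesis by blast
qed

end
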